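(* Let $d\ge 1$, let $\eta$ be a random vector in $\mathbb{R}^d$ with $\mathbb{E}|\eta|^2<\infty$, and let $m:=\mathbb{E}\,\eta\in\mathbb{R}^d$. Let $\mu_0$ be an arbitrary non-zero finite Borel measure on $\mathbb{R}^d$. Let $(\mu_n)_{n\ge0}$ be a single ball addition random walk (SBARW) Pólya urn with initial composition $\mu_0$ and i.i.d. offsets $\eta_n\in\mathbb{R}^d$ distributed as $\eta$. Then, as $n\to\infty$, almost surely $$\Theta_{\sqrt{\log n},\,m\log n}(\widetilde\mu_n)\longrightarrow N\bigl(0,\mathbb{E}[\eta\eta^{\mathsf t}]\bigr)$$ in $\mathcal{P}(\mathbb{R}^d)$ with the usual weak topology. The same result holds also if $(\mu_n)_{n\ge0}$ is instead a deterministic addition random walk (DARW) Pólya urn with initial composition $\mu_0$ and offset distribution $\mathcal{L}(\eta)$.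
   Context: Vectors are column vectors, and ${}^{\mathsf t}$ denotes transpose. $\mathcal{P}(\mathbb{R}^d)$ is the space of Borel probability measures on $\mathbb{R}^d$. $\mathcal{L}(X)$ is the distribution of $X$, and $\delta_x$ is the point mass at $x$. $N(0,\Sigma)$ is the (possibly degenerate) normal distribution with mean $0$ and covariance matrix $\Sigma$. For a non-zero finite measure $\mu$ on $\mathbb{R}^d$, its normalization is $\widetilde\mu:=\mu(\mathbb{R}^d)^{-1}\mu$. For $a>0$ and $b\in\mathbb{R}^d$, the map $\Theta_{a,b}:\mathcal{P}(\mathbb{R}^d)\to\mathcal{P}(\mathbb{R}^d)$ is defined by: if $X\sim\mu$, then $(X-b)/a\sim\Theta_{a,b}(\mu)$. SBARW Pólya urn: a process $(\mu_n)_{n\ge0}$ of (random) finite measures on $\mathbb{R}^d$ starting from the given $\mu_0$. At each step $n\ge 0$, given everything that has happened so far, a random $X_n\in\mathbb{R}^d$ is drawn with (conditional) distribution $\widetilde\mu_n$, and then $\mu_{n+1}:=\mu_n+\delta_{X_n+\eta_n}$, where $\eta_n$ is a copy of $\eta$ independent of $X_n$ and of the history; thus $(\eta_n)_{n\ge0}$ are i.i.d. DARW Pólya urn: a process $(\mu_n)_{n\ge0}$ of (random) finite measures on $\mathbb{R}^d$ starting from the given $\mu_0$. At each step $n\ge0$, given everything that has happened so far, a random $X_n\in\mathbb{R}^d$ is drawn with (conditional) distribution $\widetilde\mu_n$, and then $\mu_{n+1}:=\mu_n+\mathbf{r}_{X_n}$, where $\mathbf{r}_x:=\mathcal{L}(x+\eta)\in\mathcal{P}(\mathbb{R}^d)$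 for each $x\in\mathbb{R}^d$. *)

theory Defs
  imports "HOL-Probability.Probability"
begin

section \<open>Finite measures\<close>

definition add_measure :: "'a measure \<Rightarrow> 'a measure \<Rightarrow> 'a measure" where
  "add_measure \<mu> \<nu> = measure_of (space \<mu>) (sets \<mu>) (\<lambda>A. emeasure \<mu> A + emeasure \<nu> A)"

lemma space_add_measure [simp]: "space (add_measure \<mu> \<nu>) = space \<mu>"
  and sets_add_measure [simp, measurable_cong]: "sets (add_measure \<mu> \<nu>) = sets \<mu>"
  by (simp_all add: add_measure_def)

lemma emeasure_add_measure:
  assumes "sets \<nu> = sets \<mu>"
  shows "emeasure (add_measure \<mu> \<nu>) A = emeasure \<mu> A + emeasure \<nu> A"
proof (cases "A \<in> sets \<mu>")
  case True
  have "countably_additive (sets \<mu>) (\<lambda>A. emeasure \<mu> A + emeasure \<nu> A)"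
    using assms
    by (auto simp: countably_additive_def suminf_add [symmetric] suminf_emeasure)
  with True show ?thesis
    unfolding add_measure_def
    by (intro emeasure_measure_of_sigma) (auto simp: positive_def sets.sigma_algebra_axioms)
next
  case False
  then show ?thesis using assms by (simp add: emeasure_notin_sets)
qed

definition normalize_measure :: "'a measure \<Rightarrow> 'a measure" where
  "normalize_measure \<mu> = scale_measure (inverse (emeasure \<mu> (space \<mu>))) \<mu>"

lemma prob_space_normalize_measure:
  assumes "finite_measure \<mu>" and "emeasure \<mu> (space \<mu>) \<noteq> 0"
  shows "prob_space (normalize_measure \<mu>)"
proof -
  interpret finite_measure \<mu> by fact
  have "emeasure \<mu> (space \<mu>) / emeasure \<mu> (space \<mu>) = 1"
    using assms(2) by (intro ennreal_divide_self) (auto simp: less_top [symmetric])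
  then show ?thesis
    by (intro prob_spaceI)
       (simp add: normalize_measure_def space_scale_measure divide_ennreal_def mult.commute)
qed

section \<open>Probability measures on Euclidean space\<close>

definition Theta_map :: "real \<Rightarrow> 'a::euclidean_space \<Rightarrow> 'a measure \<Rightarrow> 'a measure" where
  "Theta_map a b \<mu> = distr \<mu> borel (\<lambda>x. (x - b) /\<^sub>R a)"

text \<open>Sequential convergence in the weak topology, tested against bounded continuous functions.
  (\<^const>\<open>weak_conv_m\<close> of the library is restricted to the real line.)\<close>

definition weakly_converges :: "(nat \<Rightarrow> 'a::euclidean_space measure) \<Rightarrow> 'a measure \<Rightarrow> bool" where
  "weakly_converges \<nu> \<nu>' \<longleftrightarrow>
     (\<forall>f::'a \<Rightarrow> real. continuous_on UNIV f \<longrightarrow> bounded (range f) \<longrightarrow>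
        (\<lambda>n. \<integral>x. f x \<partial>\<nu> n) \<longlonglongrightarrow> (\<integral>x. f x \<partial>\<nu>'))"

text \<open>The possibly degenerate normal distribution \<open>N(0, S)\<close> is the law of \<open>A Z\<close>, where \<open>Z\<close> has
  independent standard normal coordinates and \<open>A\<close> is any square root of \<open>S\<close>. Such an \<open>A\<close> exists
  for every symmetric positive semidefinite \<open>S\<close> (\<open>psd_factorization\<close>), and the law does not depend
  on the choice of \<open>A\<close> (\<open>char_centered_normal\<close>).\<close>

definition linear_image_normal :: "real^'d^'d \<Rightarrow> (real^'d) measure" where
  "linear_image_normal A =
     distr (Pi\<^sub>M (UNIV :: 'd set) (\<lambda>_. std_normal_distribution)) borel (\<lambda>z. A *v (\<chi> i. z i))"

definition centered_normal :: "real^'d^'d \<Rightarrow> (real^'d) measure" where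
  "centered_normal S = linear_image_normal (SOME A. A ** transpose A = S)"

lemma psd_factorization_aux:
  fixes S :: "real^'d^'d"
  assumes "finite T" and "transpose S = S" and "\<And>t. t \<bullet> (S *v t) \<ge> 0"
    and "\<And>i j. i \<notin> T \<Longrightarrow> S $ i $ j = 0"
  shows "\<exists>v :: 'd \<Rightarrow> real^'d. \<forall>i j. S $ i $ j = (\<Sum>k\<in>T. v k $ i * v k $ j)"
  using assms
proof (induction T arbitrary: S rule: finite_induct)
  case empty
  then show ?case by simp
next
  case (insert k T)
  have sym: "S $ i $ j = S $ j $ i" for i j
    using insert.prems(1) by (metis transpose_def vec_lambda_beta)
  have self: "(S *v x) \<bullet> y = x \<bullet> (S *v y)" for x y
    using insert.prems(1) by (metis dot_lmul_matrix vector_transpose_matrix)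
  have entry: "(S *v axis j 1) $ i = S $ i $ j" for i j
    by (simp add: matrix_vector_mult_basis column_def)
  have quad: "(t + c *\<^sub>R axis k 1) \<bullet> (S *v (t + c *\<^sub>R axis k 1)) =
      t \<bullet> (S *v t) + 2 * c * (S *v t) $ k + c\<^sup>2 * S $ k $ k" for t c
  proof -
    have "t \<bullet> (S *v axis k 1) = (S *v t) $ k"
      by (simp flip: self add: inner_axis)
    then show ?thesis
      by (simp add: matrix_vector_right_distrib matrix_vector_mult_scaleR inner_add_left
          inner_add_right inner_axis' entry power2_eq_square algebra_simps)
  qed
  show ?case
  proof (cases "S $ k $ k = 0")
    case True
    have "S $ k $ j = 0" for j
    proof (rule ccontr)
      assume nz: "S $ k $ j \<noteq> 0"
      define c where "c = - (S $ j $ j + 1) / (2 * S $ k $ j)"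
      have "2 * c * S $ k $ j = - (S $ j $ j + 1)"
        using nz by (simp add: c_def)
      then show False
        using quad[of "axis j 1" c] insert.prems(2)[of "axis j 1 + c *\<^sub>R axis k 1"] True
        by (simp add: entry inner_axis')
    qed
    then have "\<And>i j. i \<notin> T \<Longrightarrow> S $ i $ j = 0"
      using insert.prems(3) by (metis insert_iff)
    then obtain v :: "'d \<Rightarrow> real^'d" where v: "\<And>i j. S $ i $ j = (\<Sum>l\<in>T. v l $ i * v l $ j)"
      using insert.IH[of S] insert.prems(1,2) by blast
    have "S $ i $ j = (\<Sum>l\<in>insert k T. (v(k := 0)) l $ i * (v(k := 0)) l $ j)" for i j
      using insert.hyps by (simp add: v) (rule sum.cong, auto)
    then show ?thesis by blast
  next
    case False
    have pos: "S $ k $ k > 0"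
      using False insert.prems(2)[of "axis k 1"] by (simp add: inner_axis' entry)
    define S' :: "real^'d^'d" where "S' = (\<chi> i j. S $ i $ j - S $ k $ i * S $ k $ j / S $ k $ k)"
    have S'_mult: "(S' *v t) $ i = (S *v t) $ i - S $ k $ i * (S *v t) $ k / S $ k $ k" for t i
      by (simp add: S'_def matrix_vector_mult_def left_diff_distrib sum_subtractf
          sum_distrib_left sum_divide_distrib algebra_simps)
    have row: "(\<Sum>i\<in>UNIV. t $ i * S $ k $ i) = (S *v t) $ k" for t
      by (simp add: matrix_vector_mult_def mult.commute)
    have "t \<bullet> (S' *v t) \<ge> 0" for t
    proof -
      define s where "s = (S *v t) $ k"
      have "t \<bullet> (S' *v t) = t \<bullet> (S *v t) - (\<Sum>i\<in>UNIV. t $ i * S $ k $ i) * s / S $ k $ k"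
        by (simp add: inner_vec_def S'_mult s_def right_diff_distrib sum_subtractf
            sum_distrib_right sum_divide_distrib mult.assoc)
      also have "\<dots> = t \<bullet> (S *v t) - s * s / S $ k $ k"
        by (simp add: row s_def)
      also have "\<dots> = (t + (- s / S $ k $ k) *\<^sub>R axis k 1) \<bullet>
          (S *v (t + (- s / S $ k $ k) *\<^sub>R axis k 1))"
        unfolding quad using pos by (simp add: s_def [symmetric] field_simps power2_eq_square)
      finally show ?thesis using insert.prems(2) by presburger
    qed
    moreover have "transpose S' = S'"
      by (simp add: S'_def transpose_def vec_eq_iff sym)
    moreover have "S' $ i $ j = 0" if "i \<notin> T" for i j
    proof (cases "i = k")
      case True
      then show ?thesis using pos by (simp add: S'_def)
    next
      case False
      then have "S $ i $ j = 0" "S $ i $ k = 0" using that insert.prems(3) by auto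
      then show ?thesis using sym[of k i] by (simp add: S'_def)
    qed
    ultimately obtain v :: "'d \<Rightarrow> real^'d"
      where v: "\<And>i j. S' $ i $ j = (\<Sum>l\<in>T. v l $ i * v l $ j)"
      using insert.IH[of S'] by blast
    define w where "w = v(k := (1 / sqrt (S $ k $ k)) *\<^sub>R S $ k)"
    have "(\<Sum>l\<in>T. w l $ i * w l $ j) = S' $ i $ j" for i j
      unfolding v using insert.hyps by (intro sum.cong) (auto simp: w_def)
    moreover have "w k $ i * w k $ j = S $ k $ i * S $ k $ j / S $ k $ k" for i j
      using pos by (simp add: w_def)
    ultimately have "S $ i $ j = (\<Sum>l\<in>insert k T. w l $ i * w l $ j)" for i j
      using insert.hyps by (simp add: S'_def)
    then show ?thesis by blast
  qed
qed

lemma psd_factorization: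
  fixes S :: "real^'d^'d"
  assumes "transpose S = S" and "\<And>t. t \<bullet> (S *v t) \<ge> 0"
  shows "\<exists>A :: real^'d^'d. A ** transpose A = S"
proof -
  obtain v :: "'d \<Rightarrow> real^'d" where "\<And>i j. S $ i $ j = (\<Sum>k\<in>UNIV. v k $ i * v k $ j)"
    using psd_factorization_aux[of UNIV S] assms by auto
  then have "(\<chi> i k. v k $ i) ** transpose (\<chi> i k. v k $ i) = S"
    by (simp add: matrix_matrix_mult_def transpose_def vec_eq_iff)
  then show ?thesis by blast
qed

lemma char_linear_image_normal:
  fixes A :: "real^'d^'d"
  shows "(CLINT x|linear_image_normal A. iexp (t \<bullet> x)) =
    complex_of_real (exp (- (t \<bullet> ((A ** transpose A) *v t)) / 2))"
proof -
  define u where "u = transpose A *v t"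
  let ?P = "Pi\<^sub>M (UNIV :: 'd set) (\<lambda>_. std_normal_distribution)"
  interpret N: prob_space std_normal_distribution
    by (rule prob_space_normal_density) simp
  interpret product_prob_space "\<lambda>_. std_normal_distribution" "UNIV :: 'd set"
    by unfold_locales
  have [measurable]: "(\<lambda>z. A *v (\<chi> i. z i)) \<in> borel_measurable ?P"
  proof -
    have "(\<lambda>z. \<Sum>i\<in>UNIV. z i *\<^sub>R column i A) \<in> borel_measurable ?P"
      by measurable
    moreover have "A *v (\<chi> i. z i) = (\<Sum>i\<in>UNIV. z i *\<^sub>R column i A)" for z
      by (simp add: matrix_mult_sum scalar_mult_eq_scaleR)
    ultimately show ?thesis by simp
  qed
  have lin: "t \<bullet> (A *v (\<chi> i. z i)) = (\<Sum>i\<in>UNIV. u $ i * z i)" for z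
    unfolding u_def by (simp flip: dot_lmul_matrix) (simp add: inner_vec_def)
  have "(CLINT x|linear_image_normal A. iexp (t \<bullet> x)) = (CLINT z|?P. iexp (t \<bullet> (A *v (\<chi> i. z i))))"
    unfolding linear_image_normal_def by (subst integral_distr) simp_all
  also have "\<dots> = (CLINT z|?P. (\<Prod>i\<in>UNIV. iexp (u $ i * z i)))"
    unfolding lin by (simp add: exp_sum sum_distrib_left)
  also have "\<dots> = (\<Prod>i\<in>UNIV. (CLINT x|std_normal_distribution. iexp (u $ i * x)))"
    by (rule product_integral_prod) (auto intro!: N.integrable_const_bound[where B = 1])
  also have "\<dots> = (\<Prod>i\<in>UNIV. complex_of_real (exp (- (u $ i)\<^sup>2 / 2)))"
    using char_std_normal_distribution by (simp add: char_def fun_eq_iff)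
  also have "\<dots> = complex_of_real (exp (\<Sum>i\<in>UNIV. - (u $ i)\<^sup>2 / 2))"
    by (simp add: exp_sum)
  also have "(\<Sum>i\<in>UNIV. - (u $ i)\<^sup>2 / 2) = - (u \<bullet> u) / 2"
    by (simp add: inner_vec_def power2_eq_square sum_negf sum_divide_distrib)
  also have "u \<bullet> u = t \<bullet> ((A ** transpose A) *v t)"
    unfolding u_def by (metis dot_lmul_matrix matrix_vector_mul_assoc transpose_matrix_vector)
  finally show ?thesis .
qed

lemma char_centered_normal:
  fixes S :: "real^'d^'d"
  assumes "transpose S = S" and "\<And>t. t \<bullet> (S *v t) \<ge> 0"
  shows "(CLINT x|centered_normal S. iexp (t \<bullet> x)) = complex_of_real (exp (- (t \<bullet> (S *v t)) / 2))"
  unfolding centered_normal_def char_linear_image_normal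
  using someI_ex[OF psd_factorization[OF assms]] by simp

definition second_moment_matrix :: "'p measure \<Rightarrow> ('p \<Rightarrow> real^'d) \<Rightarrow> real^'d^'d" where
  "second_moment_matrix P \<eta> = (\<chi> i j. \<integral>\<omega>. \<eta> \<omega> $ i * \<eta> \<omega> $ j \<partial>P)"

section \<open>Polya urns\<close>

text \<open>The sigma-algebra generated by a set of random variables.\<close>

definition sigma_rv :: "'w measure \<Rightarrow> ('w \<Rightarrow> 'a::topological_space) set \<Rightarrow> 'w measure" where
  "sigma_rv M Ys = sigma (space M) {Y -` B \<inter> space M | Y B. Y \<in> Ys \<and> B \<in> sets borel}"

lemma subalgebra_sigma_rv:
  assumes "\<And>Y. Y \<in> Ys \<Longrightarrow> Y \<in> borel_measurable M"
  shows "subalgebra M (sigma_rv M Ys)"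
proof -
  have "{Y -` B \<inter> space M | Y B. Y \<in> Ys \<and> B \<in> sets borel} \<subseteq> sets M"
    using assms by (auto intro: measurable_sets)
  moreover from this have "{Y -` B \<inter> space M | Y B. Y \<in> Ys \<and> B \<in> sets borel} \<subseteq> Pow (space M)"
    using sets.space_closed by blast
  ultimately show ?thesis
    by (simp add: subalgebra_def sigma_rv_def sets.sigma_sets_subset)
qed

definition has_cond_law ::
  "'w measure \<Rightarrow> 'w measure \<Rightarrow> ('w \<Rightarrow> 'a::topological_space) \<Rightarrow> ('w \<Rightarrow> 'a measure) \<Rightarrow> bool" where
  "has_cond_law M F X \<kappa> \<longleftrightarrow>
     (\<forall>B\<in>sets borel. AE \<omega> in M.
        real_cond_exp M F (\<lambda>\<omega>'. indicator B (X \<omega>')) \<omega> = measure (\<kappa> \<omega>) B)"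

text \<open>In both urns \<open>\<mu>\<^sub>0\<close> is deterministic and \<open>\<mu>\<^sub>1, \<dots>, \<mu>\<^sub>n\<close> are functions of the earlier draws (and
  offsets), so the latter generate everything that has happened before step \<open>n\<close>. The measure \<open>\<nu>\<close> is
  the law of the offset.\<close>

definition sbarw_urn ::
  "'w measure \<Rightarrow> 'a::euclidean_space measure \<Rightarrow> 'a measure \<Rightarrow> (nat \<Rightarrow> 'w \<Rightarrow> 'a measure) \<Rightarrow> bool" where
  "sbarw_urn M \<mu>\<^sub>0 \<nu> \<mu> \<longleftrightarrow> prob_space M \<and>
     (\<exists>X e :: nat \<Rightarrow> 'w \<Rightarrow> 'a.
        (\<forall>n. X n \<in> borel_measurable M \<and> e n \<in> borel_measurable M) \<and>
        (\<forall>\<omega>\<in>space M. \<mu> 0 \<omega> = \<mu>\<^sub>0) \<and>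
        (\<forall>n. has_cond_law M (sigma_rv M (X ` {..<n} \<union> e ` {..<n})) (X n)
               (\<lambda>\<omega>. normalize_measure (\<mu> n \<omega>))) \<and>
        (\<forall>n. distr M borel (e n) = \<nu>) \<and>
        (\<forall>n. prob_space.indep_set M (sets (sigma_rv M {e n}))
               (sets (sigma_rv M (X ` {..n} \<union> e ` {..<n})))) \<and>
        (\<forall>n. \<forall>\<omega>\<in>space M. \<mu> (Suc n) \<omega> = add_measure (\<mu> n \<omega>) (return borel (X n \<omega> + e n \<omega>))))"

definition darw_urn ::
  "'w measure \<Rightarrow> 'a::euclidean_space measure \<Rightarrow> 'a measure \<Rightarrow> (nat \<Rightarrow> 'w \<Rightarrow> 'a measure) \<Rightarrow> bool" where
  "darw_urn M \<mu>\<^sub>0 \<nu> \<mu> \<longleftrightarrow> prob_space M \<and>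
     (\<exists>X :: nat \<Rightarrow> 'w \<Rightarrow> 'a.
        (\<forall>n. X n \<in> borel_measurable M) \<and>
        (\<forall>\<omega>\<in>space M. \<mu> 0 \<omega> = \<mu>\<^sub>0) \<and>
        (\<forall>n. has_cond_law M (sigma_rv M (X ` {..<n})) (X n)
               (\<lambda>\<omega>. normalize_measure (\<mu> n \<omega>))) \<and>
        (\<forall>n. \<forall>\<omega>\<in>space M. \<mu> (Suc n) \<omega> = add_measure (\<mu> n \<omega>) (distr \<nu> borel (\<lambda>y. X n \<omega> + y))))"

end

(* Both urns satisfy mu_(n+1) = mu_n + rho_n with random probability measures rho_n whose
   conditional expectation, given the past, is the normalized mu_n convolved with the offset law.
   Write m_n(f) for the integral of f against the normalized mu_n and W_n for the total mass.
   Predicting m_n(f) from time K amounts to applying to f the averaging operators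
   f + (Q f - f) / W_(k+1), K <= k < n, where Q f (x) = E f(x + eta), and the prediction error has
   second moment O(1/K) for every f bounded by 1. Along n_j ~ exp(sqrt j) and K_j = (j+1)^2 the errors
   tend to 0 almost surely. For f(x) = exp(i t x) the predictor is explicit: it multiplies f by
   a product of 1 + (phi(t) - 1) / W_(k+1), with phi the characteristic function of eta; at frequency
   t / sqrt(ln n) this product is close to n^(phi(t / sqrt(ln n)) - 1), and expanding phi to second
   order gives the Gaussian limit. The mass that is already far from the origin at time K_j is
   negligible because m_n(min 1 (|x| / R_n)) is a supermartingale up to a summable drift, so that no
   moment of mu_0 is needed. Quadratic test functions give tightness, consecutive n_j have ratio
   tending to 1, which fills the gaps, and a version of Levy's continuity theorem for countably many
   frequencies concludes. *)
theory Submission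
  imports Defs "HOL-Real_Asymp.Real_Asymp"
begin

section \<open>Weak convergence from characteristic functions and tightness\<close>

text \<open>Two requirements compete. A prediction must start at times K_j with summable inverses,
  but whatever the urn has collected up to K_j, of logarithmic size ln K_j, must be invisible at the
  scale sqrt(ln n_j). Polynomial K_j and n_j growing like exp(sqrt j) meet both, since ln j is
  o(j^(1/4)), and the logarithms of successive n_j still differ by o(1). The product of averaging
  factors is close to exp(h (phi - 1)) with h close to ln n: the characteristic function of a
  compound Poisson sum with about ln n jumps. The number of jumps fluctuates too, which is why the
  limit carries the uncentred second moments of \<eta> and not its covariance. Test functions stay
  bounded throughout. Quadratic functions serve only as upper bounds of bounded ones, because
  \<open>\<mu>\<^sub>0\<close> may give them an infinite integral.\<close>

inductive_set trig_sums :: "'a::real_inner set \<Rightarrow> ('a \<Rightarrow> real) set" for D where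
  wave: "s \<in> D \<Longrightarrow> (\<lambda>x. c * cos (s \<bullet> x + a)) \<in> trig_sums D"
| add: "f \<in> trig_sums D \<Longrightarrow> g \<in> trig_sums D \<Longrightarrow> (\<lambda>x. f x + g x) \<in> trig_sums D"

lemma trig_sums_continuous: "f \<in> trig_sums D \<Longrightarrow> continuous_on A f"
  by (induction rule: trig_sums.induct) (auto intro!: continuous_intros)

lemma trig_sums_bounded: "f \<in> trig_sums D \<Longrightarrow> \<exists>B. \<forall>x. \<bar>f x\<bar> \<le> B"
proof (induction rule: trig_sums.induct)
  case (wave s c a)
  show ?case
    by (rule exI[of _ "\<bar>c\<bar>"]) (simp add: abs_mult mult_left_le)
next
  case (add f g)
  then obtain B C where "\<forall>x. \<bar>f x\<bar> \<le> B" "\<forall>x. \<bar>g x\<bar> \<le> C" by blast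
  then have "\<bar>f x + g x\<bar> \<le> B + C" for x by (intro order_trans[OF abs_triangle_ineq] add_mono) auto
  then show ?case by blast
qed

text \<open>The product-to-sum formula: frequencies are added and subtracted, and the free phases
  absorb the rest, so that a group of frequencies yields an algebra.\<close>

lemma trig_sums_mult:
  assumes "\<And>s t. s \<in> D \<Longrightarrow> t \<in> D \<Longrightarrow> s + t \<in> D" and "\<And>s. s \<in> D \<Longrightarrow> - s \<in> D"
    and "f \<in> trig_sums D" and "g \<in> trig_sums D"
  shows "(\<lambda>x. f x * g x) \<in> trig_sums D"
  using assms(3)
proof (induction rule: trig_sums.induct)
  case (wave s c a)
  show ?case using assms(4)
  proof (induction rule: trig_sums.induct)
    case (wave t d b)
    have eq: "c * cos (s \<bullet> x + a) * (d * cos (t \<bullet> x + b)) =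
        c * d / 2 * cos ((s + - t) \<bullet> x + (a - b)) + c * d / 2 * cos ((s + t) \<bullet> x + (a + b))" for x
    proof -
      have 1: "(s + - t) \<bullet> x + (a - b) = (s \<bullet> x + a) - (t \<bullet> x + b)"
        and 2: "(s + t) \<bullet> x + (a + b) = (s \<bullet> x + a) + (t \<bullet> x + b)"
        by (simp_all add: inner_add_left inner_diff_left)
      have "c * cos u * (d * cos v) = c * d / 2 * cos (u - v) + c * d / 2 * cos (u + v)" for u v
        unfolding cos_diff cos_add by (simp add: algebra_simps)
      then show ?thesis unfolding 1 2 .
    qed
    show ?case unfolding eq
      by (intro trig_sums.add trig_sums.wave assms(1,2) wave \<open>s \<in> D\<close>)
  next
    case (add g h)
    then show ?case by (simp add: distrib_left trig_sums.add)
  qed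
next
  case (add f h)
  then show ?case by (simp add: distrib_right trig_sums.add)
qed

text \<open>The functions \<open>cos (\<pi> (x\<^sub>b + L) / 2L)\<close> separate the points of the cube \<open>[-L, L]\<^sup>d\<close>, and each of their
  polynomials takes on the whole space only the values that it takes on the cube. Hence the approximation
  comes with a global bound.\<close>

lemma trig_sums_approx:
  fixes f :: "'a::euclidean_space \<Rightarrow> real"
  assumes add: "\<And>s t. s \<in> D \<Longrightarrow> t \<in> D \<Longrightarrow> s + t \<in> D" and neg: "\<And>s. s \<in> D \<Longrightarrow> - s \<in> D"
    and L: "L > 0" and D: "\<And>b. b \<in> Basis \<Longrightarrow> (pi / (2 * L)) *\<^sub>R b \<in> D"
    and f: "continuous_on UNIV f" and B: "\<And>x. \<bar>f x\<bar> \<le> B" and \<epsilon>: "\<epsilon> > 0"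
  obtains p where "p \<in> trig_sums D" and "\<And>x. norm x \<le> L \<Longrightarrow> \<bar>f x - p x\<bar> < \<epsilon>"
    and "\<And>x. \<bar>p x\<bar> \<le> B + \<epsilon>"
proof -
  define c where "c b x = cos (pi / (2 * L) * (x \<bullet> b + L))" for b x :: 'a
  define K :: "'a set" where "K = cbox (- L *\<^sub>R One) (L *\<^sub>R One)"
  have K: "x \<in> K \<longleftrightarrow> (\<forall>b\<in>Basis. - L \<le> x \<bullet> b \<and> x \<bullet> b \<le> L)" for x
    by (simp add: K_def mem_box)
  \<comment> \<open>Dependence on x through the cosines \<open>c b\<close> alone is built into the
    algebra as an invariance; this is what later carries the bound on the cube to the whole
    space.\<close>
  define R where "R = {p \<in> trig_sums D. \<forall>x y. (\<forall>b\<in>Basis. c b x = c b y) \<longrightarrow> p x = p y}"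
  have zero: "0 \<in> D"
  proof -
    obtain b :: 'a where "b \<in> Basis" using nonempty_Basis by blast
    from add[OF D[OF this] neg[OF D[OF this]]] show ?thesis by simp
  qed
  have arg: "0 \<le> pi / (2 * L) * (x \<bullet> b + L)" "pi / (2 * L) * (x \<bullet> b + L) \<le> pi"
    if "x \<in> K" "b \<in> Basis" for x b
  proof -
    have x: "- L \<le> x \<bullet> b" "x \<bullet> b \<le> L" using that K by auto
    show "0 \<le> pi / (2 * L) * (x \<bullet> b + L)" using x L by simp
    have "pi / (2 * L) * (x \<bullet> b + L) \<le> pi / (2 * L) * (2 * L)"
      using x L by (intro mult_left_mono) auto
    then show "pi / (2 * L) * (x \<bullet> b + L) \<le> pi" using L by simp
  qed
  interpret function_ring_on R K
  proof
    show "compact K" by (simp add: K_def compact_cbox)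
    show "continuous_on K f" if "f \<in> R" for f
      using that trig_sums_continuous by (auto simp: R_def)
    show "(\<lambda>x. f x + g x) \<in> R" if "f \<in> R" "g \<in> R" for f g
      unfolding R_def mem_Collect_eq
    proof (intro conjI allI impI)
      show "(\<lambda>x. f x + g x) \<in> trig_sums D" using that by (auto simp: R_def intro: trig_sums.add)
      show "f x + g x = f y + g y" if "\<forall>b\<in>Basis. c b x = c b y" for x y
      proof -
        have "f x = f y" "g x = g y" using \<open>f \<in> R\<close> \<open>g \<in> R\<close> that unfolding R_def by blast+
        then show ?thesis by simp
      qed
    qed
    show "(\<lambda>x. f x * g x) \<in> R" if "f \<in> R" "g \<in> R" for f g
      unfolding R_def mem_Collect_eq
    proof (intro conjI allI impI)
      show "(\<lambda>x. f x * g x) \<in> trig_sums D"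
        using that by (intro trig_sums_mult add neg) (auto simp: R_def)
      show "f x * g x = f y * g y" if "\<forall>b\<in>Basis. c b x = c b y" for x y
      proof -
        have "f x = f y" "g x = g y" using \<open>f \<in> R\<close> \<open>g \<in> R\<close> that unfolding R_def by blast+
        then show ?thesis by simp
      qed
    qed
    show "(\<lambda>_. k) \<in> R" for k
      using trig_sums.wave[OF zero, of k 0] by (simp add: R_def)
    show "\<exists>f\<in>R. f x \<noteq> f y" if xy: "x \<in> K" "y \<in> K" "x \<noteq> y" for x y
    proof -
      obtain b where b: "b \<in> Basis" "x \<bullet> b \<noteq> y \<bullet> b" using \<open>x \<noteq> y\<close> by (auto simp: euclidean_eq_iff[of x y])
      have "c b x \<noteq> c b y"
      proof
        assume "c b x = c b y"
        then have "cos (pi / (2 * L) * (x \<bullet> b + L)) = cos (pi / (2 * L) * (y \<bullet> b + L))"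
          unfolding c_def .
        then have "pi / (2 * L) * (x \<bullet> b + L) = pi / (2 * L) * (y \<bullet> b + L)"
          by (rule cos_inj_pi[OF arg[OF xy(1) b(1)] arg[OF xy(2) b(1)]])
        then show False using L b by simp
      qed
      moreover have "c b \<in> R"
      proof -
        \<comment> \<open>The shift by L turns into the phase pi / 2.\<close>
        have "c b = (\<lambda>x. 1 * cos (((pi / (2 * L)) *\<^sub>R b) \<bullet> x + pi / 2))"
          using L by (simp add: c_def fun_eq_iff distrib_left inner_commute)
        then have "c b \<in> trig_sums D" using trig_sums.wave[OF D[OF b(1)], of 1 "pi / 2"] by simp
        then show ?thesis using b(1) by (auto simp: R_def)
      qed
      ultimately show ?thesis by blast
    qed
  qed
  obtain p where p: "p \<in> R" "\<And>x. x \<in> K \<Longrightarrow> \<bar>f x - p x\<bar> < \<epsilon>"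
    using Stone_Weierstrass_basic[OF continuous_on_subset[OF f subset_UNIV] \<epsilon>] by blast
  have ex: "\<exists>y\<in>K. p y = p x" for x
  proof -
    \<comment> \<open>Folding x back into the cube: on the cube the argument of the cosine runs over
      [0, pi], where arccos inverts it, so the folded point has the same cosines as x.\<close>
    define u where "u b = 2 * L / pi * arccos (c b x) - L" for b
    define y where "y = (\<Sum>b\<in>Basis. u b *\<^sub>R b)"
    have y: "y \<bullet> b = u b" if "b \<in> Basis" for b
      using that by (simp add: y_def)
    have ac: "0 \<le> arccos (c b x)" "arccos (c b x) \<le> pi" for b
      by (auto simp: c_def intro!: arccos_lbound arccos_ubound)
    have "y \<in> K"
    proof -
      have "2 * L / pi * arccos (c b x) \<le> 2 * L / pi * pi" for b
        using L ac by (intro mult_left_mono) auto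
      moreover have "0 \<le> 2 * L / pi * arccos (c b x)" for b
        using L ac by simp
      ultimately show ?thesis unfolding K using y by (auto simp: u_def)
    qed
    moreover have "c b y = c b x" if "b \<in> Basis" for b
      using L that by (simp add: y u_def c_def[of b y]) (simp add: c_def)
    ultimately show ?thesis using p(1) unfolding R_def by blast
  qed
  have "\<bar>p x\<bar> \<le> B + \<epsilon>" for x
  proof -
    from ex[of x] obtain y where "y \<in> K" "p y = p x" by blast
    then show ?thesis using p(2)[of y] B[of y] by linarith
  qed
  moreover have "x \<in> K" if "norm x \<le> L" for x
    unfolding K
  proof
    fix b :: 'a assume "b \<in> Basis"
    from Basis_le_norm[OF this, of x] that show "- L \<le> x \<bullet> b \<and> x \<bullet> b \<le> L" by auto
  qed
  ultimately show ?thesis using p that by (auto simp: R_def)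
qed

lemma trig_sums_integral_tendsto:
  fixes N :: "nat \<Rightarrow> 'a::euclidean_space measure"
  assumes N: "\<And>n. prob_space (N n)" "\<And>n. sets (N n) = sets borel"
    and G: "prob_space G" "sets G = sets borel"
    and cos: "\<And>s. s \<in> D \<Longrightarrow> (\<lambda>n. \<integral>x. cos (s \<bullet> x) \<partial>N n) \<longlonglongrightarrow> (\<integral>x. cos (s \<bullet> x) \<partial>G)"
    and sin: "\<And>s. s \<in> D \<Longrightarrow> (\<lambda>n. \<integral>x. sin (s \<bullet> x) \<partial>N n) \<longlonglongrightarrow> (\<integral>x. sin (s \<bullet> x) \<partial>G)"
    and p: "p \<in> trig_sums D"
  shows "(\<lambda>n. \<integral>x. p x \<partial>N n) \<longlonglongrightarrow> (\<integral>x. p x \<partial>G)"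
proof -
  have int: "integrable M f"
    if f: "f \<in> trig_sums D" and M: "prob_space M" "sets M = sets borel" for M :: "'a measure" and f
  proof -
    interpret prob_space M by fact
    obtain B where "\<forall>x. \<bar>f x\<bar> \<le> B" using trig_sums_bounded[OF f] by blast
    moreover have "f \<in> borel_measurable M"
      using borel_measurable_continuous_onI[OF trig_sums_continuous[OF f]]
      by (simp cong: measurable_cong_sets add: M(2))
    ultimately show ?thesis by (intro integrable_const_bound[where B = B]) auto
  qed
  show ?thesis using p
  proof (induction rule: trig_sums.induct)
    case (wave s c a)
    have eq: "(\<integral>x. c * cos (s \<bullet> x + a) \<partial>M) =
        c * (cos a * (\<integral>x. cos (s \<bullet> x) \<partial>M) - sin a * (\<integral>x. sin (s \<bullet> x) \<partial>M))"
      if "prob_space M" "sets M = sets borel" for M :: "'a measure"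
    proof -
      have "integrable M (\<lambda>x. cos (s \<bullet> x))"
        using int[OF trig_sums.wave[OF wave, of 1 0] that] by simp
      moreover have "integrable M (\<lambda>x. sin (s \<bullet> x))"
        using int[OF trig_sums.wave[OF wave, of 1 "- (pi / 2)"] that] by (simp add: cos_diff)
      ultimately show ?thesis by (simp add: cos_add mult.commute)
    qed
    show ?case unfolding eq[OF N] eq[OF G]
      by (intro tendsto_intros cos sin wave)
  next
    case (add f g)
    have "(\<integral>x. f x + g x \<partial>M) = (\<integral>x. f x \<partial>M) + (\<integral>x. g x \<partial>M)"
      if "prob_space M" "sets M = sets borel" for M :: "'a measure"
      using int[OF add.hyps(1) that] int[OF add.hyps(2) that] by simp
    then show ?case using add N G by (simp add: tendsto_add)
  qed
qed

lemma prob_space_tight_norm: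
  fixes M :: "'a::euclidean_space measure"
  assumes "prob_space M" and "sets M = sets borel" and "\<epsilon> > 0"
  shows "\<exists>R. measure M {x. norm x > R} < \<epsilon>"
proof -
  interpret prob_space M by fact
  define A where "A n = {x :: 'a. norm x > real n}" for n
  have "(\<lambda>n. measure M (A n)) \<longlonglongrightarrow> measure M (\<Inter>n. A n)"
    by (intro finite_Lim_measure_decseq)
       (auto simp: A_def decseq_def assms(2) intro!: borel_measurable_less)
  moreover have "(\<Inter>n. A n) = {}"
  proof -
    have "x \<notin> (\<Inter>n. A n)" for x
    proof -
      obtain n where "norm x \<le> real n" using real_arch_simple[of "norm x"] by blast
      then have "x \<notin> A n" by (simp add: A_def)
      then show ?thesis by blast
    qed
    then show ?thesis by blast
  qed
  ultimately have "eventually (\<lambda>n. measure M (A n) < \<epsilon>) sequentially"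
    using assms(3) by (intro order_tendstoD(2)) auto
  then show ?thesis
    unfolding A_def by (auto simp: eventually_sequentially)
qed

text \<open>On a ball of radius \<open>L\<close> the function f is close to a trigonometric sum p
  whose integrals converge. Outside the ball tightness leaves little mass, and there the global
  bound on p limits the damage. Only the radii L = 1, 2, ... are used, so a countable
  \<open>D\<close> can supply all the frequencies pi / (2 L).\<close>

lemma weakly_converges_if_trig_tight:
  fixes N :: "nat \<Rightarrow> 'a::euclidean_space measure"
  assumes N: "\<And>n. prob_space (N n)" "\<And>n. sets (N n) = sets borel"
    and G: "prob_space G" "sets G = sets borel"
    and add: "\<And>s t. s \<in> D \<Longrightarrow> t \<in> D \<Longrightarrow> s + t \<in> D" and neg: "\<And>s. s \<in> D \<Longrightarrow> - s \<in> D"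
    and D: "\<And>b (n :: nat). b \<in> Basis \<Longrightarrow> (pi / (2 * real (Suc n))) *\<^sub>R b \<in> D"
    and cos: "\<And>s. s \<in> D \<Longrightarrow> (\<lambda>n. \<integral>x. cos (s \<bullet> x) \<partial>N n) \<longlonglongrightarrow> (\<integral>x. cos (s \<bullet> x) \<partial>G)"
    and sin: "\<And>s. s \<in> D \<Longrightarrow> (\<lambda>n. \<integral>x. sin (s \<bullet> x) \<partial>N n) \<longlonglongrightarrow> (\<integral>x. sin (s \<bullet> x) \<partial>G)"
    and tight: "\<And>\<epsilon>. \<epsilon> > 0 \<Longrightarrow> \<exists>R. \<forall>\<^sub>F n in sequentially. measure (N n) {x. norm x > R} < \<epsilon>"
  shows "weakly_converges N G"
  unfolding weakly_converges_def
proof (intro allI impI)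
  fix f :: "'a \<Rightarrow> real" assume f: "continuous_on UNIV f" and "bounded (range f)"
  then obtain B where B: "\<And>x. \<bar>f x\<bar> \<le> B" "B > 0"
    unfolding bounded_pos by auto
  have fm: "f \<in> borel_measurable borel" using f by (rule borel_measurable_continuous_onI)
  show "(\<lambda>n. \<integral>x. f x \<partial>N n) \<longlonglongrightarrow> (\<integral>x. f x \<partial>G)"
  proof (rule LIMSEQ_I)
    fix r :: real assume r: "r > 0"
    \<comment> \<open>Replacing f by p costs (2 B + 2) \<epsilon> under \<open>N n\<close> and again
      under \<open>G\<close>, and the convergence of the integrals of p costs \<epsilon>: in all 4 B
      + 5, less than 2 (2 B + 3).\<close>
    define \<epsilon> where "\<epsilon> = min 1 (r / (2 * (2 * B + 3)))"
    have \<epsilon>: "\<epsilon> > 0" "\<epsilon> \<le> 1" using r B(2) by (auto simp: \<epsilon>_def)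
    have "\<epsilon> \<le> r / (2 * (2 * B + 3))" by (simp add: \<epsilon>_def)
    then have \<epsilon>r: "2 * (2 * B + 3) * \<epsilon> \<le> r" using B(2) by (simp add: pos_le_divide_eq mult.commute)
    obtain R where R: "\<forall>\<^sub>F n in sequentially. measure (N n) {x. norm x > R} < \<epsilon>"
      using tight \<epsilon>(1) by blast
    obtain R' where R': "measure G {x. norm x > R'} < \<epsilon>"
      using prob_space_tight_norm[OF G \<epsilon>(1)] by blast
    obtain k :: nat where "max R R' < real k" using reals_Archimedean2 by blast
    define L where "L = real (Suc k)"
    have L: "L > 0" "R \<le> L" "R' \<le> L" using \<open>max R R' < real k\<close> by (auto simp: L_def)
    have DL: "b \<in> Basis \<Longrightarrow> (pi / (2 * L)) *\<^sub>R b \<in> D" for b unfolding L_def by (rule D)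
    obtain p where p: "p \<in> trig_sums D" "\<And>x. norm x \<le> L \<Longrightarrow> \<bar>f x - p x\<bar> < \<epsilon>"
      "\<And>x. \<bar>p x\<bar> \<le> B + \<epsilon>"
      using trig_sums_approx[OF add neg L(1) DL f B(1) \<epsilon>(1)] by blast
    have pm: "p \<in> borel_measurable borel"
      using trig_sums_continuous[OF p(1)] by (rule borel_measurable_continuous_onI)
    have close: "\<bar>(\<integral>x. f x \<partial>M) - (\<integral>x. p x \<partial>M)\<bar> \<le> (2 * B + 2) * \<epsilon>"
      if "prob_space M" "sets M = sets borel" "measure M {x. norm x > L'} < \<epsilon>" "L' \<le> L"
      for M :: "'a measure" and L'
    proof -
      interpret prob_space M by fact
      have sp: "space M = UNIV" using sets_eq_imp_space_eq[OF that(2)] by simp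
      have [measurable]: "f \<in> borel_measurable M" "p \<in> borel_measurable M"
        using fm pm by (simp_all cong: measurable_cong_sets add: that(2))
      have ms: "{x. norm x > l} \<in> sets M" for l unfolding that(2) by measurable
      have int: "integrable M f" "integrable M p"
        using B p(3) by (auto intro: integrable_const_bound[where B = B] integrable_const_bound[where B = "B + \<epsilon>"])
      have "measure M {x. norm x > L} \<le> measure M {x. norm x > L'}"
        using that(4) ms by (intro finite_measure_mono) auto
      then have m: "measure M {x. norm x > L} \<le> \<epsilon>" using that(3) by simp
      have "\<bar>(\<integral>x. f x \<partial>M) - (\<integral>x. p x \<partial>M)\<bar> = \<bar>\<integral>x. f x - p x \<partial>M\<bar>"
        using int by simp
      also have "\<dots> \<le> (\<integral>x. \<bar>f x - p x\<bar> \<partial>M)" by (rule integral_abs_bound)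
      also have "\<dots> \<le> (\<integral>x. \<epsilon> + (2 * B + 1) * indicator {x. norm x > L} x \<partial>M)"
      proof (intro integral_mono)
        show "integrable M (\<lambda>x. \<bar>f x - p x\<bar>)" using int by simp
        show "integrable M (\<lambda>x. \<epsilon> + (2 * B + 1) * indicator {x. norm x > L} x)"
          using ms by (intro Bochner_Integration.integrable_add integrable_mult_right
              integrable_real_indicator) (auto simp: less_top[symmetric])
        show "\<bar>f x - p x\<bar> \<le> \<epsilon> + (2 * B + 1) * indicator {x. norm x > L} x" for x
        proof (cases "norm x > L")
          case True
          then show ?thesis using B(1)[of x] p(3)[of x] \<epsilon> by simp
        next
          case False
          then show ?thesis using p(2)[of x] by simp
        qed
      qed
      also have "\<dots> = \<epsilon> + (2 * B + 1) * measure M {x. norm x > L}"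
        using ms prob_space by (subst Bochner_Integration.integral_add)
           (auto simp: sp less_top[symmetric] intro!: integrable_mult_right integrable_real_indicator)
      also have "\<dots> \<le> \<epsilon> + (2 * B + 1) * \<epsilon>"
        using m B(2) by (intro add_left_mono mult_left_mono) auto
      finally show ?thesis by (simp add: algebra_simps)
    qed
    have "\<forall>\<^sub>F n in sequentially. \<bar>(\<integral>x. p x \<partial>N n) - (\<integral>x. p x \<partial>G)\<bar> < \<epsilon>"
      using trig_sums_integral_tendsto[OF N G cos sin p(1)] \<epsilon>(1) tendstoD by (fastforce simp: dist_real_def)
    with R have "\<forall>\<^sub>F n in sequentially. norm ((\<integral>x. f x \<partial>N n) - (\<integral>x. f x \<partial>G)) < r"
    proof eventually_elim
      case (elim n)
      have "(2 * B + 2) * \<epsilon> + (2 * B + 2) * \<epsilon> + \<epsilon> < r"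
      proof -
        have "(2 * B + 2) * \<epsilon> + (2 * B + 2) * \<epsilon> + \<epsilon> < 2 * (2 * B + 3) * \<epsilon>"
          using \<epsilon>(1) B(2) by (simp add: algebra_simps)
        then show ?thesis using \<epsilon>r by simp
      qed
      then show ?case
        using close[OF N elim(1) L(2)] close[OF G R' L(3)] elim(2) unfolding real_norm_def by linarith
    qed
    then show "\<exists>no. \<forall>n\<ge>no. norm ((\<integral>x. f x \<partial>N n) - (\<integral>x. f x \<partial>G)) < r"
      by (simp add: eventually_sequentially)
  qed
qed

section \<open>Almost sure convergence to zero\<close>

text \<open>By Tonelli the sum of the squares has finite expectation, hence is almost surely finite,
  and its terms tend to 0.\<close>

lemma (in prob_space) AE_tendsto_zero_if_summable_second_moments:
  fixes Y :: "nat \<Rightarrow> 'a \<Rightarrow> real"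
  assumes Y: "\<And>j. Y j \<in> borel_measurable M" and int: "\<And>j. integrable M (\<lambda>\<omega>. (Y j \<omega>)\<^sup>2)"
    and b: "\<And>j. expectation (\<lambda>\<omega>. (Y j \<omega>)\<^sup>2) \<le> b j" "summable b"
  shows "AE \<omega> in M. (\<lambda>j. Y j \<omega>) \<longlonglongrightarrow> 0"
proof -
  note [measurable] = Y
  have nonneg: "0 \<le> expectation (\<lambda>\<omega>. (Y j \<omega>)\<^sup>2)" for j by simp
  have "(\<integral>\<^sup>+\<omega>. (\<Sum>j. ennreal ((Y j \<omega>)\<^sup>2)) \<partial>M) = (\<Sum>j. \<integral>\<^sup>+\<omega>. ennreal ((Y j \<omega>)\<^sup>2) \<partial>M)"
    by (intro nn_integral_suminf) measurable
  also have "\<dots> = (\<Sum>j. ennreal (expectation (\<lambda>\<omega>. (Y j \<omega>)\<^sup>2)))"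
    by (intro suminf_cong nn_integral_eq_integral int) simp
  also have "\<dots> \<noteq> top"
  proof -
    have "summable (\<lambda>j. expectation (\<lambda>\<omega>. (Y j \<omega>)\<^sup>2))"
      using b nonneg by (intro summable_comparison_test[OF _ b(2)]) auto
    then show ?thesis using nonneg by (simp add: suminf_ennreal2 del: suminf_ennreal_eq)
  qed
  finally have "AE \<omega> in M. (\<Sum>j. ennreal ((Y j \<omega>)\<^sup>2)) \<noteq> \<infinity>"
    by (intro nn_integral_PInf_AE) auto
  then show ?thesis
  proof eventually_elim
    case (elim \<omega>)
    then have "summable (\<lambda>j. (Y j \<omega>)\<^sup>2)"
      by (intro summable_suminf_not_top) auto
    from summable_LIMSEQ_zero[OF this] have "(\<lambda>j. sqrt ((Y j \<omega>)\<^sup>2)) \<longlonglongrightarrow> sqrt 0"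
      by (intro tendsto_intros)
    then show ?case by (simp add: tendsto_rabs_zero_iff)
  qed
qed

text \<open>The maximal inequality, with the drift \<open>c\<close> carried along; it is the fact \<open>max\<close> below.\<close>

lemma (in prob_space) almost_supermartingale_AE_tendsto_zero:
  fixes V :: "nat \<Rightarrow> 'a \<Rightarrow> real"
  assumes sub: "\<And>n. subalgebra M (F n)" and mono: "\<And>n. sets (F n) \<subseteq> sets (F (Suc n))"
    and V: "\<And>n. V n \<in> borel_measurable (F n)" "\<And>n. integrable M (V n)" "\<And>n \<omega>. V n \<omega> \<ge> 0"
    and step: "\<And>n A. A \<in> sets (F n) \<Longrightarrow>
      expectation (\<lambda>\<omega>. indicator A \<omega> * V (Suc n) \<omega>) \<le> expectation (\<lambda>\<omega>. indicator A \<omega> * V n \<omega>) + c n"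
    and c: "\<And>n. c n \<ge> 0" "summable c"
    and lim: "(\<lambda>n. expectation (V n)) \<longlonglongrightarrow> 0"
  shows "AE \<omega> in M. (\<lambda>n. V n \<omega>) \<longlonglongrightarrow> 0"
proof -
  have spF: "space (F n) = space M" and setF: "A \<in> sets (F n) \<Longrightarrow> A \<in> sets M" for n A
    using sub[of n] by (auto simp: subalgebra_def)
  have mono': "sets (F m) \<subseteq> sets (F n)" if "m \<le> n" for m n
    using lift_Suc_mono_le[of "\<lambda>n. sets (F n)", OF mono that] .
  have Vm [measurable]: "V n \<in> borel_measurable M" for n
    using V(2) by (rule borel_measurable_integrable)
  have intI: "integrable M (\<lambda>\<omega>. indicator A \<omega> * V n \<omega>)" if "A \<in> sets M" for A n
    using integrable_mult_indicator[OF that V(2)[of n]] by simp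
  have AE_\<epsilon>: "AE \<omega> in M. \<forall>\<^sub>F n in sequentially. V n \<omega> \<le> \<epsilon>" if \<epsilon>: "\<epsilon> > 0" for \<epsilon>
  proof -
    \<comment> \<open>On \<open>B N k\<close> the path has stayed below or at \<epsilon> from time N
      to N + k; \<open>b N\<close> will bound the probability of ever leaving after N.\<close>
    define B where "B N k = {\<omega>\<in>space M. \<forall>n\<in>{N..N+k}. V n \<omega> \<le> \<epsilon>}" for N k
    define b where "b N = (expectation (V N) + (\<Sum>i. c (i + N))) / \<epsilon>" for N
    have BF: "B N k \<in> sets (F (N + k))" for N k
    proof -
      have "{\<omega>\<in>space (F (N + k)). V n \<omega> \<le> \<epsilon>} \<in> sets (F (N + k))" if "n \<le> N + k" for n
      proof -
        have "{\<omega>\<in>space (F n). V n \<omega> \<le> \<epsilon>} \<in> sets (F n)"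
          using V(1)[of n] by measurable
        then show ?thesis using mono'[OF that] spF by auto
      qed
      then have "{\<omega>\<in>space (F (N + k)). \<forall>n\<in>{N..N+k}. V n \<omega> \<le> \<epsilon>} \<in> sets (F (N + k))"
        by (intro sets.sets_Collect_finite_All) auto
      then show ?thesis by (simp add: B_def spF)
    qed
    have BM [measurable]: "B N k \<in> sets M" for N k using BF setF by blast
    have max: "\<epsilon> * (1 - prob (B N k)) + expectation (\<lambda>\<omega>. indicator (B N k) \<omega> * V (N + k) \<omega>)
        \<le> expectation (V N) + (\<Sum>i<k. c (i + N))" for N k
    proof (induction k)
      case 0
      have "\<epsilon> * (1 - prob (B N 0)) + expectation (\<lambda>\<omega>. indicator (B N 0) \<omega> * V N \<omega>) =
          expectation (\<lambda>\<omega>. \<epsilon> * (1 - indicator (B N 0) \<omega>) + indicator (B N 0) \<omega> * V N \<omega>)"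
        using intI by (simp add: prob_space integrable_real_indicator less_top[symmetric])
      also have "\<dots> \<le> expectation (V N)"
      proof (intro integral_mono)
        show "\<epsilon> * (1 - indicator (B N 0) \<omega>) + indicator (B N 0) \<omega> * V N \<omega> \<le> V N \<omega>"
          if "\<omega> \<in> space M" for \<omega>
          using that V(3)[of N \<omega>] by (auto simp: B_def indicator_def)
      qed (use intI V in \<open>auto simp: integrable_real_indicator less_top[symmetric]\<close>)
      finally show ?case by simp
    next
      case (Suc k)
      let ?n = "N + k"
      have sub: "B N (Suc k) \<subseteq> B N k" by (auto simp: B_def)
      have "\<epsilon> * (prob (B N k) - prob (B N (Suc k))) + expectation (\<lambda>\<omega>. indicator (B N (Suc k)) \<omega> * V (Suc ?n) \<omega>) =
          expectation (\<lambda>\<omega>. \<epsilon> * (indicator (B N k) \<omega> - indicator (B N (Suc k)) \<omega>) + indicator (B N (Suc k)) \<omega> * V (Suc ?n) \<omega>)"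
        using intI by (simp add: integrable_real_indicator less_top[symmetric])
      also have "\<dots> \<le> expectation (\<lambda>\<omega>. indicator (B N k) \<omega> * V (Suc ?n) \<omega>)"
      proof (intro integral_mono)
        show "\<epsilon> * (indicator (B N k) \<omega> - indicator (B N (Suc k)) \<omega>) + indicator (B N (Suc k)) \<omega> * V (Suc ?n) \<omega>
          \<le> indicator (B N k) \<omega> * V (Suc ?n) \<omega>" if "\<omega> \<in> space M" for \<omega>
        proof -
          \<comment> \<open>A path that leaves \<open>B\<close> in this step has V above \<epsilon>,
            which pays for the \<epsilon> credited to it from now on.\<close>
          have "V (Suc ?n) \<omega> > \<epsilon>" if "\<omega> \<in> B N k" "\<omega> \<notin> B N (Suc k)"
            using that by (auto simp: B_def) (metis atLeastAtMost_iff le_Suc_eq not_le)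
          then show ?thesis using sub by (auto simp: indicator_def)
        qed
      qed (use intI in \<open>auto simp: integrable_real_indicator less_top[symmetric]\<close>)
      also have "\<dots> \<le> expectation (\<lambda>\<omega>. indicator (B N k) \<omega> * V ?n \<omega>) + c ?n"
        by (rule step[OF BF])
      finally show ?case using Suc by (simp add: algebra_simps)
    qed
    have bound: "1 - prob (B N k) \<le> b N" for N k
    proof -
      have "0 \<le> expectation (\<lambda>\<omega>. indicator (B N k) \<omega> * V (N + k) \<omega>)"
        using V(3) by (intro integral_nonneg_AE) auto
      moreover have "(\<Sum>i<k. c (i + N)) \<le> (\<Sum>i. c (i + N))"
        using c summable_ignore_initial_segment by (intro sum_le_suminf) auto
      ultimately have "\<epsilon> * (1 - prob (B N k)) \<le> expectation (V N) + (\<Sum>i. c (i + N))"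
        using max[of N k] by linarith
      then show ?thesis using \<epsilon> by (simp add: b_def field_simps)
    qed
    have "(\<lambda>N. \<Sum>i. c (i + N)) \<longlonglongrightarrow> 0"
      by (rule suminf_exist_split2[OF c(2)])
    then have b: "b \<longlonglongrightarrow> 0"
      unfolding b_def using lim \<epsilon> by (auto intro!: tendsto_eq_intros)
    define G where "G N = (\<Inter>k. B N k)" for N
    have [measurable]: "G N \<in> sets M" for N unfolding G_def by measurable
    have "1 - prob (G N) \<le> b N" for N
    proof -
      have "(\<lambda>k. prob (B N k)) \<longlonglongrightarrow> prob (G N)"
        unfolding G_def by (intro finite_Lim_measure_decseq) (auto simp: B_def decseq_def)
      then have "(\<lambda>k. 1 - prob (B N k)) \<longlonglongrightarrow> 1 - prob (G N)" by (intro tendsto_intros)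
      then show ?thesis by (rule LIMSEQ_le_const2) (use bound in auto)
    qed
    moreover have "prob (G N) \<le> prob (\<Union>N. G N)" for N
      by (intro finite_measure_mono) auto
    ultimately have "1 - prob (\<Union>N. G N) \<le> b N" for N by (metis diff_left_mono order_trans)
    then have "1 - prob (\<Union>N. G N) \<le> 0"
      by (intro LIMSEQ_le_const[OF b]) auto
    then have "prob (\<Union>N. G N) = 1" using prob_le_1[of "\<Union>N. G N"] by linarith
    then have "AE \<omega> in M. \<omega> \<in> (\<Union>N. G N)" by (intro prob_eq_1[THEN iffD1]) auto
    then show ?thesis
    proof eventually_elim
      case (elim \<omega>)
      then obtain N where N: "\<And>k. \<omega> \<in> B N k" by (auto simp: G_def)
      have "V n \<omega> \<le> \<epsilon>" if "n \<ge> N" for n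
        using N[of "n - N"] that by (auto simp: B_def)
      then show ?case by (auto simp: eventually_sequentially)
    qed
  qed
  have "AE \<omega> in M. \<forall>m :: nat. \<forall>\<^sub>F n in sequentially. V n \<omega> \<le> inverse (real (Suc m))"
    by (subst AE_all_countable) (auto intro!: AE_\<epsilon>)
  then show ?thesis
  proof eventually_elim
    case (elim \<omega>)
    show ?case
    proof (rule tendstoI)
      fix e :: real assume "e > 0"
      then obtain m where m: "inverse (real (Suc m)) < e" using reals_Archimedean by blast
      from elim[rule_format, of m] show "\<forall>\<^sub>F n in sequentially. dist (V n \<omega>) 0 < e"
        by (rule eventually_mono) (use V(3) m in \<open>auto simp: abs_of_nonneg\<close>)
    qed
  qed
qed

section \<open>Urn processes\<close>

definition bounded_borel :: "('a::topological_space \<Rightarrow> real) \<Rightarrow> bool" where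
  "bounded_borel f \<longleftrightarrow> f \<in> borel_measurable borel \<and> (\<exists>B. \<forall>x. \<bar>f x\<bar> \<le> B)"

text \<open>Written through the increments and not through the composition itself: this makes it a
  finite sum of real random variables, measurable as soon as the integrals against
  \<open>\<rho> k\<close> are.\<close>

definition urn_mean ::
  "'a::topological_space measure \<Rightarrow> (nat \<Rightarrow> 'w \<Rightarrow> 'a measure) \<Rightarrow> nat \<Rightarrow> ('a \<Rightarrow> real) \<Rightarrow> 'w \<Rightarrow> real" where
  "urn_mean \<mu>\<^sub>0 \<rho> n f \<omega> =
     ((\<integral>x. f x \<partial>\<mu>\<^sub>0) + (\<Sum>k<n. \<integral>x. f x \<partial>\<rho> k \<omega>)) / (measure \<mu>\<^sub>0 UNIV + real n)"

definition shift_mean :: "'a::{topological_space, plus} measure \<Rightarrow> ('a \<Rightarrow> real) \<Rightarrow> 'a \<Rightarrow> real" where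
  "shift_mean \<nu> f x = (\<integral>y. f (x + y) \<partial>\<nu>)"

lemma bounded_borelI: "f \<in> borel_measurable borel \<Longrightarrow> (\<And>x. \<bar>f x\<bar> \<le> B) \<Longrightarrow> bounded_borel f"
  by (auto simp: bounded_borel_def)

lemma bounded_borel_measurable: "bounded_borel f \<Longrightarrow> f \<in> borel_measurable borel"
  by (simp add: bounded_borel_def)

lemma bounded_borel_add: "bounded_borel f \<Longrightarrow> bounded_borel g \<Longrightarrow> bounded_borel (\<lambda>x. f x + g x)"
  unfolding bounded_borel_def
  by (auto intro!: borel_measurable_add) (metis abs_triangle_ineq add_mono order_trans)

lemma bounded_borel_cmult: "bounded_borel f \<Longrightarrow> bounded_borel (\<lambda>x. c * f x)"
  unfolding bounded_borel_def
  by (auto intro!: borel_measurable_times simp: abs_mult) (metis mult_left_mono abs_ge_zero)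

lemma bounded_borel_const: "bounded_borel (\<lambda>_. c)"
  by (rule bounded_borelI[of _ "\<bar>c\<bar>"]) auto

lemma bounded_borel_integrable:
  assumes "bounded_borel f" and "finite_measure N" and "sets N = sets borel"
  shows "integrable N f"
proof -
  interpret finite_measure N by fact
  obtain B where "\<And>x. \<bar>f x\<bar> \<le> B" using assms(1) by (auto simp: bounded_borel_def)
  moreover have "f \<in> borel_measurable N"
    using bounded_borel_measurable[OF assms(1)] by (simp cong: measurable_cong_sets add: assms(3))
  ultimately show ?thesis by (intro integrable_const_bound[where B = B]) auto
qed

lemma bounded_borel_integral_abs_le:
  assumes f: "bounded_borel f" "\<And>x. \<bar>f x\<bar> \<le> B" and N: "prob_space N" "sets N = sets borel"
  shows "\<bar>\<integral>x. f x \<partial>N\<bar> \<le> B"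
proof -
  interpret prob_space N by (rule N(1))
  have "(\<integral>x. \<bar>f x\<bar> \<partial>N) \<le> (\<integral>x. B \<partial>N)"
    using bounded_borel_integrable[OF f(1) finite_measure_axioms N(2)] f(2) by (intro integral_mono) auto
  also have "\<dots> = B" by (simp add: prob_space)
  finally show ?thesis by (rule order_trans[OF integral_abs_bound])
qed

lemma abs_shift_mean_le:
  fixes \<nu> :: "'a::euclidean_space measure"
  assumes "prob_space \<nu>" and "sets \<nu> = sets borel" and f: "bounded_borel f" and B: "\<And>x. \<bar>f x\<bar> \<le> B"
  shows "\<bar>shift_mean \<nu> f x\<bar> \<le> B"
proof -
  have "bounded_borel (\<lambda>y. f (x + y))"
    using bounded_borel_measurable[OF f] B by (intro bounded_borelI) auto
  then show ?thesis unfolding shift_mean_def using B assms(1,2) by (rule bounded_borel_integral_abs_le)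
qed

lemma shift_mean_bounded_borel:
  fixes \<nu> :: "'a::euclidean_space measure"
  assumes "prob_space \<nu>" and "sets \<nu> = sets borel" and f: "bounded_borel f"
  shows "bounded_borel (shift_mean \<nu> f)"
proof -
  interpret prob_space \<nu> by fact
  obtain B where B: "\<And>x. \<bar>f x\<bar> \<le> B" using f by (auto simp: bounded_borel_def)
  note [measurable] = bounded_borel_measurable[OF f]
  note [measurable_cong] = assms(2)
  have "shift_mean \<nu> f \<in> borel_measurable borel" unfolding shift_mean_def by measurable
  then show ?thesis using abs_shift_mean_le[OF assms B] by (rule bounded_borelI)
qed

lemma urn_mean_measurable:
  assumes "\<And>k. k < n \<Longrightarrow> (\<lambda>\<omega>. \<integral>x. f x \<partial>\<rho> k \<omega>) \<in> borel_measurable N"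
  shows "urn_mean \<mu>\<^sub>0 \<rho> n f \<in> borel_measurable N"
  unfolding urn_mean_def
  by (intro borel_measurable_divide borel_measurable_add borel_measurable_sum assms) auto

text \<open>Both urns are of the form \<open>\<mu>\<^sub>n\<^sub>+\<^sub>1 = \<mu>\<^sub>n + \<rho>\<^sub>n\<close> with random probability measures \<open>\<rho>\<^sub>n\<close> such that, given
  the past, the expectation of \<open>\<rho>\<^sub>n\<close> is the normalization of \<open>\<mu>\<^sub>n\<close> convolved with the offset law \<open>\<nu>\<close>;
  \<open>urn_mean\<close> is integration against the normalization of \<open>\<mu>\<^sub>n\<close>.\<close>

locale urn_process = prob_space M for M :: "'w measure" +
  fixes F :: "nat \<Rightarrow> 'w measure" and \<mu>\<^sub>0 \<nu> :: "'a::euclidean_space measure"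
    and \<rho> :: "nat \<Rightarrow> 'w \<Rightarrow> 'a measure"
  assumes subalg: "\<And>n. subalgebra M (F n)"
    and filtration: "\<And>n. sets (F n) \<subseteq> sets (F (Suc n))"
    and init: "finite_measure \<mu>\<^sub>0" "sets \<mu>\<^sub>0 = sets borel" "measure \<mu>\<^sub>0 UNIV > 0"
    and offset: "prob_space \<nu>" "sets \<nu> = sets borel"
    and increment: "\<And>n \<omega>. prob_space (\<rho> n \<omega>)" "\<And>n \<omega>. sets (\<rho> n \<omega>) = sets borel"
    and adapted: "\<And>n f. bounded_borel f \<Longrightarrow> (\<lambda>\<omega>. \<integral>x. f x \<partial>\<rho> n \<omega>) \<in> borel_measurable (F (Suc n))"
    and cond_mean: "\<And>n f Z. bounded_borel f \<Longrightarrow> Z \<in> borel_measurable (F n) \<Longrightarrow> \<exists>B. \<forall>\<omega>. \<bar>Z \<omega>\<bar> \<le> B \<Longrightarrow>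
      (\<integral>\<omega>. Z \<omega> * (\<integral>x. f x \<partial>\<rho> n \<omega>) \<partial>M) = (\<integral>\<omega>. Z \<omega> * urn_mean \<mu>\<^sub>0 \<rho> n (shift_mean \<nu> f) \<omega> \<partial>M)"
begin

section \<open>Predictors and martingale noise\<close>

definition W :: "nat \<Rightarrow> real" where "W n = measure \<mu>\<^sub>0 UNIV + real n"

abbreviation "mean \<equiv> urn_mean \<mu>\<^sub>0 \<rho>"

definition step :: "nat \<Rightarrow> ('a \<Rightarrow> real) \<Rightarrow> 'a \<Rightarrow> real" where
  "step n f x = f x + (shift_mean \<nu> f x - f x) / W (Suc n)"

text \<open>The latest urn step, from K + j to K + j + 1, acts on f first, in the order in which
  conditional expectations are taken back to time K.\<close>

primrec pull :: "nat \<Rightarrow> nat \<Rightarrow> ('a \<Rightarrow> real) \<Rightarrow> 'a \<Rightarrow> real" where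
  "pull K 0 f = f"
| "pull K (Suc j) f = pull K j (step (K + j) f)"

lemma W_pos: "W n > 0" using init(3) by (simp add: W_def)

lemma W_Suc: "W (Suc n) = W n + 1" by (simp add: W_def)

lemma W_Suc_ge: "W (Suc n) \<ge> 1" using init(3) by (simp add: W_def)

lemma space_init: "space \<mu>\<^sub>0 = UNIV" using sets_eq_imp_space_eq[OF init(2)] by simp

lemma integrable_init: "bounded_borel f \<Longrightarrow> integrable \<mu>\<^sub>0 f"
  using bounded_borel_integrable init by blast

lemma integrable_increment: "bounded_borel f \<Longrightarrow> integrable (\<rho> n \<omega>) f"
  by (rule bounded_borel_integrable) (simp_all add: increment prob_space.finite_measure)

lemma integrable_offset: "bounded_borel f \<Longrightarrow> integrable \<nu> f"
  by (rule bounded_borel_integrable) (simp_all add: offset prob_space.finite_measure)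

lemma mean_add:
  assumes "bounded_borel f" and "bounded_borel g"
  shows "mean n (\<lambda>x. f x + g x) \<omega> = mean n f \<omega> + mean n g \<omega>"
  using assms unfolding urn_mean_def
  by (simp add: integrable_init integrable_increment sum.distrib add_divide_distrib)

lemma mean_cmult: "mean n (\<lambda>x. c * f x) \<omega> = c * mean n f \<omega>"
  unfolding urn_mean_def by (simp add: sum_distrib_left distrib_left)

lemma mean_diff:
  assumes "bounded_borel f" and "bounded_borel g"
  shows "mean n (\<lambda>x. f x - g x) \<omega> = mean n f \<omega> - mean n g \<omega>"
  using mean_add[OF assms(1) bounded_borel_cmult[OF assms(2), of "-1"]]
    mean_cmult[of n "-1" g] by simp

lemma mean_const: "mean n (\<lambda>_. c) \<omega> = c"
proof -
  interpret \<mu>\<^sub>0: finite_measure \<mu>\<^sub>0 by (rule init)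
  have [simp]: "measure (\<rho> k \<omega>) (space (\<rho> k \<omega>)) = 1" for k
    by (rule prob_space.prob_space[OF increment(1)])
  then show ?thesis using W_pos[of n]
    by (simp add: urn_mean_def space_init W_def field_simps)
qed

lemma mean_mono:
  assumes "bounded_borel f" and "bounded_borel g" and "\<And>x. f x \<le> g x"
  shows "mean n f \<omega> \<le> mean n g \<omega>"
  unfolding urn_mean_def using W_pos[of n] assms
  by (intro divide_right_mono add_mono sum_mono integral_mono)
     (auto simp: W_def integrable_init integrable_increment)

lemma mean_abs_le:
  assumes "bounded_borel f" and "\<And>x. \<bar>f x\<bar> \<le> B"
  shows "\<bar>mean n f \<omega>\<bar> \<le> B"
proof -
  have "f x \<le> B" "- B \<le> f x" for x using assms(2)[of x] by auto
  then have "mean n f \<omega> \<le> mean n (\<lambda>_. B) \<omega>" "mean n (\<lambda>_. - B) \<omega> \<le> mean n f \<omega>"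
    using mean_mono[OF assms(1) bounded_borel_const, of B] mean_mono[OF bounded_borel_const assms(1), of "- B"]
    by simp_all
  then show ?thesis by (simp add: mean_const)
qed

lemma mean_Suc: "mean (Suc n) f \<omega> = mean n f \<omega> + ((\<integral>x. f x \<partial>\<rho> n \<omega>) - mean n f \<omega>) / W (Suc n)"
proof -
  have "W n * mean n f \<omega> = (\<integral>x. f x \<partial>\<mu>\<^sub>0) + (\<Sum>k<n. \<integral>x. f x \<partial>\<rho> k \<omega>)"
    using W_pos[of n] by (simp add: urn_mean_def W_def)
  then have "mean (Suc n) f \<omega> = (W n * mean n f \<omega> + (\<integral>x. f x \<partial>\<rho> n \<omega>)) / W (Suc n)"
    by (simp add: urn_mean_def W_def add.assoc)
  then show ?thesis using W_pos[of "Suc n"] by (simp add: W_Suc field_simps)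
qed

lemmas increment_abs_le = bounded_borel_integral_abs_le[OF _ _ increment]

text \<open>The urn gains mass n' - n. Per unit of gained mass, the new part and the renormalization
  of the old part each change \<open>W n'\<close> times the mean by at most B.\<close>

lemma mean_shift_abs_le:
  assumes "bounded_borel f" and "\<And>x. \<bar>f x\<bar> \<le> B" and "n \<le> n'"
  shows "\<bar>mean n' f \<omega> - mean n f \<omega>\<bar> \<le> 2 * B * (real n' - real n) / W n'"
proof -
  define S where "S n = (\<integral>x. f x \<partial>\<mu>\<^sub>0) + (\<Sum>k<n. \<integral>x. f x \<partial>\<rho> k \<omega>)" for n
  have S: "S n = W n * mean n f \<omega>" for n
    using W_pos[of n] by (simp add: urn_mean_def W_def S_def)
  have "S n' = S n + (\<Sum>k\<in>{n..<n'}. \<integral>x. f x \<partial>\<rho> k \<omega>)"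
    unfolding S_def using assms(3) by (simp add: sum.atLeastLessThan_concat flip: atLeast0LessThan)
  moreover have "\<bar>\<Sum>k\<in>{n..<n'}. \<integral>x. f x \<partial>\<rho> k \<omega>\<bar> \<le> (\<Sum>k\<in>{n..<n'}. B)"
    by (rule order_trans[OF sum_abs sum_mono]) (rule increment_abs_le[OF assms(1,2)])
  moreover have "\<bar>(real n' - real n) * mean n f \<omega>\<bar> \<le> (real n' - real n) * B"
    using mean_abs_le[OF assms(1,2)] assms(3) by (simp add: abs_mult mult_left_mono)
  moreover have "W n' * (mean n' f \<omega> - mean n f \<omega>) = S n' - S n - (real n' - real n) * mean n f \<omega>"
    unfolding S by (simp add: W_def algebra_simps)
  ultimately have "\<bar>W n' * (mean n' f \<omega> - mean n f \<omega>)\<bar> \<le> 2 * B * (real n' - real n)"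
    using assms(3) by (simp add: of_nat_diff algebra_simps)
  then show ?thesis using W_pos[of n'] by (simp add: abs_mult pos_le_divide_eq mult.commute[of _ "W n'"])
qed

lemma F_mono: "m \<le> n \<Longrightarrow> subalgebra (F n) (F m)"
  using lift_Suc_mono_le[of "\<lambda>n. sets (F n)", OF filtration] subalg
  by (auto simp: subalgebra_def)

lemma mean_measurable_F:
  assumes "bounded_borel f"
  shows "mean n f \<in> borel_measurable (F n)"
proof -
  have "(\<lambda>\<omega>. \<integral>x. f x \<partial>\<rho> k \<omega>) \<in> borel_measurable (F n)" if "k < n" for k
    using measurable_from_subalg[OF F_mono adapted[OF assms]] that by (simp add: Suc_le_eq)
  then show ?thesis by (rule urn_mean_measurable)
qed

lemma mean_measurable: "bounded_borel f \<Longrightarrow> mean n f \<in> borel_measurable M"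
  using measurable_from_subalg[OF subalg mean_measurable_F] .

lemma mean_integrable:
  assumes "bounded_borel f"
  shows "integrable M (mean n f)"
proof -
  obtain B where "\<And>x. \<bar>f x\<bar> \<le> B" using assms by (auto simp: bounded_borel_def)
  then show ?thesis using mean_abs_le[OF assms] mean_measurable[OF assms]
    by (intro integrable_const_bound[where B = B]) auto
qed

lemmas shift_mean_abs_le = abs_shift_mean_le[OF offset]

lemmas bounded_borel_shift_mean = shift_mean_bounded_borel[OF offset]

text \<open>Since \<open>W (Suc n)\<close> is at least 1, \<open>step n f\<close> is a convex
  combination of f and its shifted average.\<close>

lemma step_abs_le:
  assumes "bounded_borel f" and "\<And>x. \<bar>f x\<bar> \<le> B"
  shows "\<bar>step n f x\<bar> \<le> B"
proof -
  define \<theta> where "\<theta> = 1 / W (Suc n)"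
  have \<theta>: "0 \<le> \<theta>" "\<theta> \<le> 1" using W_Suc_ge[of n] by (auto simp: \<theta>_def)
  have "\<bar>step n f x\<bar> = \<bar>(1 - \<theta>) * f x + \<theta> * shift_mean \<nu> f x\<bar>"
    by (simp add: step_def \<theta>_def algebra_simps diff_divide_distrib)
  also have "\<dots> \<le> (1 - \<theta>) * \<bar>f x\<bar> + \<theta> * \<bar>shift_mean \<nu> f x\<bar>"
    using \<theta> by (intro order_trans[OF abs_triangle_ineq]) (simp add: abs_mult)
  also have "\<dots> \<le> (1 - \<theta>) * B + \<theta> * B"
    using \<theta> assms shift_mean_abs_le[OF assms] by (intro add_mono mult_left_mono) auto
  finally show ?thesis by (simp add: algebra_simps)
qed

lemma bounded_borel_step:
  assumes "bounded_borel f"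
  shows "bounded_borel (step n f)"
proof -
  obtain B where B: "\<And>x. \<bar>f x\<bar> \<le> B" using assms by (auto simp: bounded_borel_def)
  have "step n f \<in> borel_measurable borel"
    unfolding step_def using bounded_borel_measurable[OF assms]
      bounded_borel_measurable[OF bounded_borel_shift_mean[OF assms]] by measurable
  then show ?thesis using step_abs_le[OF assms B] by (rule bounded_borelI)
qed

lemma pull_bounded:
  assumes "bounded_borel f" and "\<And>x. \<bar>f x\<bar> \<le> B"
  shows "bounded_borel (pull K j f)" and "\<And>x. \<bar>pull K j f x\<bar> \<le> B"
proof -
  have "bounded_borel (pull K j f) \<and> (\<forall>x. \<bar>pull K j f x\<bar> \<le> B)"
    using assms
  proof (induction j arbitrary: f)
    case (Suc j)
    show ?case unfolding pull.simps
      by (rule Suc.IH) (use Suc.prems in \<open>auto intro: bounded_borel_step step_abs_le\<close>)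
  qed auto
  then show "bounded_borel (pull K j f)" and "\<And>x. \<bar>pull K j f x\<bar> \<le> B" by auto
qed

lemma mean_step:
  assumes "bounded_borel f"
  shows "mean n (step n f) \<omega> = mean n f \<omega> + (mean n (shift_mean \<nu> f) \<omega> - mean n f \<omega>) / W (Suc n)"
proof -
  note Q = bounded_borel_shift_mean[OF assms]
  have "bounded_borel (\<lambda>x. shift_mean \<nu> f x - f x)"
    using bounded_borel_add[OF Q bounded_borel_cmult[OF assms, of "-1"]] by simp
  then show ?thesis
    using mean_add[OF assms bounded_borel_cmult, of "\<lambda>x. shift_mean \<nu> f x - f x" n "1 / W (Suc n)" \<omega>]
      mean_cmult[of n "1 / W (Suc n)" "\<lambda>x. shift_mean \<nu> f x - f x" \<omega>] mean_diff[OF Q assms, of n \<omega>]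
    by (simp add: step_def[abs_def])
qed

text \<open>A martingale difference: what is left of one step of the mean after its conditional
  expectation has been removed, see \<open>mean_Suc_step\<close>.\<close>

definition noise :: "nat \<Rightarrow> ('a \<Rightarrow> real) \<Rightarrow> 'w \<Rightarrow> real" where
  "noise n f \<omega> = ((\<integral>x. f x \<partial>\<rho> n \<omega>) - mean n (shift_mean \<nu> f) \<omega>) / W (Suc n)"

lemma mean_Suc_step:
  assumes "bounded_borel f"
  shows "mean (Suc n) f \<omega> = mean n (step n f) \<omega> + noise n f \<omega>"
  unfolding mean_Suc mean_step[OF assms] noise_def by (simp add: field_simps diff_divide_distrib)

lemma noise_measurable:
  assumes "bounded_borel f"
  shows "noise n f \<in> borel_measurable M"
proof -
  have "noise n f = (\<lambda>\<omega>. mean (Suc n) f \<omega> - mean n (step n f) \<omega>)"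
    by (simp add: mean_Suc_step[OF assms] fun_eq_iff)
  then show ?thesis
    using assms by (simp add: mean_measurable bounded_borel_step borel_measurable_diff)
qed

lemma noise_abs_le:
  assumes "bounded_borel f" and "\<And>x. \<bar>f x\<bar> \<le> B"
  shows "\<bar>noise n f \<omega>\<bar> \<le> 2 * B / W (Suc n)"
proof -
  have "\<bar>\<integral>x. f x \<partial>\<rho> n \<omega>\<bar> \<le> B" "\<bar>mean n (shift_mean \<nu> f) \<omega>\<bar> \<le> B"
    using assms by (auto intro: increment_abs_le mean_abs_le bounded_borel_shift_mean shift_mean_abs_le)
  then have "\<bar>(\<integral>x. f x \<partial>\<rho> n \<omega>) - mean n (shift_mean \<nu> f) \<omega>\<bar> \<le> 2 * B" by linarith
  then show ?thesis using W_pos[of "Suc n"] by (simp add: noise_def divide_right_mono)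
qed

text \<open>The martingale difference property, tested against bounded variables known at time n,
  which is the form in which \<open>cond_mean\<close> provides it.\<close>

lemma noise_orthogonal:
  assumes f: "bounded_borel f" and Z: "Z \<in> borel_measurable (F n)" "\<And>\<omega>. \<bar>Z \<omega>\<bar> \<le> C"
  shows "integrable M (\<lambda>\<omega>. Z \<omega> * noise n f \<omega>)" and "expectation (\<lambda>\<omega>. Z \<omega> * noise n f \<omega>) = 0"
proof -
  obtain B where B: "\<And>x. \<bar>f x\<bar> \<le> B" using f by (auto simp: bounded_borel_def)
  have ZM [measurable]: "Z \<in> borel_measurable M" using measurable_from_subalg[OF subalg Z(1)] .
  have int: "integrable M (\<lambda>\<omega>. Z \<omega> * Y \<omega>)"
    if "Y \<in> borel_measurable M" "\<And>\<omega>. \<bar>Y \<omega>\<bar> \<le> D" for Y D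
  proof (rule integrable_const_bound[where B = "C * D"])
    show "AE \<omega> in M. norm (Z \<omega> * Y \<omega>) \<le> C * D"
      using Z(2) that(2) by (auto simp: abs_mult intro!: AE_I2 mult_mono) (meson abs_ge_zero order_trans)
  qed (use that in measurable)
  show "integrable M (\<lambda>\<omega>. Z \<omega> * noise n f \<omega>)"
    by (rule int[OF noise_measurable[OF f] noise_abs_le[OF f B]])
  have "integrable M (\<lambda>\<omega>. Z \<omega> * (\<integral>x. f x \<partial>\<rho> n \<omega>))"
    using increment_abs_le[OF f B] measurable_from_subalg[OF subalg adapted[OF f]] by (intro int[of _ B]) auto
  moreover have "integrable M (\<lambda>\<omega>. Z \<omega> * mean n (shift_mean \<nu> f) \<omega>)"
    using f by (intro int[of _ B] mean_measurable bounded_borel_shift_mean)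
      (auto intro: mean_abs_le bounded_borel_shift_mean shift_mean_abs_le B)
  ultimately show "expectation (\<lambda>\<omega>. Z \<omega> * noise n f \<omega>) = 0"
    using cond_mean[OF f Z(1)] Z(2)
    by (auto simp: noise_def right_diff_distrib diff_divide_distrib)
qed

text \<open>The error splits into the noise of the last step and the error made for
  \<open>step n f\<close> at time n. The latter is known at time n, so the two are orthogonal and
  their second moments add. The noise is at most 2 / (W + 1) with W the mass at time n, and 4 / (W +
  1)^2 is below 4 / (W (W + 1)) = 4 (1 / W - 1 / (W + 1)), so the bounds telescope.\<close>

lemma mean_pull_second_moment:
  assumes f: "bounded_borel f" and f1: "\<And>x. \<bar>f x\<bar> \<le> 1"
  shows "expectation (\<lambda>\<omega>. (mean (K + j) f \<omega> - mean K (pull K j f) \<omega>)\<^sup>2) \<le> 4 * (1 / W K - 1 / W (K + j))"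
  using assms
proof (induction j arbitrary: f)
  case (Suc j)
  define n where "n = K + j"
  define g where "g = step n f"
  have g: "bounded_borel g" "\<And>x. \<bar>g x\<bar> \<le> 1"
    using Suc.prems by (auto simp: g_def intro: bounded_borel_step step_abs_le)
  note bg = pull_bounded[OF g, of K j]
  define Z where "Z \<omega> = mean n g \<omega> - mean K (pull K j g) \<omega>" for \<omega>
  have ZF: "Z \<in> borel_measurable (F n)"
    unfolding Z_def using mean_measurable_F[OF g(1), of n] n_def
      measurable_from_subalg[OF F_mono mean_measurable_F[OF bg(1), of K], of n]
    by (intro borel_measurable_diff) auto
  then have ZM [measurable]: "Z \<in> borel_measurable M" by (rule measurable_from_subalg[OF subalg])
  have Z2: "\<bar>Z \<omega>\<bar> \<le> 2" for \<omega>
    using mean_abs_le[OF g, of n \<omega>] mean_abs_le[OF bg, of K \<omega>] unfolding Z_def by linarith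
  note orth = noise_orthogonal[OF Suc.prems(1) ZF Z2]
  note [measurable] = noise_measurable[OF Suc.prems(1), of n]
  have D: "(noise n f \<omega>)\<^sup>2 \<le> 4 * (1 / W n - 1 / W (Suc n))" for \<omega>
  proof -
    have "(noise n f \<omega>)\<^sup>2 \<le> (2 / W (Suc n))\<^sup>2"
      using noise_abs_le[OF Suc.prems] by (intro abs_le_square_iff[THEN iffD1]) (simp add: W_pos less_imp_le)
    also have "\<dots> \<le> 4 * (1 / W n - 1 / W (Suc n))"
    proof -
      have "(2 / W (Suc n))\<^sup>2 = 4 / (W (Suc n) * W (Suc n))" by (simp add: power2_eq_square)
      also have "\<dots> \<le> 4 / (W n * W (Suc n))"
        using W_pos[of n] W_pos[of "Suc n"] by (intro divide_left_mono mult_right_mono) (auto simp: W_Suc)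
      also have "\<dots> = 4 * (1 / W n - 1 / W (Suc n))"
        using W_pos[of n] W_pos[of "Suc n"] by (simp add: field_simps) (simp add: W_Suc algebra_simps)
      finally show ?thesis .
    qed
    finally show ?thesis .
  qed
  have iD: "integrable M (\<lambda>\<omega>. (noise n f \<omega>)\<^sup>2)"
    using D by (intro integrable_const_bound[where B = "4 * (1 / W n - 1 / W (Suc n))"]) auto
  have iZ: "integrable M (\<lambda>\<omega>. (Z \<omega>)\<^sup>2)"
  proof (rule integrable_const_bound[where B = "2\<^sup>2"])
    have "(Z \<omega>)\<^sup>2 \<le> 2\<^sup>2" for \<omega> using Z2[of \<omega>] power2_le_iff_abs_le[of 2 "Z \<omega>"] by simp
    then show "AE \<omega> in M. norm ((Z \<omega>)\<^sup>2) \<le> 2\<^sup>2" by simp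
  qed simp
  have "expectation (\<lambda>\<omega>. (mean (Suc n) f \<omega> - mean K (pull K (Suc j) f) \<omega>)\<^sup>2) =
      expectation (\<lambda>\<omega>. (noise n f \<omega>)\<^sup>2 + 2 * (Z \<omega> * noise n f \<omega>) + (Z \<omega>)\<^sup>2)"
    by (intro Bochner_Integration.integral_cong)
       (auto simp: mean_Suc_step[OF Suc.prems(1)] Z_def g_def n_def power2_eq_square algebra_simps)
  also have "\<dots> = expectation (\<lambda>\<omega>. (noise n f \<omega>)\<^sup>2) + expectation (\<lambda>\<omega>. (Z \<omega>)\<^sup>2)"
    using orth iD iZ by simp
  also have "\<dots> \<le> 4 * (1 / W n - 1 / W (Suc n)) + 4 * (1 / W K - 1 / W n)"
  proof (rule add_mono)
    have "expectation (\<lambda>\<omega>. (noise n f \<omega>)\<^sup>2) \<le> expectation (\<lambda>\<omega>. 4 * (1 / W n - 1 / W (Suc n)))"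
      using D iD by (intro integral_mono) auto
    then show "expectation (\<lambda>\<omega>. (noise n f \<omega>)\<^sup>2) \<le> 4 * (1 / W n - 1 / W (Suc n))"
      by (simp add: prob_space)
    show "expectation (\<lambda>\<omega>. (Z \<omega>)\<^sup>2) \<le> 4 * (1 / W K - 1 / W n)"
      unfolding Z_def n_def using Suc.IH[OF g] .
  qed
  finally show ?case by (simp add: n_def)
qed simp

end

section \<open>Sampling times and elementary estimates\<close>

text \<open>The Taylor remainder is controlled by the integral of min (6 x^2) (|u| |x|^3). Dominated
  convergence with majorant 6 x^2 sends it to 0, so a finite second moment gives an error
  o(u^2).\<close>

lemma (in real_distribution) char_second_order:
  assumes sq: "integrable M (\<lambda>x. x\<^sup>2)" and u: "u \<longlonglongrightarrow> 0"
  shows "(\<lambda>j. (char M (u j) - (1 + \<i> * u j * expectation (\<lambda>x. x) - (u j)\<^sup>2 * expectation (\<lambda>x. x\<^sup>2) / 2))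
    / (of_real (u j))\<^sup>2) \<longlonglongrightarrow> 0"
proof -
  have moments: "integrable M (\<lambda>x. x ^ k)" if "k \<le> 2" for k
  proof -
    have "integrable M (\<lambda>x. x)"
      using square_integrable_imp_integrable[of "\<lambda>x. x"] sq by simp
    then show ?thesis using that sq by (auto simp: le_Suc_eq numeral_2_eq_2)
  qed
  define e where "e j = expectation (\<lambda>x. min (6 * x\<^sup>2) (\<bar>u j\<bar> * \<bar>x\<bar> ^ 3)) / 6" for j
  have "(\<lambda>j. expectation (\<lambda>x. min (6 * x\<^sup>2) (\<bar>u j\<bar> * \<bar>x\<bar> ^ 3))) \<longlonglongrightarrow> expectation (\<lambda>x. 0)"
  proof (rule integral_dominated_convergence[where w = "\<lambda>x. 6 * x\<^sup>2"])
    show "AE x in M. (\<lambda>j. min (6 * x\<^sup>2) (\<bar>u j\<bar> * \<bar>x\<bar> ^ 3)) \<longlonglongrightarrow> 0"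
    proof (rule AE_I2)
      fix x
      have "(\<lambda>j. min (6 * x\<^sup>2) (\<bar>u j\<bar> * \<bar>x\<bar> ^ 3)) \<longlonglongrightarrow> min (6 * x\<^sup>2) (\<bar>0\<bar> * \<bar>x\<bar> ^ 3)"
        by (intro tendsto_intros u)
      then show "(\<lambda>j. min (6 * x\<^sup>2) (\<bar>u j\<bar> * \<bar>x\<bar> ^ 3)) \<longlonglongrightarrow> 0" by simp
    qed
  qed (use sq in auto)
  then have e: "e \<longlonglongrightarrow> 0" unfolding e_def by (auto intro!: tendsto_eq_intros)
  show ?thesis
  proof (rule Lim_null_comparison[OF _ e], intro always_eventually allI)
    fix j
    have "(\<Sum>k\<le>2. ((\<i> * u j) ^ k / fact k) * expectation (\<lambda>x. x ^ k)) =
        1 + \<i> * u j * expectation (\<lambda>x. x) - (u j)\<^sup>2 * expectation (\<lambda>x. x\<^sup>2) / 2"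
      using prob_space by (simp add: numeral_2_eq_2 power_mult_distrib)
    from char_approx2[of 2 "u j", OF moments, unfolded this]
    have "norm (char M (u j) - (1 + \<i> * u j * expectation (\<lambda>x. x) - (u j)\<^sup>2 * expectation (\<lambda>x. x\<^sup>2) / 2))
        \<le> (u j)\<^sup>2 * e j"
      by (simp add: e_def fact_numeral mult.commute)
    \<comment> \<open>For u j = 0 the quotient is 0, because division by 0 yields 0, and the bound
      holds by nonnegativity of \<open>e j\<close>.\<close>
    then show "norm ((char M (u j) - (1 + \<i> * u j * expectation (\<lambda>x. x) - (u j)\<^sup>2 * expectation (\<lambda>x. x\<^sup>2) / 2))
        / (of_real (u j))\<^sup>2) \<le> e j"
      by (cases "u j = 0") (auto simp: norm_divide norm_power divide_le_eq mult.commute e_def integral_nonneg_AE)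
  qed
qed

section \<open>Truncated norms\<close>

text \<open>A continuous majorant of the indicator of norm x > R. Being bounded by 1 and Lipschitz
  with constant 1 / R, it reacts little to a shift of x and can be integrated against any finite
  measure.\<close>

definition trunc_norm :: "real \<Rightarrow> 'a::real_normed_vector \<Rightarrow> real" where
  "trunc_norm R x = min 1 (norm x / R)"

lemma trunc_norm_abs_le: "R > 0 \<Longrightarrow> \<bar>trunc_norm R x\<bar> \<le> 1"
  by (auto simp: trunc_norm_def)

lemma trunc_norm_nonneg: "R > 0 \<Longrightarrow> trunc_norm R x \<ge> 0"
  by (auto simp: trunc_norm_def)

lemma bounded_borel_trunc_norm:
  "R > 0 \<Longrightarrow> bounded_borel (trunc_norm R :: 'a::euclidean_space \<Rightarrow> real)"
  by (rule bounded_borelI[OF _ trunc_norm_abs_le]) (auto simp: trunc_norm_def)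

lemma trunc_norm_lipschitz:
  assumes "R > 0"
  shows "\<bar>trunc_norm R x - trunc_norm R y\<bar> \<le> norm (x - y) / R"
proof -
  have "\<bar>norm x / R - norm y / R\<bar> \<le> norm (x - y) / R"
    using assms norm_triangle_ineq3[of x y] divide_right_mono[of "\<bar>norm x - norm y\<bar>" "norm (x - y)" R]
    by (simp flip: diff_divide_distrib)
  then show ?thesis unfolding trunc_norm_def by linarith
qed

section \<open>Sampling times\<close>

text \<open>Times at which the urn is sampled, and earlier times from which it is predicted. The error of the
  prediction has second moment \<open>O(1 / base_time j)\<close>, which is summable, while \<open>ln (base_time j)\<close> is
  negligible compared with \<open>sqrt (ln (sample_time j))\<close> and consecutive sample times have ratio
  tending to \<open>1\<close>.\<close>

definition base_time :: "nat \<Rightarrow> nat" where "base_time j = (Suc j)\<^sup>2"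
definition lag :: "nat \<Rightarrow> nat" where "lag j = nat \<lfloor>exp (sqrt (real j))\<rfloor>"
definition sample_time :: "nat \<Rightarrow> nat" where "sample_time j = base_time j + lag j"
abbreviation sample_log :: "nat \<Rightarrow> real" where "sample_log j \<equiv> ln (real (sample_time j))"
text \<open>Index of a sample time slightly before n. The subtracted 1 makes exp (sqrt j) fall below
  n by about n / (2 ln n), which leaves room for \<open>base_time j\<close>, at most (ln
  n)^4.\<close>

definition sample_index :: "nat \<Rightarrow> nat" where "sample_index n = nat \<lfloor>(ln (real n))\<^sup>2 - 1\<rfloor>"
text \<open>The exponent must be positive, so that the sum of 1 / (radius n * n) converges, and
  below 1/8: at \<open>base_time j\<close>, of order j^2, the radius is then o(j^(1/4)), hence
  negligible against the square root of \<open>sample_log j\<close>.\<close>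

definition radius :: "nat \<Rightarrow> real" where "radius n = real (Suc n) powr (1 / 16)"

lemma radius_pos: "radius n > 0" by (simp add: radius_def)

lemma sample_time_ge: "exp (sqrt (real j)) \<le> real (sample_time j)"
proof -
  have "real (lag j) = of_int \<lfloor>exp (sqrt (real j))\<rfloor>" unfolding lag_def by (intro of_nat_nat) simp
  then have "exp (sqrt (real j)) \<le> real (lag j) + 1" by linarith
  \<comment> \<open>The base time makes up for the floor in \<open>lag\<close>.\<close>
  moreover have "base_time j \<ge> 1" by (simp add: base_time_def)
  then have "1 \<le> real (base_time j)" by linarith
  ultimately show ?thesis by (simp add: sample_time_def)
qed

lemma ln_sample_time_ge: "sqrt (real j) \<le> sample_log j"
  using sample_time_ge[of j] less_le_trans[OF exp_gt_zero sample_time_ge[of j]] by (subst ln_ge_iff) auto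

lemma ln_sample_time_at_top: "filterlim (\<lambda>j. sample_log j) at_top sequentially"
proof (rule filterlim_at_top_mono)
  show "filterlim (\<lambda>j. sqrt (real j)) at_top sequentially" by real_asymp
qed (simp add: ln_sample_time_ge)

lemma eventually_ln_sample_time_pos: "\<forall>\<^sub>F j in sequentially. sample_log j > 0"
  using filterlim_at_top_dense[THEN iffD1, OF ln_sample_time_at_top] by blast

text \<open>Replaces \<open>sample_log j\<close> by its lower bound sqrt j, after which limits
  involve explicit functions of j without floors.\<close>

lemma div_sqrt_ln_sample_time_tendsto_zero:
  assumes "(\<lambda>j. f j / sqrt (sqrt (real j))) \<longlonglongrightarrow> 0"
  shows "(\<lambda>j. f j / sqrt (sample_log j)) \<longlonglongrightarrow> 0"
proof (rule Lim_null_comparison)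
  show "(\<lambda>j. \<bar>f j / sqrt (sqrt (real j))\<bar>) \<longlonglongrightarrow> 0"
    using tendsto_rabs[OF assms] by simp
  have "\<bar>f j / sqrt (sample_log j)\<bar> \<le> \<bar>f j / sqrt (sqrt (real j))\<bar>" if "j > 0" for j
  proof -
    have 1: "0 < sqrt (sqrt (real j))" using that by simp
    have 2: "sqrt (sqrt (real j)) \<le> sqrt (sample_log j)"
      using ln_sample_time_ge[of j] by (intro real_sqrt_le_mono)
    have "\<bar>sqrt (sqrt (real j))\<bar> \<le> \<bar>sqrt (sample_log j)\<bar>" "0 < \<bar>sqrt (sqrt (real j))\<bar>"
      using 1 2 by linarith+
    then show ?thesis unfolding abs_divide by (intro frac_le) auto
  qed
  then show "\<forall>\<^sub>F j in sequentially. norm (f j / sqrt (sample_log j)) \<le> \<bar>f j / sqrt (sqrt (real j))\<bar>"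
    unfolding real_norm_def by (intro eventually_mono[OF eventually_gt_at_top[of "0 :: nat"]]) blast
qed

lemma radius_base_time_negligible: "(\<lambda>j. radius (base_time j) / sqrt (sample_log j)) \<longlonglongrightarrow> 0"
proof (rule div_sqrt_ln_sample_time_tendsto_zero)
  have "(\<lambda>j. (((real j + 1)\<^sup>2 + 1) powr (1 / 16)) / sqrt (sqrt (real j))) \<longlonglongrightarrow> 0" by real_asymp
  then show "(\<lambda>j. radius (base_time j) / sqrt (sqrt (real j))) \<longlonglongrightarrow> 0"
    by (simp add: radius_def base_time_def add.commute)
qed

lemma filterlim_sample_index: "filterlim sample_index at_top sequentially"
proof -
  have "filterlim (\<lambda>n. (ln (real n))\<^sup>2 - 1) at_top sequentially" by real_asymp
  then have "filterlim (\<lambda>n. \<lfloor>(ln (real n))\<^sup>2 - 1\<rfloor>) at_top sequentially"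
    by (rule filterlim_compose[OF filterlim_floor_sequentially])
  then show ?thesis unfolding sample_index_def
    by (rule filterlim_compose[OF filterlim_nat_sequentially])
qed

lemma eventually_sample_time_le: "\<forall>\<^sub>F n in sequentially. sample_time (sample_index n) \<le> n"
proof -
  \<comment> \<open>The second summand bounds \<open>base_time j\<close>, since j + 1 is at most (ln
    n)^2.\<close>
  have "\<forall>\<^sub>F n in sequentially. exp (sqrt ((ln (real n))\<^sup>2 - 1)) + ((ln (real n))\<^sup>2)\<^sup>2 \<le> real n"
    by real_asymp
  moreover have "\<forall>\<^sub>F n in sequentially. (ln (real n))\<^sup>2 - 1 \<ge> 0" by real_asymp
  ultimately show ?thesis
  proof eventually_elim
    case (elim n)
    define j where "j = sample_index n"
    have j: "real j \<le> (ln (real n))\<^sup>2 - 1" using elim(2) by (simp add: j_def sample_index_def)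
    have "real (lag j) \<le> exp (sqrt (real j))" by (simp add: lag_def)
    also have "\<dots> \<le> exp (sqrt ((ln (real n))\<^sup>2 - 1))" using j by simp
    finally have "real (lag j) \<le> exp (sqrt ((ln (real n))\<^sup>2 - 1))" .
    moreover have "real (base_time j) \<le> ((ln (real n))\<^sup>2)\<^sup>2"
      using j unfolding base_time_def of_nat_power by (intro power_mono) auto
    ultimately have "real (sample_time j) \<le> real n" using elim(1) by (simp add: sample_time_def)
    then show ?case by (simp add: j_def)
  qed
qed

lemma sample_time_ratio: "(\<lambda>n. real (sample_time (sample_index n)) / real n) \<longlonglongrightarrow> 1"
proof (rule tendsto_sandwich)
  \<comment> \<open>The floor in \<open>sample_index\<close> costs at most one further unit, hence
    the 2; the quotient is exp of a term of order 1 / ln n.\<close>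
  show "(\<lambda>n. exp (sqrt ((ln (real n))\<^sup>2 - 2)) / real n) \<longlonglongrightarrow> 1" by real_asymp
  show "(\<lambda>n. 1) \<longlonglongrightarrow> (1 :: real)" by simp
  show "\<forall>\<^sub>F n in sequentially. real (sample_time (sample_index n)) / real n \<le> 1"
    using eventually_sample_time_le by eventually_elim (auto simp: divide_le_eq_1)
  have "exp (sqrt ((ln (real n))\<^sup>2 - 2)) / real n \<le> real (sample_time (sample_index n)) / real n" for n
  proof -
    have "(ln (real n))\<^sup>2 - 2 \<le> real (sample_index n)" unfolding sample_index_def by linarith
    then have "exp (sqrt ((ln (real n))\<^sup>2 - 2)) \<le> exp (sqrt (real (sample_index n)))" by simp
    then show ?thesis using sample_time_ge[of "sample_index n"]
      by (intro divide_right_mono order_trans[OF _ sample_time_ge]) auto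
  qed
  then show "\<forall>\<^sub>F n in sequentially. exp (sqrt ((ln (real n))\<^sup>2 - 2)) / real n \<le> real (sample_time (sample_index n)) / real n"
    by simp
qed

lemma ln_sample_time_diff: "(\<lambda>n. ln (real n) - sample_log (sample_index n)) \<longlonglongrightarrow> 0"
proof -
  have "(\<lambda>n. - ln (real (sample_time (sample_index n)) / real n)) \<longlonglongrightarrow> - ln 1"
    by (intro tendsto_intros sample_time_ratio) simp
  then have lim: "(\<lambda>n. - ln (real (sample_time (sample_index n)) / real n)) \<longlonglongrightarrow> 0" by simp
  have "sample_time j > 0" for j by (simp add: sample_time_def base_time_def)
  then have "- ln (real (sample_time (sample_index n)) / real n) = ln (real n) - sample_log (sample_index n)"
    if "n > 0" for n using that by (simp add: ln_div)
  then have "\<forall>\<^sub>F n in sequentially. - ln (real (sample_time (sample_index n)) / real n) =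
      ln (real n) - sample_log (sample_index n)"
    by (intro eventually_mono[OF eventually_gt_at_top[of "0 :: nat"]]) blast
  with lim show ?thesis by (rule Lim_transform_eventually)
qed

section \<open>Trigonometric test functions\<close>

text \<open>The complex coefficient c lets one real function cover the cosine (c = 1) and the sine
  (c = -i), and the averaging operators change c only, see \<open>shift_mean_wave\<close>.\<close>

definition wave :: "complex \<Rightarrow> 'a::real_inner \<Rightarrow> 'a \<Rightarrow> real" where
  "wave c t x = Re (c * iexp (t \<bullet> x))"

lemma wave_abs_le: "\<bar>wave c t x\<bar> \<le> norm c"
  unfolding wave_def using abs_Re_le_cmod[of "c * iexp (t \<bullet> x)"] by (simp add: norm_mult)

lemma wave_measurable [measurable]:
  "wave c (t :: 'a::euclidean_space) \<in> borel_measurable borel"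
  unfolding wave_def by measurable

lemma bounded_borel_wave: "bounded_borel (wave c (t :: 'a::euclidean_space))"
  by (rule bounded_borelI[OF wave_measurable wave_abs_le])

lemma wave_lipschitz: "\<bar>wave c t x - wave c t y\<bar> \<le> norm c * norm t * norm (x - y)"
proof -
  have "wave c t x - wave c t y = Re (c * iexp (t \<bullet> y) * (iexp (t \<bullet> (x - y)) - 1))"
    by (simp add: wave_def algebra_simps inner_diff_right flip: exp_add)
  also have "\<bar>\<dots>\<bar> \<le> norm c * norm (iexp (t \<bullet> (x - y)) - 1)"
    using abs_Re_le_cmod[of "c * iexp (t \<bullet> y) * (iexp (t \<bullet> (x - y)) - 1)"] by (simp add: norm_mult)
  also have "norm (iexp (t \<bullet> (x - y)) - 1) \<le> \<bar>t \<bullet> (x - y)\<bar>"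
    using iexp_approx1[of "t \<bullet> (x - y)" 0] by simp
  also have "\<bar>t \<bullet> (x - y)\<bar> \<le> norm t * norm (x - y)" by (rule Cauchy_Schwarz_ineq2)
  finally show ?thesis by (simp add: mult_left_mono mult.assoc)
qed

lemma norm_iexp_minus_one_le: "norm (iexp \<theta> - 1) \<le> min 2 \<bar>\<theta>\<bar>"
proof -
  have "norm (iexp \<theta> - 1) \<le> \<bar>\<theta>\<bar>" using iexp_approx1[of \<theta> 0] by simp
  moreover have "norm (iexp \<theta> - 1) \<le> norm (iexp \<theta>) + norm (1 :: complex)" by (rule norm_triangle_ineq4)
  ultimately show ?thesis by simp
qed

definition rescale :: "'a::real_vector \<Rightarrow> nat \<Rightarrow> 'a \<Rightarrow> 'a" where
  "rescale m n x = (x - ln (real n) *\<^sub>R m) /\<^sub>R sqrt (ln (real n))"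

lemma rescale_measurable [measurable]:
  "rescale (m :: 'a::euclidean_space) n \<in> borel_measurable borel"
  unfolding rescale_def by measurable

lemma bounded_borel_rescale:
  fixes m :: "'a::euclidean_space"
  assumes "bounded_borel f"
  shows "bounded_borel (\<lambda>x. f (rescale m n x))"
  using assms measurable_compose[OF rescale_measurable bounded_borel_measurable[OF assms]]
  by (auto simp: bounded_borel_def)

section \<open>Limit theorem for urn processes\<close>

locale urn_process_square_integrable = urn_process +
  assumes square_integrable_offset: "integrable \<nu> (\<lambda>y. (norm y)\<^sup>2)"
begin

definition drift :: 'b where "drift = (\<integral>y. y \<partial>\<nu>)"
definition spread :: real where "spread = (\<integral>y. (norm y)\<^sup>2 \<partial>\<nu>)"

sublocale offset: prob_space \<nu> by (rule offset(1))

lemma offset_measurable: "f \<in> borel_measurable borel \<Longrightarrow> f \<in> borel_measurable \<nu>"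
  by (simp cong: measurable_cong_sets add: offset(2))

lemma integrable_norm_offset: "integrable \<nu> (\<lambda>y. norm y)"
  using offset.square_integrable_imp_integrable[of norm] square_integrable_offset
  by (simp add: offset_measurable)

lemma integrable_id_offset: "integrable \<nu> (\<lambda>y. y)"
  using integrable_norm_offset by (rule integrable_norm_cancel) (simp add: offset_measurable)

lemma spread_nonneg: "spread \<ge> 0" by (simp add: spread_def)

definition absmean :: real where "absmean = (\<integral>y. norm y \<partial>\<nu>)"

lemma absmean_nonneg: "absmean \<ge> 0" by (simp add: absmean_def)

section \<open>Mass far from the origin\<close>

lemma shift_mean_trunc_norm_le:
  assumes R: "R > 0"
  shows "shift_mean \<nu> (trunc_norm R) x \<le> trunc_norm R x + absmean / R"
proof -
  have "shift_mean \<nu> (trunc_norm R) x \<le> (\<integral>y. trunc_norm R x + norm y / R \<partial>\<nu>)"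
    unfolding shift_mean_def
  proof (rule integral_mono)
    show "integrable \<nu> (\<lambda>y. trunc_norm R (x + y))"
    proof (intro integrable_offset bounded_borelI)
      show "(\<lambda>y. trunc_norm R (x + y)) \<in> borel_measurable borel" by (simp add: trunc_norm_def)
      show "\<bar>trunc_norm R (x + y)\<bar> \<le> 1" for y by (rule trunc_norm_abs_le[OF R])
    qed
    show "integrable \<nu> (\<lambda>y. trunc_norm R x + norm y / R)"
      using integrable_norm_offset by simp
    show "trunc_norm R (x + y) \<le> trunc_norm R x + norm y / R" for y
      using trunc_norm_lipschitz[OF R, of "x + y" x] by simp
  qed
  also have "\<dots> = trunc_norm R x + absmean / R"
    using integrable_norm_offset offset.prob_space by (simp add: absmean_def)
  finally show ?thesis .
qed

text \<open>An offset raises the truncated norm by at most E|\<eta>| / R on average, and a step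
  gives the added mass the weight 1 / \<open>W (Suc n)\<close>. The noise disappears on integration
  over an event known at time n.\<close>

lemma mean_trunc_norm_Suc:
  assumes R: "R > 0" and A: "A \<in> sets (F n)"
  shows "expectation (\<lambda>\<omega>. indicator A \<omega> * mean (Suc n) (trunc_norm R) \<omega>) \<le>
    expectation (\<lambda>\<omega>. indicator A \<omega> * mean n (trunc_norm R) \<omega>) + absmean / (R * W (Suc n))"
proof -
  note bb = bounded_borel_trunc_norm[OF R]
  have AM: "A \<in> sets M" using A subalg[of n] by (auto simp: subalgebra_def)
  have int: "integrable M (\<lambda>\<omega>. indicator A \<omega> * mean k (trunc_norm R) \<omega>)" for k
    using integrable_mult_indicator[OF AM mean_integrable[OF bb, of k]] by simp
  have "indicator A \<in> borel_measurable (F n)" using A by simp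
  note orth = noise_orthogonal[OF bb this, of 1]
  have "mean n (shift_mean \<nu> (trunc_norm R)) \<omega> - mean n (trunc_norm R) \<omega> \<le> absmean / R" for \<omega>
  proof -
    have "mean n (shift_mean \<nu> (trunc_norm R)) \<omega> \<le> mean n (\<lambda>x. trunc_norm R x + absmean / R) \<omega>"
      using shift_mean_trunc_norm_le[OF R] bb
      by (intro mean_mono bounded_borel_add bounded_borel_const bounded_borel_shift_mean) auto
    then show ?thesis by (simp add: mean_add[OF bb bounded_borel_const] mean_const)
  qed
  then have "(mean n (shift_mean \<nu> (trunc_norm R)) \<omega> - mean n (trunc_norm R) \<omega>) / W (Suc n) \<le>
      absmean / (R * W (Suc n))" for \<omega>
    using divide_right_mono[of _ "absmean / R" "W (Suc n)"] W_pos[of "Suc n"] by simp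
  then have step: "mean (Suc n) (trunc_norm R) \<omega> \<le> mean n (trunc_norm R) \<omega> + absmean / (R * W (Suc n)) +
      noise n (trunc_norm R) \<omega>" for \<omega>
    unfolding mean_Suc_step[OF bb] mean_step[OF bb] by (simp add: add_left_mono)
  have pos: "0 \<le> absmean / (R * W (Suc n))" using absmean_nonneg R W_pos[of "Suc n"] by simp
  have "expectation (\<lambda>\<omega>. indicator A \<omega> * mean (Suc n) (trunc_norm R) \<omega>) \<le>
    expectation (\<lambda>\<omega>. indicator A \<omega> * mean n (trunc_norm R) \<omega> + absmean / (R * W (Suc n)) +
      indicator A \<omega> * noise n (trunc_norm R) \<omega>)"
    using orth int step pos by (intro integral_mono) (auto simp: indicator_def)
  also have "\<dots> = expectation (\<lambda>\<omega>. indicator A \<omega> * mean n (trunc_norm R) \<omega>) + absmean / (R * W (Suc n))"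
    using orth int by (simp add: prob_space)
  finally show ?thesis .
qed

text \<open>The logarithmic time elapsed between K and K + j. Over this period the prediction acts
  on waves nearly as a compound Poisson walk of this duration, see
  \<open>norm_prod_minus_exp_le\<close>.\<close>

definition harm_sum :: "nat \<Rightarrow> nat \<Rightarrow> real" where
  "harm_sum K j = (\<Sum>i<j. 1 / W (Suc (K + i)))"

lemma harm_sum_nonneg: "harm_sum K j \<ge> 0"
  unfolding harm_sum_def using W_pos by (intro sum_nonneg) (simp add: less_imp_le)

text \<open>The inequality ln x <= x - 1 at the ratio of successive masses;
  \<open>harm_sum_ge\<close> uses it at the reciprocal kind of ratio, with the masses shifted by
  one.\<close>

lemma harm_sum_le: "harm_sum K j \<le> ln (W (K + j)) - ln (W K)"
proof (induction j)
  case (Suc j)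
  have "ln (W (K + j) / W (Suc (K + j))) \<le> W (K + j) / W (Suc (K + j)) - 1"
    using W_pos by (intro ln_le_minus_one) simp
  also have "\<dots> = - 1 / W (Suc (K + j))" using W_pos[of "Suc (K + j)"] by (simp add: W_Suc field_simps)
  finally have "1 / W (Suc (K + j)) \<le> ln (W (Suc (K + j))) - ln (W (K + j))"
    using W_pos[of "K + j"] W_pos[of "Suc (K + j)"] by (simp add: ln_div)
  then show ?case using Suc by (simp add: harm_sum_def)
qed (simp add: harm_sum_def)

lemma harm_sum_ge: "ln (W (K + j) + 1) - ln (W K + 1) \<le> harm_sum K j"
proof (induction j)
  case (Suc j)
  define v where "v = W (Suc (K + j))"
  have v: "v > 0" "W (K + j) + 1 = v" using W_pos[of "K + j"] by (simp_all add: v_def W_Suc)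
  have "ln ((v + 1) / v) \<le> (v + 1) / v - 1" using v by (intro ln_le_minus_one) simp
  also have "\<dots> = 1 / v" using v by (simp add: field_simps)
  finally have "ln (v + 1) - ln v \<le> 1 / v" using v by (simp add: ln_div)
  then show ?case using Suc v by (simp add: harm_sum_def flip: v_def)
qed (simp add: harm_sum_def)

lemma expectation_mean_trunc_norm_le:
  assumes "R > 0"
  shows "expectation (mean n (trunc_norm R)) \<le> (\<integral>x. trunc_norm R x \<partial>\<mu>\<^sub>0) / W 0 + absmean / R * harm_sum 0 n"
proof (induction n)
  case 0
  show ?case by (simp add: urn_mean_def harm_sum_def W_def prob_space)
next
  case (Suc n)
  have "expectation (mean k (trunc_norm R)) = expectation (\<lambda>\<omega>. indicator (space M) \<omega> * mean k (trunc_norm R) \<omega>)" for k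
    by (intro Bochner_Integration.integral_cong) auto
  moreover have "space M \<in> sets (F n)" using subalg[of n] sets.top[of "F n"] by (simp add: subalgebra_def)
  ultimately show ?case
    using mean_trunc_norm_Suc[OF assms, of "space M" n] Suc by (simp add: harm_sum_def distrib_left)
qed

text \<open>The radius grows with n, which only lowers the truncated norm, so the inequality for
  fixed R survives. The drift is of order n^(-17/16) and summable. The expectation tends to 0: the
  contribution of \<open>\<mu>\<^sub>0\<close> by dominated convergence, the accumulated drift
  because ln n is beaten by a power of n.\<close>

lemma mean_trunc_norm_tendsto_zero: "AE \<omega> in M. (\<lambda>n. mean n (trunc_norm (radius n)) \<omega>) \<longlonglongrightarrow> 0"
proof (rule almost_supermartingale_AE_tendsto_zero[where F = F and
      c = "\<lambda>n. absmean / (radius (Suc n) * W (Suc n))"])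
  note bb = bounded_borel_trunc_norm[OF radius_pos]
  show "subalgebra M (F n)" "sets (F n) \<subseteq> sets (F (Suc n))" for n by (rule subalg filtration)+
  show "mean n (trunc_norm (radius n)) \<in> borel_measurable (F n)" for n by (rule mean_measurable_F[OF bb])
  show "integrable M (mean n (trunc_norm (radius n)))" for n by (rule mean_integrable[OF bb])
  show nonneg: "0 \<le> mean n (trunc_norm (radius n)) \<omega>" for n \<omega>
    using mean_mono[OF bounded_borel_const bb trunc_norm_nonneg[OF radius_pos]] by (simp add: mean_const)
  show "expectation (\<lambda>\<omega>. indicator A \<omega> * mean (Suc n) (trunc_norm (radius (Suc n))) \<omega>)
      \<le> expectation (\<lambda>\<omega>. indicator A \<omega> * mean n (trunc_norm (radius n)) \<omega>) + absmean / (radius (Suc n) * W (Suc n))"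
    if A: "A \<in> sets (F n)" for n A
  proof -
    have AM: "A \<in> sets M" using A subalg[of n] by (auto simp: subalgebra_def)
    have int: "integrable M (\<lambda>\<omega>. indicator A \<omega> * mean n (trunc_norm (radius k)) \<omega>)" for k
      using integrable_mult_indicator[OF AM mean_integrable[OF bb, of n]] by simp
    have "radius n \<le> radius (Suc n)" by (auto simp: radius_def intro!: powr_mono2)
    then have "trunc_norm (radius (Suc n)) x \<le> trunc_norm (radius n) x" for x :: 'b
      unfolding trunc_norm_def using radius_pos[of n] by (intro min.mono divide_left_mono mult_pos_pos) (auto intro: radius_pos)
    then have "mean n (trunc_norm (radius (Suc n))) \<omega> \<le> mean n (trunc_norm (radius n)) \<omega>" for \<omega>
      by (intro mean_mono bb)
    then have "expectation (\<lambda>\<omega>. indicator A \<omega> * mean n (trunc_norm (radius (Suc n))) \<omega>) \<le>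
        expectation (\<lambda>\<omega>. indicator A \<omega> * mean n (trunc_norm (radius n)) \<omega>)"
      using int by (intro integral_mono mult_left_mono) auto
    then show ?thesis using mean_trunc_norm_Suc[OF radius_pos A, of "Suc n"] by linarith
  qed
  show "0 \<le> absmean / (radius (Suc n) * W (Suc n))" for n
    using absmean_nonneg radius_pos[of "Suc n"] W_pos[of "Suc n"] by simp
  have "summable (\<lambda>n. real (Suc n) powr (- 17 / 16))"
    using summable_real_powr_iff[of "- 17 / 16"] by (subst summable_Suc_iff) simp
  then have "summable (\<lambda>n. absmean * real (Suc n) powr (- 17 / 16))" by (rule summable_mult)
  then show "summable (\<lambda>n. absmean / (radius (Suc n) * W (Suc n)))"
  proof (rule summable_comparison_test'[where N = 0])
    fix n :: nat
    have pos: "0 < radius (Suc n) * W (Suc n)" using W_pos[of "Suc n"] radius_pos[of "Suc n"] by simp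
    have "real (Suc n) powr (17 / 16) = real (Suc n) powr (1 / 16 + 1)" by simp
    also have "\<dots> = real (Suc n) powr (1 / 16) * real (Suc n)" by (subst powr_add) simp
    also have "\<dots> \<le> radius (Suc n) * W (Suc n)"
    proof (rule mult_mono)
      show "real (Suc n) powr (1 / 16) \<le> radius (Suc n)" unfolding radius_def by (rule powr_mono2) auto
      show "real (Suc n) \<le> W (Suc n)" using W_pos[of 0] by (simp add: W_def)
    qed (auto simp: radius_def)
    finally have "absmean / (radius (Suc n) * W (Suc n)) \<le> absmean / real (Suc n) powr (17 / 16)"
      using absmean_nonneg pos by (intro divide_left_mono mult_pos_pos[OF pos]) auto
    also have "\<dots> = absmean * real (Suc n) powr (- 17 / 16)" by (simp add: powr_minus_divide)
    finally show "norm (absmean / (radius (Suc n) * W (Suc n))) \<le> absmean * real (Suc n) powr (- 17 / 16)"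
      using absmean_nonneg pos by simp
  qed
  show "(\<lambda>n. expectation (mean n (trunc_norm (radius n)))) \<longlonglongrightarrow> 0"
  proof (rule tendsto_sandwich[OF _ _ tendsto_const])
    show "\<forall>\<^sub>F n in sequentially. 0 \<le> expectation (mean n (trunc_norm (radius n)))"
      using nonneg by (intro always_eventually allI integral_nonneg_AE) simp
    define b where "b n = (\<integral>x. trunc_norm (radius n) x \<partial>\<mu>\<^sub>0) / W 0 + absmean / radius n * (ln (W n) - ln (W 0))" for n
    show "\<forall>\<^sub>F n in sequentially. expectation (mean n (trunc_norm (radius n))) \<le> b n"
    proof (intro always_eventually allI)
      fix n
      have "absmean / radius n * harm_sum 0 n \<le> absmean / radius n * (ln (W n) - ln (W 0))"
        using harm_sum_le[of 0 n] absmean_nonneg radius_pos[of n] by (intro mult_left_mono) auto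
      then show "expectation (mean n (trunc_norm (radius n))) \<le> b n"
        using expectation_mean_trunc_norm_le[OF radius_pos, of n n] unfolding b_def by linarith
    qed
    interpret \<mu>\<^sub>0: finite_measure \<mu>\<^sub>0 by (rule init)
    have lim1: "(\<lambda>n. \<integral>x. trunc_norm (radius n) x \<partial>\<mu>\<^sub>0) \<longlonglongrightarrow> (\<integral>x. 0 \<partial>\<mu>\<^sub>0)"
    proof (rule integral_dominated_convergence[where w = "\<lambda>_. 1"])
      show "(\<lambda>x. trunc_norm (radius n) x) \<in> borel_measurable \<mu>\<^sub>0" for n
        using integrable_init[OF bb] by auto
      show "AE x in \<mu>\<^sub>0. (\<lambda>n. trunc_norm (radius n) x) \<longlonglongrightarrow> 0"
      proof (rule AE_I2)
        fix x :: 'b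
        have "(\<lambda>n. norm x / radius n) \<longlonglongrightarrow> 0" unfolding radius_def by real_asymp
        then have "(\<lambda>n. min 1 (norm x / radius n)) \<longlonglongrightarrow> min 1 0" by (intro tendsto_intros)
        then show "(\<lambda>n. trunc_norm (radius n) x) \<longlonglongrightarrow> 0" by (simp add: trunc_norm_def)
      qed
      show "AE x in \<mu>\<^sub>0. norm (trunc_norm (radius n) x) \<le> 1" for n
        using trunc_norm_abs_le[OF radius_pos] by auto
    qed auto
    have lim2: "(\<lambda>n. absmean / radius n * (ln (W n) - ln (W 0))) \<longlonglongrightarrow> 0"
      unfolding radius_def W_def by real_asymp
    have "W 0 \<noteq> 0" using W_pos[of 0] by simp
    from tendsto_add[OF tendsto_divide[OF lim1 tendsto_const this] lim2]
    show "b \<longlonglongrightarrow> 0" unfolding b_def by simp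
  qed
qed

lemma mean_trunc_norm_base_time:
  "AE \<omega> in M. (\<lambda>j. mean (base_time j) (trunc_norm (radius (base_time j))) \<omega>) \<longlonglongrightarrow> 0"
proof -
  have "filterlim base_time at_top sequentially"
    unfolding base_time_def by (rule filterlim_at_top_mono[OF filterlim_Suc]) (auto simp: power2_eq_square)
  note lim = filterlim_compose[OF _ this]
  show ?thesis using mean_trunc_norm_tendsto_zero by eventually_elim (rule lim)
qed

section \<open>Logarithmic time up to a sample time\<close>

text \<open>Both logarithmic bounds on \<open>harm_sum\<close> equal ln n up to a logarithm taken at
  the base time k. The initial mass, by which \<open>W n\<close> exceeds n, is absorbed there
  through \<open>W n\<close> <= n (\<open>W k\<close> + 1).\<close>

lemma harm_sum_sample_time:
  "\<bar>sample_log j - harm_sum (base_time j) (lag j)\<bar> \<le> ln (W (base_time j) + 1)"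
proof -
  define k n where "k = base_time j" and "n = sample_time j"
  have k: "k \<ge> 1" and "k \<le> n" by (simp_all add: n_def k_def sample_time_def base_time_def)
  then have n: "n \<ge> 1" by simp
  have w: "W 0 > 0" "W n = W 0 + real n" "W k = W 0 + real k" using W_pos[of 0] by (simp_all add: W_def)
  have le: "harm_sum k (lag j) \<le> ln (W n) - ln (W k)" and ge: "ln (W n + 1) - ln (W k + 1) \<le> harm_sum k (lag j)"
    using harm_sum_le[of k "lag j"] harm_sum_ge[of k "lag j"] by (simp_all add: n_def k_def sample_time_def)
  have "ln (real n) \<le> ln (W n + 1)" using n w by simp
  moreover have "ln (W n) \<le> ln (real n * (W k + 1))"
  proof -
    have "W 0 + real n \<le> real n * W 0 + real n * 1" using n w(1) by simp
    also have "\<dots> \<le> real n * (W k + 1)" using w by (simp add: distrib_left mult_left_mono)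
    finally show ?thesis using w by simp
  qed
  then have "ln (W n) \<le> ln (real n) + ln (W k + 1)" using n W_pos[of k] by (simp add: ln_mult)
  moreover have "0 \<le> ln (W k)" using k w by simp
  ultimately show ?thesis using le ge unfolding k_def n_def by linarith
qed

text \<open>The centering moves by ln n times the mean offset, the predicted walk by
  \<open>harm_sum\<close> times it. The mismatch has to vanish at the scale sqrt(ln n) of the
  fluctuations; agreement to first order, as in \<open>harm_sum_ratio\<close>, would not suffice for
  the drift.\<close>

lemma harm_sum_negligible:
  "(\<lambda>j. (sample_log j - harm_sum (base_time j) (lag j)) / sqrt (sample_log j)) \<longlonglongrightarrow> 0"
proof (rule Lim_null_comparison)
  have "(\<lambda>j. ln (1 + (w + (1 + real j)\<^sup>2)) / sqrt (sqrt (real j))) \<longlonglongrightarrow> 0" for w :: real by real_asymp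
  from this[of "measure \<mu>\<^sub>0 UNIV"]
  show "(\<lambda>j. ln (W (base_time j) + 1) / sqrt (sample_log j)) \<longlonglongrightarrow> 0"
    by (intro div_sqrt_ln_sample_time_tendsto_zero) (simp add: W_def base_time_def add_ac)
  have "norm ((sample_log j - harm_sum (base_time j) (lag j)) / sqrt (sample_log j))
      \<le> ln (W (base_time j) + 1) / sqrt (sample_log j)" for j
  proof -
    have "0 \<le> sample_log j" using ln_sample_time_ge[of j] real_sqrt_ge_zero[of "real j"] by linarith
    then show ?thesis using harm_sum_sample_time[of j] by (simp add: divide_right_mono)
  qed
  then show "\<forall>\<^sub>F j in sequentially. norm ((sample_log j - harm_sum (base_time j) (lag j)) / sqrt (sample_log j))
      \<le> ln (W (base_time j) + 1) / sqrt (sample_log j)" by simp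
qed

lemma harm_sum_ratio: "(\<lambda>j. harm_sum (base_time j) (lag j) / sample_log j) \<longlonglongrightarrow> 1"
proof -
  let ?L = "\<lambda>j. sample_log j" and ?H = "\<lambda>j. harm_sum (base_time j) (lag j)"
  have "filterlim (\<lambda>j. sqrt (?L j)) at_top sequentially"
    by (rule filterlim_compose[OF sqrt_at_top ln_sample_time_at_top])
  then have "(\<lambda>j. inverse (sqrt (?L j))) \<longlonglongrightarrow> 0" by (rule tendsto_inverse_0_at_top)
  from tendsto_diff[OF tendsto_const[of 1] tendsto_mult[OF harm_sum_negligible this]]
  have "(\<lambda>j. 1 - (?L j - ?H j) / sqrt (?L j) * inverse (sqrt (?L j))) \<longlonglongrightarrow> 1" by simp
  moreover have "\<forall>\<^sub>F j in sequentially. 1 - (?L j - ?H j) / sqrt (?L j) * inverse (sqrt (?L j)) = ?H j / ?L j"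
    using eventually_ln_sample_time_pos by eventually_elim (simp add: field_simps)
  ultimately show ?thesis by (rule Lim_transform_eventually)
qed

section \<open>Prediction of waves\<close>

definition offset_char :: "'b \<Rightarrow> complex" where
  "offset_char t = (CLINT y|\<nu>. iexp (t \<bullet> y))"

lemma integrable_iexp_offset: "integrable \<nu> (\<lambda>y. iexp (t \<bullet> y))"
  by (intro offset.integrable_const_bound[where B = 1]) (auto intro: offset_measurable)

lemma norm_offset_char_le: "norm (offset_char t) \<le> 1"
  unfolding offset_char_def
  by (rule order_trans[OF integral_norm_bound]) (simp add: offset.prob_space)

text \<open>Waves are eigenfunctions of averaging over the offset, with the characteristic function
  as eigenvalue; this makes the whole predictor explicit in \<open>pull_wave\<close>.\<close>

lemma shift_mean_wave: "shift_mean \<nu> (wave c t) x = wave (c * offset_char t) t x"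
proof -
  have "shift_mean \<nu> (wave c t) x = (\<integral>y. Re (c * iexp (t \<bullet> x) * iexp (t \<bullet> y)) \<partial>\<nu>)"
    by (simp add: shift_mean_def wave_def inner_add_right distrib_left exp_add mult.assoc)
  also have "\<dots> = Re (CLINT y|\<nu>. c * iexp (t \<bullet> x) * iexp (t \<bullet> y))"
    using integrable_iexp_offset by (intro integral_Re) auto
  finally show ?thesis by (simp add: wave_def offset_char_def mult_ac)
qed

lemma pull_wave:
  "pull K j (wave c t) = wave (c * (\<Prod>i<j. 1 + (offset_char t - 1) / W (Suc (K + i)))) t"
proof (induction j arbitrary: c)
  case (Suc j)
  have "step (K + j) (wave c t) = wave (c * (1 + (offset_char t - 1) / W (Suc (K + j)))) t"
    by (simp add: step_def[abs_def] shift_mean_wave fun_eq_iff) (simp add: wave_def algebra_simps diff_divide_distrib add_divide_distrib)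
  then show ?case by (simp add: Suc mult_ac)
qed simp

text \<open>Each factor 1 + \<psi> r with r = 1 / W in [0, 1] is a convex combination of 1 and 1 +
  \<psi>, hence in the unit disc; so is exp (\<psi> r), because Re \<psi> <= 0. The products
  therefore differ by at most the sum of the differences of their factors. Taylor's formula bounds
  each of these by 4 exp 2 r^2, as |\<psi>| <= 2, and the r^2 are dominated by a telescoping sum.
  The bound is uniform in j and \<psi>, which matters since both vary with the sample time.\<close>

lemma norm_prod_minus_exp_le:
  fixes \<psi> :: complex
  assumes "norm (1 + \<psi>) \<le> 1"
  shows "norm ((\<Prod>i<j. 1 + \<psi> / W (Suc (K + i))) - exp (\<psi> * harm_sum K j)) \<le> 4 * exp 2 / W K"
proof -
  define r where "r i = 1 / W (Suc (K + i))" for i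
  have r: "0 < r i" "r i \<le> 1" for i using W_Suc_ge[of "K + i"] by (auto simp: r_def)
  have \<psi>2: "norm \<psi> \<le> 2" using norm_triangle_ineq4[of "1 + \<psi>" 1] assms by simp
  have Re\<psi>: "Re \<psi> \<le> 0" using complex_Re_le_cmod[of "1 + \<psi>"] assms by simp
  have n1: "norm (1 + \<psi> * r i) \<le> 1" for i
  proof -
    have "1 + \<psi> * r i = of_real (1 - r i) + r i * (1 + \<psi>)" by (simp add: algebra_simps)
    also have "norm \<dots> \<le> (1 - r i) + r i * norm (1 + \<psi>)"
      using r[of i] by (intro order_trans[OF norm_triangle_ineq]) (simp add: norm_mult del: of_real_diff)
    also have "\<dots> \<le> (1 - r i) + r i * 1" using r[of i] assms by (intro add_left_mono mult_left_mono) auto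
    finally show ?thesis by simp
  qed
  have n2: "norm (exp (\<psi> * r i)) \<le> 1" for i
    using Re\<psi> r[of i] by (simp add: mult_nonpos_nonneg less_imp_le)
  have diff: "norm ((1 + \<psi> * r i) - exp (\<psi> * r i)) \<le> 4 * exp 2 * (1 / W (K + i) - 1 / W (Suc (K + i)))" for i
  proof -
    have "norm (\<psi> * r i) \<le> 2 * 1"
      unfolding norm_mult using \<psi>2 r[of i] by (intro mult_mono) auto
    then have "\<bar>Re (\<psi> * r i)\<bar> \<le> 2" using abs_Re_le_cmod order_trans by fastforce
    have "norm (exp (\<psi> * r i) - (\<Sum>k\<le>1. (\<psi> * r i) ^ k / fact k)) \<le> exp \<bar>Re (\<psi> * r i)\<bar> * norm (\<psi> * r i) ^ Suc 1 / fact 1"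
      by (rule Taylor_exp)
    also have "\<dots> \<le> exp 2 * (2 * r i) ^ 2"
    proof -
      have "norm (\<psi> * r i) \<le> 2 * r i" using \<psi>2 r[of i] by (simp add: norm_mult)
      then have "norm (\<psi> * r i) ^ 2 \<le> (2 * r i) ^ 2" by (intro power_mono) auto
      moreover have "exp \<bar>Re (\<psi> * r i)\<bar> \<le> exp 2" using \<open>\<bar>Re (\<psi> * r i)\<bar> \<le> 2\<close> by simp
      ultimately have "exp \<bar>Re (\<psi> * r i)\<bar> * norm (\<psi> * r i) ^ 2 \<le> exp 2 * (2 * r i) ^ 2"
        by (intro mult_mono) auto
      then show ?thesis by (simp add: numeral_2_eq_2)
    qed
    also have "(2 * r i) ^ 2 = 4 * (r i * r i)" by (simp add: power2_eq_square)
    also have "r i * r i \<le> 1 / W (K + i) - 1 / W (Suc (K + i))"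
    proof -
      have "r i * r i \<le> 1 / (W (K + i) * W (Suc (K + i)))"
        unfolding r_def using W_pos[of "K + i"] W_pos[of "Suc (K + i)"]
        by (simp add: W_Suc[of "K + i"]) (intro divide_left_mono mult_right_mono, auto)
      also have "\<dots> = 1 / W (K + i) - 1 / W (Suc (K + i))"
        using W_pos[of "K + i"] W_pos[of "Suc (K + i)"] by (simp add: field_simps) (simp add: W_Suc)
      finally show ?thesis .
    qed
    finally show ?thesis by (simp add: norm_minus_commute mult_left_mono algebra_simps)
  qed
  have "(\<Sum>i<j. 1 / W (K + i) - 1 / W (Suc (K + i))) = 1 / W K - 1 / W (K + j)"
    by (induction j) simp_all
  also have "\<dots> \<le> 1 / W K" using W_pos[of "K + j"] by simp
  finally have tele: "(\<Sum>i<j. 1 / W (K + i) - 1 / W (Suc (K + i))) \<le> 1 / W K" .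
  have "exp (\<psi> * harm_sum K j) = (\<Prod>i<j. exp (\<psi> * r i))"
    by (simp add: harm_sum_def r_def sum_distrib_left exp_sum)
  then have "norm ((\<Prod>i<j. 1 + \<psi> * r i) - exp (\<psi> * harm_sum K j)) \<le> (\<Sum>i<j. norm ((1 + \<psi> * r i) - exp (\<psi> * r i)))"
    using norm_prod_diff[of "{..<j}" "\<lambda>i. 1 + \<psi> * r i" "\<lambda>i. exp (\<psi> * r i)"] n1 n2 by simp
  also have "\<dots> \<le> (\<Sum>i<j. 4 * exp 2 * (1 / W (K + i) - 1 / W (Suc (K + i))))"
    by (intro sum_mono diff)
  also have "\<dots> \<le> 4 * exp 2 * (1 / W K)"
    unfolding sum_distrib_left[symmetric] using tele by (intro mult_left_mono) auto
  finally show ?thesis by (simp add: r_def)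
qed

text \<open>Along multiples of s only the real variable s \<bullet> y is seen, so the expansion is
  the one-dimensional one for its law.\<close>

lemma offset_char_second_order:
  assumes "u \<longlonglongrightarrow> 0"
  shows "(\<lambda>j. (offset_char (u j *\<^sub>R s) - (1 + \<i> * u j * (s \<bullet> drift) - (u j)\<^sup>2 * (\<integral>y. (s \<bullet> y)\<^sup>2 \<partial>\<nu>) / 2))
    / (of_real (u j))\<^sup>2) \<longlonglongrightarrow> 0"
proof -
  let ?D = "distr \<nu> borel (\<lambda>y. s \<bullet> y)"
  have [measurable]: "(\<lambda>y. s \<bullet> y) \<in> borel_measurable \<nu>" by (rule offset_measurable) measurable
  interpret D: real_distribution ?D by (rule offset.real_distribution_distr) measurable
  have "integrable \<nu> (\<lambda>y. (s \<bullet> y)\<^sup>2)"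
  proof (rule Bochner_Integration.integrable_bound[OF integrable_mult_right[OF square_integrable_offset]])
    show "AE y in \<nu>. norm ((s \<bullet> y)\<^sup>2) \<le> norm ((norm s)\<^sup>2 * (norm y)\<^sup>2)"
      using Cauchy_Schwarz_ineq2[of s] by (intro AE_I2) (simp add: abs_le_square_iff[symmetric] abs_mult flip: power_mult_distrib)
  qed measurable
  then have "integrable ?D (\<lambda>x. x\<^sup>2)" by (subst integrable_distr_eq) auto
  note lim = D.char_second_order[OF this assms]
  have "char ?D (u j) = offset_char (u j *\<^sub>R s)" for j
    by (simp add: char_def offset_char_def integral_distr)
  moreover have "D.expectation (\<lambda>x. x) = s \<bullet> drift"
  proof -
    have "D.expectation (\<lambda>x. x) = (\<integral>y. s \<bullet> y \<partial>\<nu>)" by (rule integral_distr) measurable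
    also have "\<dots> = s \<bullet> drift" unfolding drift_def using integrable_id_offset by (rule integral_inner_right)
    finally show ?thesis .
  qed
  moreover have "D.expectation (\<lambda>x. x\<^sup>2) = (\<integral>y. (s \<bullet> y)\<^sup>2 \<partial>\<nu>)"
    by (rule integral_distr) measurable
  ultimately show ?thesis using lim by simp
qed

text \<open>The second moments are at most 4 / (j + 1)^2 for any test functions bounded by 1. These
  may change with j, as they do when a fixed function is composed with the rescaling at the sample
  time.\<close>

lemma mean_pull_sample_time:
  assumes f: "\<And>j. bounded_borel (f j)" "\<And>j x. \<bar>f j x\<bar> \<le> 1"
  shows "AE \<omega> in M. (\<lambda>j. mean (sample_time j) (f j) \<omega> - mean (base_time j) (pull (base_time j) (lag j) (f j)) \<omega>) \<longlonglongrightarrow> 0"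
proof (rule AE_tendsto_zero_if_summable_second_moments)
  note pb = pull_bounded[OF f]
  define Y where "Y j \<omega> = mean (sample_time j) (f j) \<omega> - mean (base_time j) (pull (base_time j) (lag j) (f j)) \<omega>" for j \<omega>
  show meas: "Y j \<in> borel_measurable M" for j
    unfolding Y_def by (intro borel_measurable_diff mean_measurable f pb)
  have Y2: "(Y j \<omega>)\<^sup>2 \<le> 2\<^sup>2" for j \<omega>
  proof -
    have "\<bar>Y j \<omega>\<bar> \<le> 2" unfolding Y_def
      using mean_abs_le[OF f, of "sample_time j" j \<omega>] mean_abs_le[OF pb, of "base_time j" "base_time j" "lag j" j \<omega>] by linarith
    then show ?thesis using power2_le_iff_abs_le[of 2 "Y j \<omega>"] by simp
  qed
  show "integrable M (\<lambda>\<omega>. (Y j \<omega>)\<^sup>2)" for j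
    using Y2 meas by (intro integrable_const_bound[where B = "2\<^sup>2"]) auto
  show "expectation (\<lambda>\<omega>. (Y j \<omega>)\<^sup>2) \<le> 4 * (1 / real (Suc j) ^ 2)" for j
  proof -
    have "expectation (\<lambda>\<omega>. (Y j \<omega>)\<^sup>2) \<le> 4 * (1 / W (base_time j) - 1 / W (sample_time j))"
      unfolding Y_def sample_time_def by (rule mean_pull_second_moment[OF f])
    also have "\<dots> \<le> 4 * (1 / W (base_time j))" using W_pos[of "sample_time j"] by simp
    also have "1 / W (base_time j) \<le> 1 / real (Suc j) ^ 2"
    proof (rule divide_left_mono)
      show "real (Suc j) ^ 2 \<le> W (base_time j)" using W_pos[of 0] by (simp add: W_def base_time_def)
    qed (auto intro!: mult_pos_pos W_pos)
    finally show ?thesis by simp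
  qed
  have "summable (\<lambda>j. 1 / real (Suc j) ^ 2)"
    using inverse_power_summable[of 2, where 'a = real] by (subst summable_Suc_iff) (simp add: inverse_eq_divide)
  then show "summable (\<lambda>j. 4 * (1 / real (Suc j) ^ 2))" by (rule summable_mult)
qed

text \<open>In the original coordinate the test function is a wave of slow frequency
  \<open>u j\<close> s. Its prediction has the coefficient \<open>c j * p j\<close>, which converges
  to the value \<zeta> of the limit, and the remaining slow oscillation is close to 1 on all mass
  within \<open>radius (base_time j)\<close>; mass beyond it is controlled by
  \<open>mean_trunc_norm_base_time\<close>.\<close>

lemma mean_wave_sample_time:
  assumes z: "norm z \<le> 1"
  shows "AE \<omega> in M. (\<lambda>j. mean (sample_time j) (\<lambda>x. wave z s (rescale drift (sample_time j) x)) \<omega>)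
    \<longlonglongrightarrow> Re (z * exp (- (\<integral>y. (s \<bullet> y)\<^sup>2 \<partial>\<nu>) / 2))"
proof -
  define L where "L j = sample_log j" for j
  define H where "H j = harm_sum (base_time j) (lag j)" for j
  define u where "u j = 1 / sqrt (L j)" for j
  define \<sigma> where "\<sigma> = (\<integral>y. (s \<bullet> y)\<^sup>2 \<partial>\<nu>)"
  define \<psi> where "\<psi> j = offset_char (u j *\<^sub>R s) - 1" for j
  define c where "c j = z * exp (- \<i> * (s \<bullet> drift) * sqrt (L j))" for j
  define p where "p j = (\<Prod>i<lag j. 1 + \<psi> j / W (Suc (base_time j + i)))" for j
  define \<zeta> where "\<zeta> = z * exp (- \<sigma> / 2)"
  have Ltop: "filterlim L at_top sequentially" unfolding L_def by (rule ln_sample_time_at_top)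
  then have sLtop: "filterlim (\<lambda>j. sqrt (L j)) at_top sequentially" by (rule filterlim_compose[OF sqrt_at_top])
  have u: "u \<longlonglongrightarrow> 0"
    unfolding u_def using tendsto_inverse_0_at_top[OF sLtop] by (simp add: inverse_eq_divide)
  have Lpos: "\<forall>\<^sub>F j in sequentially. L j > 0"
    unfolding L_def by (rule eventually_ln_sample_time_pos)
  have fw: "wave z s (rescale drift (sample_time j) x) = wave (c j) (u j *\<^sub>R s) x" if "L j > 0" for j x
  proof -
    have "s \<bullet> rescale drift (sample_time j) x = (u j *\<^sub>R s) \<bullet> x - (s \<bullet> drift) * (L j / sqrt (L j))"
      by (simp add: rescale_def u_def inner_diff_right L_def divide_inverse algebra_simps)
    also have "L j / sqrt (L j) = sqrt (L j)" using that by (simp add: real_div_sqrt)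
    finally have eq: "s \<bullet> rescale drift (sample_time j) x = (u j *\<^sub>R s) \<bullet> x - (s \<bullet> drift) * sqrt (L j)" .
    show ?thesis unfolding wave_def eq c_def
      by (simp add: exp_diff exp_minus right_diff_distrib mult.assoc divide_inverse mult_ac)
  qed
  define e where "e j = (\<psi> j - (\<i> * u j * (s \<bullet> drift) - (u j)\<^sup>2 * \<sigma> / 2)) / (of_real (u j))\<^sup>2" for j
  have e: "e \<longlonglongrightarrow> 0"
    using offset_char_second_order[OF u, of s] unfolding e_def[abs_def] \<psi>_def \<sigma>_def by (simp add: algebra_simps)
  \<comment> \<open>The exponent left when the centering phase meets the prediction. The terms
    linear in \<open>u j\<close> combine to the mismatch of H and L at scale sqrt L; the quadratic
    ones appear with the factor H / L, which tends to 1.\<close>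
  define q where "q j = \<i> * of_real ((s \<bullet> drift) * (- ((L j - H j) / sqrt (L j)))) + of_real (H j / L j) * (e j - of_real (\<sigma> / 2))" for j
  have "q \<longlonglongrightarrow> \<i> * of_real ((s \<bullet> drift) * (- 0)) + of_real 1 * (0 - of_real (\<sigma> / 2))"
    unfolding q_def L_def H_def
    by (intro tendsto_intros e harm_sum_negligible harm_sum_ratio)
  then have "(\<lambda>j. z * exp (q j)) \<longlonglongrightarrow> z * exp (- of_real (\<sigma> / 2))"
    by (intro tendsto_intros) simp
  then have zq: "(\<lambda>j. z * exp (q j)) \<longlonglongrightarrow> \<zeta>" by (simp add: \<zeta>_def exp_of_real[symmetric] del: exp_of_real)
  have qeq: "c j * exp (\<psi> j * H j) = z * exp (q j)" if "L j > 0" for j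
  proof -
    have uu: "(of_real (u j))\<^sup>2 = (1 / of_real (L j) :: complex)" using that
      by (simp add: u_def power2_eq_square flip: of_real_mult)
    have u2: "(u j)\<^sup>2 = 1 / L j" using that by (simp add: u_def power_divide)
    have ul: "H j / sqrt (L j) - sqrt (L j) = - ((L j - H j) / sqrt (L j))"
      using that by (simp add: field_simps)
    have \<psi>e: "\<psi> j = (\<i> * u j * (s \<bullet> drift) - (u j)\<^sup>2 * \<sigma> / 2) + e j / L j"
      using that unfolding e_def uu by simp
    have "- \<i> * (s \<bullet> drift) * sqrt (L j) + \<psi> j * H j =
        \<i> * of_real ((s \<bullet> drift) * (H j / sqrt (L j) - sqrt (L j))) + of_real (H j / L j) * (e j - of_real (\<sigma> / 2))"
      by (subst \<psi>e[unfolded u2]) (simp add: u_def algebra_simps diff_divide_distrib add_divide_distrib)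
    then have "- \<i> * (s \<bullet> drift) * sqrt (L j) + \<psi> j * H j = q j" unfolding ul q_def .
    then show ?thesis unfolding c_def by (simp add: mult.assoc flip: exp_add)
  qed
  have cn: "norm (c j) \<le> 1" for j
    using z by (simp add: c_def norm_mult)
  have "(\<lambda>j. c j * p j - c j * exp (\<psi> j * H j)) \<longlonglongrightarrow> 0"
  proof (rule Lim_null_comparison[where g = "\<lambda>j. 4 * exp 2 / W (base_time j)"])
    show "\<forall>\<^sub>F j in sequentially. norm (c j * p j - c j * exp (\<psi> j * H j)) \<le> 4 * exp 2 / W (base_time j)"
    proof (intro always_eventually allI)
      fix j
      have "norm (1 + \<psi> j) \<le> 1" using norm_offset_char_le by (simp add: \<psi>_def)
      then have "norm (p j - exp (\<psi> j * H j)) \<le> 4 * exp 2 / W (base_time j)"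
        unfolding p_def H_def by (rule norm_prod_minus_exp_le)
      then have "norm (c j) * norm (p j - exp (\<psi> j * H j)) \<le> 1 * (4 * exp 2 / W (base_time j))"
        using cn by (intro mult_mono) auto
      then show "norm (c j * p j - c j * exp (\<psi> j * H j)) \<le> 4 * exp 2 / W (base_time j)"
        by (simp add: norm_mult flip: right_diff_distrib)
    qed
    show "(\<lambda>j. 4 * exp 2 / W (base_time j)) \<longlonglongrightarrow> 0"
      unfolding W_def base_time_def of_nat_power of_nat_Suc by real_asymp
  qed
  moreover have "(\<lambda>j. c j * exp (\<psi> j * H j)) \<longlonglongrightarrow> \<zeta>"
    using zq by (rule Lim_transform_eventually) (use Lpos in \<open>auto elim!: eventually_mono simp: qeq\<close>)
  ultimately have "(\<lambda>j. (c j * p j - c j * exp (\<psi> j * H j)) + c j * exp (\<psi> j * H j)) \<longlonglongrightarrow> 0 + \<zeta>"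
    by (rule tendsto_add)
  then have cp: "(\<lambda>j. c j * p j) \<longlonglongrightarrow> \<zeta>" by simp
  have \<zeta>1: "norm \<zeta> \<le> 1"
  proof -
    have "norm \<zeta> = norm z * exp (- \<sigma> / 2)" by (simp add: \<zeta>_def norm_mult)
    also have "\<dots> \<le> 1" using z by (intro mult_le_one) (auto simp: \<sigma>_def)
    finally show ?thesis .
  qed
  define V where "V j \<omega> = mean (base_time j) (trunc_norm (radius (base_time j))) \<omega>" for j \<omega>
  have V: "AE \<omega> in M. (\<lambda>j. V j \<omega>) \<longlonglongrightarrow> 0"
    unfolding V_def by (rule mean_trunc_norm_base_time)
  have "(\<lambda>j. norm s * (radius (base_time j) / sqrt (L j))) \<longlonglongrightarrow> norm s * 0"
    unfolding L_def by (intro tendsto_intros radius_base_time_negligible)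
  then have rad: "\<forall>\<^sub>F j in sequentially. norm s * (radius (base_time j) / sqrt (L j)) < 2"
    by (intro order_tendstoD(2)) auto
  \<comment> \<open>The second condition makes the phase at most 2 |x| / r in absolute value with r
    the radius, and min 2 (2 |x| / r) is twice the truncated norm.\<close>
  have pull_close: "\<bar>wave (c j * p j) (u j *\<^sub>R s) x - Re \<zeta>\<bar> \<le> norm (c j * p j - \<zeta>) + 2 * trunc_norm (radius (base_time j)) x"
    if j: "L j > 0" "norm s * (radius (base_time j) / sqrt (L j)) < 2" for j x
  proof -
    define \<theta> where "\<theta> = (u j *\<^sub>R s) \<bullet> x"
    define r where "r = radius (base_time j)"
    have r: "r > 0" by (simp add: r_def radius_pos)
    have "\<bar>\<theta>\<bar> \<le> norm s / sqrt (L j) * norm x"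
      using Cauchy_Schwarz_ineq2[of "u j *\<^sub>R s" x] j(1) by (simp add: \<theta>_def u_def)
    also have "\<dots> \<le> 2 / r * norm x"
      using j(2) r by (intro mult_right_mono) (auto simp: r_def field_simps)
    finally have "norm (iexp \<theta> - 1) \<le> 2 * trunc_norm r x"
      using norm_iexp_minus_one_le[of \<theta>] by (auto simp: trunc_norm_def)
    have "wave (c j * p j) (u j *\<^sub>R s) x - Re \<zeta> = Re ((c j * p j - \<zeta>) * iexp \<theta> + \<zeta> * (iexp \<theta> - 1))"
      unfolding wave_def \<theta>_def[symmetric] minus_complex.sel[symmetric] by (rule arg_cong[where f = Re]) (simp add: algebra_simps)
    also have "\<bar>\<dots>\<bar> \<le> norm ((c j * p j - \<zeta>) * iexp \<theta>) + norm (\<zeta> * (iexp \<theta> - 1))"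
      by (rule order_trans[OF abs_Re_le_cmod norm_triangle_ineq])
    also have "\<dots> \<le> norm (c j * p j - \<zeta>) + 1 * (2 * trunc_norm r x)"
      unfolding norm_mult using \<zeta>1 \<open>norm (iexp \<theta> - 1) \<le> 2 * trunc_norm r x\<close>
      by (intro add_mono mult_mono) auto
    finally show ?thesis by (simp add: r_def)
  qed
  have "AE \<omega> in M. (\<lambda>j. mean (sample_time j) (wave (c j) (u j *\<^sub>R s)) \<omega> -
      mean (base_time j) (pull (base_time j) (lag j) (wave (c j) (u j *\<^sub>R s))) \<omega>) \<longlonglongrightarrow> 0"
    using cn wave_abs_le by (intro mean_pull_sample_time bounded_borel_wave) (blast intro: order_trans)
  with V show ?thesis
  proof eventually_elim
    case (elim \<omega>)
    have "(\<lambda>j. mean (base_time j) (wave (c j * p j) (u j *\<^sub>R s)) \<omega> - Re \<zeta>) \<longlonglongrightarrow> 0"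
    proof (rule Lim_null_comparison)
      have "(\<lambda>j. norm (c j * p j - \<zeta>) + 2 * V j \<omega>) \<longlonglongrightarrow> norm (\<zeta> - \<zeta>) + 2 * 0"
        by (intro tendsto_intros cp elim)
      then show "(\<lambda>j. norm (c j * p j - \<zeta>) + 2 * V j \<omega>) \<longlonglongrightarrow> 0" by simp
      show "\<forall>\<^sub>F j in sequentially. norm (mean (base_time j) (wave (c j * p j) (u j *\<^sub>R s)) \<omega> - Re \<zeta>)
          \<le> norm (c j * p j - \<zeta>) + 2 * V j \<omega>"
        using Lpos rad
      proof eventually_elim
        case (elim j)
        let ?g = "wave (c j * p j) (u j *\<^sub>R s)" and ?t = "trunc_norm (radius (base_time j)) :: 'b \<Rightarrow> real"
        have "?g x \<le> (Re \<zeta> + norm (c j * p j - \<zeta>)) + 2 * ?t x"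
          "(Re \<zeta> - norm (c j * p j - \<zeta>)) + 2 * (- 1 * ?t x) \<le> ?g x" for x
          using pull_close[OF elim, of x] by linarith+
        then have "mean (base_time j) ?g \<omega> \<le> mean (base_time j) (\<lambda>x. (Re \<zeta> + norm (c j * p j - \<zeta>)) + 2 * ?t x) \<omega>"
          "mean (base_time j) (\<lambda>x. (Re \<zeta> - norm (c j * p j - \<zeta>)) + 2 * (- 1 * ?t x)) \<omega> \<le> mean (base_time j) ?g \<omega>"
          by (intro mean_mono bounded_borel_wave bounded_borel_add bounded_borel_const bounded_borel_cmult
              bounded_borel_trunc_norm radius_pos; simp)+
        then show ?case
          by (simp only: mean_add[OF bounded_borel_const bounded_borel_cmult[OF bounded_borel_trunc_norm[OF radius_pos]]]
              mean_add[OF bounded_borel_const bounded_borel_cmult[OF bounded_borel_cmult[OF bounded_borel_trunc_norm[OF radius_pos]]]]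
              mean_const mean_cmult V_def real_norm_def)
      qed
    qed
    moreover have "pull (base_time j) (lag j) (wave (c j) (u j *\<^sub>R s)) = wave (c j * p j) (u j *\<^sub>R s)" for j
      by (simp add: pull_wave p_def \<psi>_def)
    ultimately have "(\<lambda>j. (mean (sample_time j) (wave (c j) (u j *\<^sub>R s)) \<omega> -
        mean (base_time j) (wave (c j * p j) (u j *\<^sub>R s)) \<omega>) +
        (mean (base_time j) (wave (c j * p j) (u j *\<^sub>R s)) \<omega> - Re \<zeta>) + Re \<zeta>) \<longlonglongrightarrow> 0 + 0 + Re \<zeta>"
      using elim(2) by (intro tendsto_add tendsto_const) simp_all
    then have "(\<lambda>j. mean (sample_time j) (wave (c j) (u j *\<^sub>R s)) \<omega>) \<longlonglongrightarrow> Re \<zeta>" by simp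
    then have "(\<lambda>j. mean (sample_time j) (\<lambda>x. wave z s (rescale drift (sample_time j) x)) \<omega>) \<longlonglongrightarrow> Re \<zeta>"
    proof (rule Lim_transform_eventually)
      show "\<forall>\<^sub>F j in sequentially. mean (sample_time j) (wave (c j) (u j *\<^sub>R s)) \<omega> =
          mean (sample_time j) (\<lambda>x. wave z s (rescale drift (sample_time j) x)) \<omega>"
        using Lpos by eventually_elim (simp add: fw)
    qed
    then show ?case by (simp add: \<zeta>_def \<sigma>_def)
  qed
qed

section \<open>Tightness along the sample times\<close>

text \<open>Averaging maps quadratic functions to quadratic functions. It is stated for a bounded f
  below a quadratic one, so that it can be iterated within the bounded functions to which
  \<open>pull\<close> applies.\<close>

lemma shift_mean_le_quadratic:
  assumes f: "bounded_borel f" and le: "\<And>x. f x \<le> \<alpha> * ((norm (x - b))\<^sup>2 + \<beta>)"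
  shows "shift_mean \<nu> f x \<le> \<alpha> * ((norm (x - b))\<^sup>2 + 2 * ((x - b) \<bullet> drift) + spread + \<beta>)"
proof -
  have int: "integrable \<nu> (\<lambda>y. (norm (x - b))\<^sup>2 + 2 * ((x - b) \<bullet> y) + (norm y)\<^sup>2 + \<beta>)"
    using integrable_id_offset square_integrable_offset by simp
  have "shift_mean \<nu> f x \<le> (\<integral>y. \<alpha> * ((norm (x - b))\<^sup>2 + 2 * ((x - b) \<bullet> y) + (norm y)\<^sup>2 + \<beta>) \<partial>\<nu>)"
    unfolding shift_mean_def
  proof (rule integral_mono)
    show "integrable \<nu> (\<lambda>y. f (x + y))"
    proof (rule integrable_offset)
      have "(\<lambda>y. f (x + y)) \<in> borel_measurable borel"
        using bounded_borel_measurable[OF f] by measurable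
      then show "bounded_borel (\<lambda>y. f (x + y))" using f by (auto simp: bounded_borel_def)
    qed
    show "integrable \<nu> (\<lambda>y. \<alpha> * ((norm (x - b))\<^sup>2 + 2 * ((x - b) \<bullet> y) + (norm y)\<^sup>2 + \<beta>))"
      using int by (rule integrable_mult_right)
    show "f (x + y) \<le> \<alpha> * ((norm (x - b))\<^sup>2 + 2 * ((x - b) \<bullet> y) + (norm y)\<^sup>2 + \<beta>)" for y
    proof -
      have "(norm (x + y - b))\<^sup>2 = (norm (x - b))\<^sup>2 + 2 * ((x - b) \<bullet> y) + (norm y)\<^sup>2"
        using dot_norm[of "x - b" y] by (simp add: algebra_simps)
      then show ?thesis using le[of "x + y"] by simp
    qed
  qed
  also have "\<dots> = \<alpha> * ((norm (x - b))\<^sup>2 + 2 * ((x - b) \<bullet> drift) + spread + \<beta>)"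
    using integrable_id_offset square_integrable_offset offset.prob_space
    by (simp add: drift_def spread_def)
  finally show ?thesis .
qed

lemma step_le_quadratic:
  fixes n :: nat
  assumes f: "bounded_borel f" and le: "\<And>x. f x \<le> \<alpha> * ((norm (x - b))\<^sup>2 + \<beta>)" and \<alpha>: "\<alpha> \<ge> 0"
  defines "\<epsilon> \<equiv> 1 / W (Suc n)"
  shows "step n f x \<le> \<alpha> * ((norm (x - (b - \<epsilon> *\<^sub>R drift)))\<^sup>2 + (\<beta> + \<epsilon> * spread))"
proof -
  have \<epsilon>: "0 \<le> \<epsilon>" "\<epsilon> \<le> 1" using W_Suc_ge[of n] by (auto simp: \<epsilon>_def)
  have "step n f x = (1 - \<epsilon>) * f x + \<epsilon> * shift_mean \<nu> f x"
    by (simp add: step_def \<epsilon>_def algebra_simps diff_divide_distrib)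
  also have "\<dots> \<le> (1 - \<epsilon>) * (\<alpha> * ((norm (x - b))\<^sup>2 + \<beta>)) +
      \<epsilon> * (\<alpha> * ((norm (x - b))\<^sup>2 + 2 * ((x - b) \<bullet> drift) + spread + \<beta>))"
    using \<epsilon> by (intro add_mono mult_left_mono le shift_mean_le_quadratic[OF f le]) auto
  also have "\<dots> = \<alpha> * ((norm (x - b))\<^sup>2 + 2 * \<epsilon> * ((x - b) \<bullet> drift) + (\<beta> + \<epsilon> * spread))"
    by (simp add: algebra_simps)
  \<comment> \<open>Adding the square of \<epsilon> drift completes the square: the averaged
    quadratic is again centred, at b moved back by \<epsilon> drift, and along \<open>pull\<close>
    these moves add up to \<open>harm_sum\<close> times the drift.\<close>
  also have "\<dots> \<le> \<alpha> * ((norm (x - b))\<^sup>2 + 2 * \<epsilon> * ((x - b) \<bullet> drift) + (norm (\<epsilon> *\<^sub>R drift))\<^sup>2 + (\<beta> + \<epsilon> * spread))"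
    using \<alpha> by (intro mult_left_mono) auto
  also have "(norm (x - b))\<^sup>2 + 2 * \<epsilon> * ((x - b) \<bullet> drift) + (norm (\<epsilon> *\<^sub>R drift))\<^sup>2 = (norm (x - (b - \<epsilon> *\<^sub>R drift)))\<^sup>2"
    using dot_norm[of "x - b" "\<epsilon> *\<^sub>R drift"] by (simp add: algebra_simps)
  finally show ?thesis .
qed

lemma pull_le_quadratic:
  assumes "bounded_borel f" and "\<And>x. f x \<le> \<alpha> * ((norm (x - b))\<^sup>2 + \<beta>)" and \<alpha>: "\<alpha> \<ge> 0"
  shows "pull K j f x \<le> \<alpha> * ((norm (x - (b - harm_sum K j *\<^sub>R drift)))\<^sup>2 + (\<beta> + harm_sum K j * spread))"
  using assms(1,2)
proof (induction j arbitrary: f b \<beta>)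
  case 0
  then show ?case by (simp add: harm_sum_def)
next
  case (Suc j)
  show ?case
    using Suc.IH[OF bounded_borel_step[OF Suc.prems(1)] step_le_quadratic[OF Suc.prems \<alpha>], of "K + j"]
    by (simp add: harm_sum_def algebra_simps scaleR_add_left)
qed

text \<open>A bound of order 1 / R that holds eventually in j, whatever R. Points within the radius
  of the base time are handled by the quadratic bound on the predictor; beyond it the truncated norm
  at that radius is already 1. The limit of \<open>q\<close> has 1 + \<open>spread\<close> in the
  numerator, and the 2 gives the slack for a strict inequality.\<close>

lemma mean_trunc_norm_sample_time_less:
  assumes R: "R > 0"
  shows "AE \<omega> in M. \<forall>\<^sub>F j in sequentially.
    mean (sample_time j) (\<lambda>x. trunc_norm R (rescale drift (sample_time j) x)) \<omega> < (2 + spread) / (2 * R)"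
proof -
  define L where "L j = sample_log j" for j
  define H where "H j = harm_sum (base_time j) (lag j)" for j
  define r where "r j = radius (base_time j)" for j
  define f where "f j x = trunc_norm R (rescale drift (sample_time j) x)" for j x
  \<comment> \<open>The summands: rescaled distance of a starting point from the origin together
    with the mismatch of logarithmic times, the constant from 2 v <= v^2 + 1, and the second moment
    gathered during time H.\<close>
  define q where "q j = ((r j / sqrt (L j) + \<bar>(L j - H j) / sqrt (L j)\<bar> * norm drift)\<^sup>2 + 1 + H j / L j * spread) / (2 * R)" for j
  note bf = bounded_borel_rescale[OF bounded_borel_trunc_norm[OF R]]
  have f1: "bounded_borel (f j)" "\<bar>f j x\<bar> \<le> 1" for j x
    unfolding f_def by (rule bf trunc_norm_abs_le[OF R])+
  note pb = pull_bounded[OF f1]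
  have Lpos: "\<forall>\<^sub>F j in sequentially. L j > 0"
    unfolding L_def by (rule eventually_ln_sample_time_pos)
  have "q \<longlonglongrightarrow> ((0 + \<bar>0\<bar> * norm drift)\<^sup>2 + 1 + 1 * spread) / (2 * R)"
    unfolding q_def L_def H_def r_def using R
    by (intro tendsto_intros radius_base_time_negligible harm_sum_negligible harm_sum_ratio) auto
  then have q: "q \<longlonglongrightarrow> (1 + spread) / (2 * R)" by simp
  have pull_le: "pull (base_time j) (lag j) (f j) x \<le> trunc_norm (r j) x + q j" if L: "L j > 0" for j x
  proof (cases "norm x \<le> r j")
    case False
    have "q j \<ge> 0" unfolding q_def H_def using harm_sum_nonneg spread_nonneg L R
      by (intro divide_nonneg_pos add_nonneg_nonneg mult_nonneg_nonneg) auto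
    moreover have "r j > 0" unfolding r_def by (rule radius_pos)
    with False have "trunc_norm (r j) x = 1" by (simp add: trunc_norm_def)
    moreover have "pull (base_time j) (lag j) (f j) x \<le> 1"
      using pull_bounded(2)[OF f1(1)[of j] f1(2), of "base_time j" "lag j" x] by (simp add: abs_le_iff)
    ultimately show ?thesis by linarith
  next
    case True
    \<comment> \<open>The truncated norm grows linearly; 2 v <= v^2 + 1 trades this for the
      quadratic majorant that \<open>pull_le_quadratic\<close> asks for.\<close>
    have "f j y \<le> 1 / (2 * R * L j) * ((norm (y - L j *\<^sub>R drift))\<^sup>2 + L j)" for y
    proof -
      define v where "v = norm (rescale drift (sample_time j) y)"
      have "f j y \<le> v / R" by (simp add: f_def trunc_norm_def v_def)
      also have "2 * v \<le> v\<^sup>2 + 1" using sum_squares_bound[of v 1] by simp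
      then have "v / R \<le> (v\<^sup>2 + 1) / (2 * R)" using R by (simp add: field_simps)
      also have "v\<^sup>2 = (norm (y - L j *\<^sub>R drift))\<^sup>2 / L j"
        using L by (simp add: v_def rescale_def L_def power_divide power_mult_distrib divide_inverse power_inverse)
      also have "((norm (y - L j *\<^sub>R drift))\<^sup>2 / L j + 1) / (2 * R) =
          1 / (2 * R * L j) * ((norm (y - L j *\<^sub>R drift))\<^sup>2 + L j)"
        using L R by (simp add: field_simps)
      finally show ?thesis .
    qed
    from pull_le_quadratic[OF f1(1) this, of "base_time j" "lag j" x]
    have "pull (base_time j) (lag j) (f j) x \<le>
        1 / (2 * R * L j) * ((norm (x - (L j *\<^sub>R drift - H j *\<^sub>R drift)))\<^sup>2 + (L j + H j * spread))"
      using L R by (simp add: H_def)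
    also have "\<dots> \<le> 1 / (2 * R * L j) * ((r j + \<bar>L j - H j\<bar> * norm drift)\<^sup>2 + (L j + H j * spread))"
    proof -
      have "norm (x - (L j *\<^sub>R drift - H j *\<^sub>R drift)) \<le> norm x + norm ((L j - H j) *\<^sub>R drift)"
        unfolding scaleR_diff_left[symmetric] by (rule norm_triangle_ineq4)
      also have "\<dots> \<le> r j + \<bar>L j - H j\<bar> * norm drift" using True by simp
      finally have "(norm (x - (L j *\<^sub>R drift - H j *\<^sub>R drift)))\<^sup>2 \<le> (r j + \<bar>L j - H j\<bar> * norm drift)\<^sup>2"
        by (intro power_mono) auto
      then show ?thesis using L R by (intro mult_left_mono add_right_mono) auto
    qed
    also have "\<dots> = q j"
    proof -
      have "r j / sqrt (L j) + \<bar>(L j - H j) / sqrt (L j)\<bar> * norm drift = (r j + \<bar>L j - H j\<bar> * norm drift) / sqrt (L j)"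
        using L by (simp add: add_divide_distrib)
      then have "q j = ((r j + \<bar>L j - H j\<bar> * norm drift)\<^sup>2 / L j + 1 + H j / L j * spread) / (2 * R)"
        using L by (simp add: q_def power_divide)
      also have "\<dots> = 1 / (2 * R * L j) * ((r j + \<bar>L j - H j\<bar> * norm drift)\<^sup>2 + (L j + H j * spread))"
        using L R by (simp add: field_simps)
      finally show ?thesis by simp
    qed
    finally show ?thesis using trunc_norm_nonneg[OF radius_pos, of "base_time j" x] unfolding r_def by linarith
  qed
  have V: "AE \<omega> in M. (\<lambda>j. mean (base_time j) (trunc_norm (r j)) \<omega>) \<longlonglongrightarrow> 0"
    unfolding r_def by (rule mean_trunc_norm_base_time)
  have pred: "AE \<omega> in M. (\<lambda>j. mean (sample_time j) (f j) \<omega> - mean (base_time j) (pull (base_time j) (lag j) (f j)) \<omega>) \<longlonglongrightarrow> 0"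
    by (rule mean_pull_sample_time[OF f1])
  show ?thesis
    using pred V
  proof eventually_elim
    case (elim \<omega>)
    have "(1 + spread) / (2 * R) < (2 + spread) / (2 * R)" using R by (simp add: divide_strict_right_mono)
    moreover have "(\<lambda>j. (mean (sample_time j) (f j) \<omega> - mean (base_time j) (pull (base_time j) (lag j) (f j)) \<omega>) +
        mean (base_time j) (trunc_norm (r j)) \<omega> + q j) \<longlonglongrightarrow> 0 + 0 + (1 + spread) / (2 * R)"
      by (intro tendsto_add elim q)
    ultimately have "\<forall>\<^sub>F j in sequentially. (mean (sample_time j) (f j) \<omega> - mean (base_time j) (pull (base_time j) (lag j) (f j)) \<omega>) +
        mean (base_time j) (trunc_norm (r j)) \<omega> + q j < (2 + spread) / (2 * R)"
      by (intro order_tendstoD(2)) auto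
    then show ?case using Lpos
    proof eventually_elim
      case (elim j)
      have bt: "bounded_borel (trunc_norm (r j) :: 'b \<Rightarrow> real)" unfolding r_def by (rule bounded_borel_trunc_norm[OF radius_pos])
      have "mean (base_time j) (pull (base_time j) (lag j) (f j)) \<omega> \<le> mean (base_time j) (\<lambda>x. trunc_norm (r j) x + q j) \<omega>"
        using pull_le[OF elim(2)] by (intro mean_mono pb(1) bounded_borel_add bt bounded_borel_const)
      then show ?case using elim(1)
        unfolding mean_add[OF bt bounded_borel_const] mean_const f_def[symmetric] by simp
    qed
  qed
qed

text \<open>Tightness of the rescaled compositions along a, with the truncated norm in the role of
  the tail indicator: as a bounded Lipschitz function it is itself an admissible test function in
  \<open>mean_between_sample_times\<close>.\<close>

definition tight_at :: "'a \<Rightarrow> (nat \<Rightarrow> nat) \<Rightarrow> bool" where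
  "tight_at \<omega> a \<longleftrightarrow> (\<forall>\<epsilon>>0. \<exists>R>0. \<forall>\<^sub>F j in sequentially.
     mean (a j) (\<lambda>x. trunc_norm R (rescale drift (a j) x)) \<omega> < \<epsilon>)"

lemma tight_sample_time: "AE \<omega> in M. tight_at \<omega> sample_time"
proof -
  have "AE \<omega> in M. \<forall>k :: nat. \<forall>\<^sub>F j in sequentially.
      mean (sample_time j) (\<lambda>x. trunc_norm (real (Suc k)) (rescale drift (sample_time j) x)) \<omega> < (2 + spread) / (2 * real (Suc k))"
    unfolding AE_all_countable by (intro allI mean_trunc_norm_sample_time_less) simp
  then show ?thesis
  proof eventually_elim
    case (elim \<omega>)
    show ?case unfolding tight_at_def
    proof (intro allI impI)
      fix \<epsilon> :: real assume \<epsilon>: "\<epsilon> > 0"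
      obtain k :: nat where k: "(2 + spread) / (2 * \<epsilon>) < real k" using reals_Archimedean2 by blast
      then have "(2 + spread) / (2 * real (Suc k)) < \<epsilon>" using \<epsilon> by (simp add: field_simps)
      with elim[rule_format, of k] have "\<forall>\<^sub>F j in sequentially.
          mean (sample_time j) (\<lambda>x. trunc_norm (real (Suc k)) (rescale drift (sample_time j) x)) \<omega> < \<epsilon>"
        by (auto elim!: eventually_mono)
      then show "\<exists>R>0. \<forall>\<^sub>F j in sequentially.
          mean (sample_time j) (\<lambda>x. trunc_norm R (rescale drift (sample_time j) x)) \<omega> < \<epsilon>"
        by (intro exI[of _ "real (Suc k)"]) simp
    qed
  qed
qed

section \<open>From the sample times to all times\<close>

text \<open>From the sample time a n to n the composition changes in total variation by a vanishing
  amount, since a n / n tends to 1. The rescaling changes, in rescaled coordinates, by the affine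
  map sending y to \<open>\<alpha> n\<close> y - \<open>\<beta> n\<close> drift, which tends to the
  identity, but only locally uniformly; tightness takes care of large y.\<close>

lemma mean_between_sample_times:
  assumes tight: "tight_at \<omega> sample_time" and f: "bounded_borel f" "\<And>x. \<bar>f x\<bar> \<le> 1"
    and lip: "\<And>x y. \<bar>f x - f y\<bar> \<le> C * norm (x - y)"
  shows "(\<lambda>n. mean n (\<lambda>x. f (rescale drift n x)) \<omega> -
    mean (sample_time (sample_index n)) (\<lambda>x. f (rescale drift (sample_time (sample_index n)) x)) \<omega>) \<longlonglongrightarrow> 0"
proof -
  define a where "a n = sample_time (sample_index n)" for n
  define \<alpha> where "\<alpha> n = sqrt (ln (real (a n)) / ln (real n))" for n
  define \<beta> where "\<beta> n = (ln (real n) - ln (real (a n))) / sqrt (ln (real n))" for n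
  have C: "C \<ge> 0"
  proof -
    obtain b :: 'b where b: "b \<in> Basis" using nonempty_Basis by blast
    have "0 \<le> C * norm (b - 0)" using lip[of b 0] by linarith
    then show ?thesis using b by simp
  qed
  have lntop: "filterlim (\<lambda>n. ln (real n)) at_top sequentially" by real_asymp
  have diff0: "(\<lambda>n. ln (real n) - ln (real (a n))) \<longlonglongrightarrow> 0" unfolding a_def by (rule ln_sample_time_diff)
  have "(\<lambda>n. (ln (real n) - ln (real (a n))) * inverse (sqrt (ln (real n)))) \<longlonglongrightarrow> 0 * 0"
    by (intro tendsto_mult diff0 tendsto_inverse_0_at_top filterlim_compose[OF sqrt_at_top lntop])
  then have \<beta>: "\<beta> \<longlonglongrightarrow> 0" unfolding \<beta>_def by (simp add: divide_inverse)
  have ln0: "\<forall>\<^sub>F n in sequentially. ln (real n) > 0"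
    using filterlim_at_top_dense[THEN iffD1, OF lntop] by blast
  have la0: "\<forall>\<^sub>F n in sequentially. ln (real (a n)) > 0"
    unfolding a_def using filterlim_at_top_dense[THEN iffD1, OF filterlim_compose[OF ln_sample_time_at_top filterlim_sample_index]] by blast
  have an: "\<forall>\<^sub>F n in sequentially. a n \<le> n" unfolding a_def by (rule eventually_sample_time_le)
  have "(\<lambda>n. sqrt (1 - (ln (real n) - ln (real (a n))) * inverse (ln (real n)))) \<longlonglongrightarrow> sqrt (1 - 0 * 0)"
    by (intro tendsto_intros diff0 tendsto_inverse_0_at_top lntop)
  then have lim: "(\<lambda>n. sqrt (1 - (ln (real n) - ln (real (a n))) * inverse (ln (real n)))) \<longlonglongrightarrow> 1" by simp
  have "sqrt (1 - (ln (real n) - ln (real (a n))) * inverse (ln (real n))) = \<alpha> n" if "0 < ln (real n)" for n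
  proof -
    have "1 - (ln (real n) - ln (real (a n))) * inverse (ln (real n)) = ln (real (a n)) / ln (real n)"
      using that by (simp add: left_diff_distrib divide_inverse)
    then show ?thesis by (simp only: \<alpha>_def)
  qed
  then have \<alpha>: "\<alpha> \<longlonglongrightarrow> 1"
    by (intro Lim_transform_eventually[OF lim eventually_mono[OF ln0]])
  define g where "g R n = 2 * (1 - real (a n) / real n) + C * \<bar>\<beta> n\<bar> * norm drift +
    2 * mean (a n) (\<lambda>x. trunc_norm R (rescale drift (a n) x)) \<omega>" for R n
  have bound: "\<bar>mean n (\<lambda>x. f (rescale drift n x)) \<omega> - mean (a n) (\<lambda>x. f (rescale drift (a n) x)) \<omega>\<bar> \<le> g R n"
    if n: "ln (real n) > 0" "ln (real (a n)) > 0" "a n \<le> n" and \<alpha>n: "C * \<bar>\<alpha> n - 1\<bar> * R < 2" and R: "R > 0" for n R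
  proof -
    let ?ft = "\<lambda>x. f (rescale drift n x)" and ?fa = "\<lambda>x. f (rescale drift (a n) x)"
    let ?t = "\<lambda>x. trunc_norm R (rescale drift (a n) x)"
    have npos: "n > 0" using n(1) by (cases n) auto
    have b: "bounded_borel ?ft" "bounded_borel ?fa" "bounded_borel ?t"
      by (intro bounded_borel_rescale f bounded_borel_trunc_norm R)+
    have "\<bar>mean n ?ft \<omega> - mean (a n) ?ft \<omega>\<bar> \<le> 2 * 1 * (real n - real (a n)) / W n"
      using f(2) n(3) by (intro mean_shift_abs_le b)
    also have "\<dots> \<le> 2 * 1 * (real n - real (a n)) / real n"
      using n npos W_pos[of 0] by (intro divide_left_mono mult_pos_pos W_pos) (auto simp: W_def)
    also have "\<dots> = 2 * (1 - real (a n) / real n)" using npos by (simp add: field_simps)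
    finally have 1: "\<bar>mean n ?ft \<omega> - mean (a n) ?ft \<omega>\<bar> \<le> 2 * (1 - real (a n) / real n)" .
    have pt: "\<bar>?ft x - ?fa x\<bar> \<le> C * \<bar>\<beta> n\<bar> * norm drift + 2 * ?t x" for x
    proof -
      define y where "y = rescale drift (a n) x"
      have "sqrt (ln (real (a n))) *\<^sub>R y = x - ln (real (a n)) *\<^sub>R drift"
        using n by (simp add: y_def rescale_def)
      then have "x = sqrt (ln (real (a n))) *\<^sub>R y + ln (real (a n)) *\<^sub>R drift" by simp
      then have eq: "rescale drift n x = \<alpha> n *\<^sub>R y - \<beta> n *\<^sub>R drift"
        using n by (simp add: rescale_def \<alpha>_def \<beta>_def real_sqrt_mult real_sqrt_inverse divide_inverse algebra_simps)
      define \<theta> where "\<theta> = C * norm (\<alpha> n *\<^sub>R y - y)"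
      have "\<bar>f (rescale drift n x) - f (\<alpha> n *\<^sub>R y)\<bar> \<le> C * \<bar>\<beta> n\<bar> * norm drift"
        using lip[of "rescale drift n x" "\<alpha> n *\<^sub>R y"] by (simp add: eq mult.assoc)
      \<comment> \<open>The assumption on \<open>\<alpha> n\<close> turns the Lipschitz bound into 2
        |y| / R, and |f| <= 1 supplies the cap 2.\<close>
      moreover have "\<bar>f (\<alpha> n *\<^sub>R y) - f y\<bar> \<le> 2 * trunc_norm R y"
      proof -
        have "\<bar>f (\<alpha> n *\<^sub>R y) - f y\<bar> \<le> C * norm (\<alpha> n *\<^sub>R y - y)" by (rule lip)
        also have "\<alpha> n *\<^sub>R y - y = (\<alpha> n - 1) *\<^sub>R y" by (simp add: algebra_simps)
        also have "C * norm ((\<alpha> n - 1) *\<^sub>R y) = (C * \<bar>\<alpha> n - 1\<bar>) * norm y" by simp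
        also have "\<dots> \<le> 2 / R * norm y"
          using \<alpha>n R by (intro mult_right_mono) (auto simp: pos_le_divide_eq)
        finally have "\<bar>f (\<alpha> n *\<^sub>R y) - f y\<bar> \<le> 2 / R * norm y" .
        moreover have "\<bar>f (\<alpha> n *\<^sub>R y) - f y\<bar> \<le> 2" using f(2)[of "\<alpha> n *\<^sub>R y"] f(2)[of y] by linarith
        ultimately show ?thesis by (simp add: trunc_norm_def min_def)
      qed
      ultimately show ?thesis unfolding y_def by linarith
    qed
    let ?k = "C * \<bar>\<beta> n\<bar> * norm drift"
    have "?ft x \<le> ?fa x + (?k + 2 * ?t x)" "?fa x \<le> ?ft x + (?k + 2 * ?t x)" for x
      using pt[of x] by linarith+
    then have "mean (a n) ?ft \<omega> \<le> mean (a n) (\<lambda>x. ?fa x + (?k + 2 * ?t x)) \<omega>"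
      "mean (a n) ?fa \<omega> \<le> mean (a n) (\<lambda>x. ?ft x + (?k + 2 * ?t x)) \<omega>"
      using b by (auto intro!: mean_mono bounded_borel_add bounded_borel_const bounded_borel_cmult)
    moreover have "mean (a n) (\<lambda>x. h x + (?k + 2 * ?t x)) \<omega> = mean (a n) h \<omega> + (?k + 2 * mean (a n) ?t \<omega>)"
      if "bounded_borel h" for h
      using that b(3) by (simp add: mean_add bounded_borel_add bounded_borel_const bounded_borel_cmult mean_const mean_cmult)
    ultimately have 2: "\<bar>mean (a n) ?ft \<omega> - mean (a n) ?fa \<omega>\<bar> \<le> ?k + 2 * mean (a n) ?t \<omega>"
      using b by (simp add: abs_le_iff)
    show ?thesis using 1 2 unfolding g_def by linarith
  qed
  show ?thesis unfolding a_def[symmetric]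
  proof (rule tendstoI)
    fix \<epsilon> :: real assume \<epsilon>: "\<epsilon> > 0"
    then obtain R where R: "R > 0" "\<forall>\<^sub>F j in sequentially.
        mean (sample_time j) (\<lambda>x. trunc_norm R (rescale drift (sample_time j) x)) \<omega> < \<epsilon> / 4"
      using tight unfolding tight_at_def by (meson divide_pos_pos zero_less_numeral)
    have tn: "\<forall>\<^sub>F n in sequentially. mean (a n) (\<lambda>x. trunc_norm R (rescale drift (a n) x)) \<omega> < \<epsilon> / 4"
      unfolding a_def by (rule eventually_compose_filterlim[OF R(2) filterlim_sample_index])
    have "(\<lambda>n. C * \<bar>\<alpha> n - 1\<bar> * R) \<longlonglongrightarrow> C * \<bar>1 - 1\<bar> * R" by (intro tendsto_intros \<alpha>)
    then have \<alpha>n: "\<forall>\<^sub>F n in sequentially. C * \<bar>\<alpha> n - 1\<bar> * R < 2" by (intro order_tendstoD(2)) auto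
    have "(\<lambda>n. 2 * (1 - real (a n) / real n) + C * \<bar>\<beta> n\<bar> * norm drift) \<longlonglongrightarrow> 2 * (1 - 1) + C * \<bar>0\<bar> * norm drift"
      unfolding a_def by (intro tendsto_intros \<beta> sample_time_ratio)
    then have "\<forall>\<^sub>F n in sequentially. 2 * (1 - real (a n) / real n) + C * \<bar>\<beta> n\<bar> * norm drift < \<epsilon> / 2"
      using \<epsilon> by (intro order_tendstoD(2)) auto
    with tn \<alpha>n ln0 la0 an
    show "\<forall>\<^sub>F n in sequentially. dist (mean n (\<lambda>x. f (rescale drift n x)) \<omega> -
        mean (a n) (\<lambda>x. f (rescale drift (a n) x)) \<omega>) 0 < \<epsilon>"
    proof eventually_elim
      case (elim n)
      from bound[OF elim(3,4,5,2) R(1)] show ?case using elim(1,6) by (simp add: g_def)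
    qed
  qed
qed

lemma mean_tendsto_from_sample_times:
  assumes "tight_at \<omega> sample_time" "bounded_borel f" "\<And>x. \<bar>f x\<bar> \<le> 1"
    and "\<And>x y. \<bar>f x - f y\<bar> \<le> C * norm (x - y)"
    and lim: "(\<lambda>j. mean (sample_time j) (\<lambda>x. f (rescale drift (sample_time j) x)) \<omega>) \<longlonglongrightarrow> l"
  shows "(\<lambda>n. mean n (\<lambda>x. f (rescale drift n x)) \<omega>) \<longlonglongrightarrow> l"
  using tendsto_add[OF mean_between_sample_times[OF assms(1-4)] filterlim_compose[OF lim filterlim_sample_index]]
  by simp

text \<open>The comparison of times applies to \<open>trunc_norm R\<close> itself, which is bounded
  by 1 and Lipschitz with constant 1 / R.\<close>

lemma tight_all_times:
  assumes "tight_at \<omega> sample_time"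
  shows "tight_at \<omega> (\<lambda>n. n)"
  unfolding tight_at_def
proof (intro allI impI)
  fix \<epsilon> :: real assume \<epsilon>: "\<epsilon> > 0"
  then obtain R where R: "R > 0" "\<forall>\<^sub>F j in sequentially.
      mean (sample_time j) (\<lambda>x. trunc_norm R (rescale drift (sample_time j) x)) \<omega> < \<epsilon> / 2"
    using assms unfolding tight_at_def by (meson divide_pos_pos zero_less_numeral)
  have "\<bar>trunc_norm R x - trunc_norm R y\<bar> \<le> 1 / R * norm (x - y)" for x y :: 'b
    using trunc_norm_lipschitz[OF R(1), of x y] by simp
  from mean_between_sample_times[OF assms bounded_borel_trunc_norm[OF R(1)] trunc_norm_abs_le[OF R(1)] this]
  have "\<forall>\<^sub>F n in sequentially. mean n (\<lambda>x. trunc_norm R (rescale drift n x)) \<omega> -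
      mean (sample_time (sample_index n)) (\<lambda>x. trunc_norm R (rescale drift (sample_time (sample_index n)) x)) \<omega> < \<epsilon> / 2"
    using \<epsilon> by (intro order_tendstoD(2)) auto
  with eventually_compose_filterlim[OF R(2) filterlim_sample_index]
  have "\<forall>\<^sub>F n in sequentially. mean n (\<lambda>x. trunc_norm R (rescale drift n x)) \<omega> < \<epsilon>"
    by eventually_elim simp
  with R(1) show "\<exists>R>0. \<forall>\<^sub>F n in sequentially. mean n (\<lambda>x. trunc_norm R (rescale drift n x)) \<omega> < \<epsilon>"
    by blast
qed

lemma mean_wave_tendsto:
  assumes z: "norm z \<le> 1"
  shows "AE \<omega> in M. (\<lambda>n. mean n (\<lambda>x. wave z s (rescale drift n x)) \<omega>)
    \<longlonglongrightarrow> Re (z * exp (- (\<integral>y. (s \<bullet> y)\<^sup>2 \<partial>\<nu>) / 2))"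
  using tight_sample_time mean_wave_sample_time[OF z, of s]
proof eventually_elim
  case (elim \<omega>)
  show ?case
    by (rule mean_tendsto_from_sample_times[OF elim(1) bounded_borel_wave _ wave_lipschitz elim(2)])
      (use wave_abs_le z order_trans in blast)
qed

end

section \<open>The two urns\<close>

text \<open>A monotone class argument. For nonnegative functions, the parts of a bounded sum and the
  members of an increasing sequence with bounded limit lie between 0 and a bounded function, so
  boundedness is inherited downwards; a general f is reached as (f + B) - B.\<close>

lemma bounded_borel_induct [consumes 1, case_names indicator cmult add limit]:
  fixes f :: "'a::topological_space \<Rightarrow> real"
  assumes f: "bounded_borel f"
    and ind: "\<And>A. A \<in> sets borel \<Longrightarrow> P (indicator A)"
    and cmult: "\<And>c u. bounded_borel u \<Longrightarrow> P u \<Longrightarrow> P (\<lambda>x. c * u x)"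
    and add: "\<And>u v. bounded_borel u \<Longrightarrow> bounded_borel v \<Longrightarrow> P u \<Longrightarrow> P v \<Longrightarrow> P (\<lambda>x. u x + v x)"
    and lim: "\<And>U B u. (\<And>i. bounded_borel (U i)) \<Longrightarrow> (\<And>i x. \<bar>U i x\<bar> \<le> B) \<Longrightarrow> (\<And>i. P (U i)) \<Longrightarrow>
      bounded_borel u \<Longrightarrow> (\<And>x. (\<lambda>i. U i x) \<longlonglongrightarrow> u x) \<Longrightarrow> P u"
  shows "P f"
proof -
  have nonneg: "bounded_borel u \<longrightarrow> P u" if "u \<in> borel_measurable borel" "\<And>x. 0 \<le> u x" for u
    using that
  proof (induction rule: borel_measurable_induct_real)
    case (set A)
    then show ?case using ind by simp
  next
    case (mult u c)
    show ?case
    proof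
      assume "bounded_borel (\<lambda>x. c * u x)"
      show "P (\<lambda>x. c * u x)"
      \<comment> \<open>For c = 0 the product says nothing about the boundedness of u; the zero
        function is then obtained as the indicator of the empty set.\<close>
      proof (cases "c = 0")
        case True
        moreover have "indicator {} = (\<lambda>x :: 'a. 0 :: real)" by (simp add: fun_eq_iff)
        ultimately show ?thesis using ind[of "{}"] by simp
      next
        case False
        have "(\<lambda>x. inverse c * (c * u x)) = u" using False by (simp add: fun_eq_iff)
        then have "bounded_borel u"
          using bounded_borel_cmult[OF \<open>bounded_borel (\<lambda>x. c * u x)\<close>, of "inverse c"] by simp
        then show ?thesis using cmult mult by blast
      qed
    qed
  next
    case (add u v)
    show ?case
    proof
      assume "bounded_borel (\<lambda>x. v x + u x)"
      then obtain B where B: "\<And>x. \<bar>v x + u x\<bar> \<le> B" by (auto simp: bounded_borel_def)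
      have le: "\<bar>u x\<bar> \<le> B" "\<bar>v x\<bar> \<le> B" for x
        using B[of x] add.hyps(2)[of x] add.hyps(4)[of x] by auto
      have "bounded_borel u" "bounded_borel v"
        by (rule bounded_borelI[OF add.hyps(1) le(1)]) (rule bounded_borelI[OF add.hyps(3) le(2)])
      then show "P (\<lambda>x. v x + u x)" using add.IH assms(4) by blast
    qed
  next
    case (seq U)
    show ?case
    proof
      assume u: "bounded_borel u"
      then obtain B where B: "\<And>x. \<bar>u x\<bar> \<le> B" by (auto simp: bounded_borel_def)
      have le: "U i x \<le> u x" for i x
        using seq by (intro incseq_le) (auto simp: incseq_def le_fun_def)
      have U: "\<bar>U i x\<bar> \<le> B" for i x
        using le[of i x] seq(2)[of i x] B[of x] by linarith
      have bU: "bounded_borel (U i)" for i by (rule bounded_borelI[OF seq(1) U])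
      have "P (U i)" for i using seq.IH[of i] bU by blast
      then show "P u" by (rule lim[OF bU U _ u]) (use seq.hyps in auto)
    qed
  qed
  obtain B where B: "\<And>x. \<bar>f x\<bar> \<le> B" using f by (auto simp: bounded_borel_def)
  have "0 \<le> f x + B" for x using B[of x] by linarith
  then have "P (\<lambda>x. f x + B)"
    using bounded_borel_add[OF f bounded_borel_const] nonneg[of "\<lambda>x. f x + B"]
    by (auto dest: bounded_borel_measurable)
  moreover have "P (\<lambda>x. - B)"
  proof -
    have "bounded_borel (indicator UNIV :: 'a \<Rightarrow> real)" by (rule bounded_borelI[of _ 1]) auto
    then have "P (\<lambda>x. - B * indicator UNIV x)" by (rule cmult) (rule ind, simp)
    then show ?thesis by simp
  qed
  ultimately have "P (\<lambda>x. (f x + B) + - B)"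
    by (rule add[OF bounded_borel_add[OF f bounded_borel_const] bounded_borel_const])
  then show ?thesis by simp
qed

lemma bounded_borel_integral_limit:
  assumes N: "finite_measure N" "sets N = sets borel"
    and U: "\<And>i. bounded_borel (U i)" "\<And>i x. \<bar>U i x\<bar> \<le> B" "\<And>x. (\<lambda>i. U i x) \<longlonglongrightarrow> u x"
    and u: "bounded_borel u"
  shows "(\<lambda>i. \<integral>x. U i x \<partial>N) \<longlonglongrightarrow> (\<integral>x. u x \<partial>N)"
proof (rule integral_dominated_convergence[where w = "\<lambda>_. B"])
  show "integrable N (\<lambda>_. B)" using N(1) by (simp add: finite_measure.integrable_const)
  show "u \<in> borel_measurable N" "U i \<in> borel_measurable N" for i
    using bounded_borel_integrable[OF u N] bounded_borel_integrable[OF U(1) N] by auto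
qed (use U in auto)

lemma bounded_borel_indicator: "A \<in> sets borel \<Longrightarrow> bounded_borel (indicator A)"
  by (rule bounded_borelI[of _ 1]) (auto simp: indicator_def)

lemma measure_add_measure:
  assumes "finite_measure \<mu>" "finite_measure \<nu>" "sets \<nu> = sets \<mu>"
  shows "measure (add_measure \<mu> \<nu>) A = measure \<mu> A + measure \<nu> A"
proof -
  interpret \<mu>: finite_measure \<mu> by fact
  interpret \<nu>: finite_measure \<nu> by fact
  show ?thesis unfolding measure_def
    by (simp add: emeasure_add_measure[OF assms(3)] enn2real_plus less_top[symmetric])
qed

lemma finite_measure_add_measure:
  assumes "finite_measure \<mu>" "finite_measure \<nu>" "sets \<nu> = sets \<mu>"
  shows "finite_measure (add_measure \<mu> \<nu>)"
proof -
  interpret \<mu>: finite_measure \<mu> by fact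
  interpret \<nu>: finite_measure \<nu> by fact
  show ?thesis
    by (rule finite_measureI) (simp add: emeasure_add_measure[OF assms(3)])
qed

lemma integral_add_measure:
  fixes \<mu> \<nu> :: "'a::topological_space measure"
  assumes \<mu>: "finite_measure \<mu>" "sets \<mu> = sets borel" and \<nu>: "finite_measure \<nu>" "sets \<nu> = sets borel"
    and f: "bounded_borel f"
  shows "(\<integral>x. f x \<partial>add_measure \<mu> \<nu>) = (\<integral>x. f x \<partial>\<mu>) + (\<integral>x. f x \<partial>\<nu>)"
proof -
  have ss: "sets \<nu> = sets \<mu>" using \<mu>(2) \<nu>(2) by simp
  note s = finite_measure_add_measure[OF \<mu>(1) \<nu>(1) ss]
  have sets: "sets (add_measure \<mu> \<nu>) = sets borel" using \<mu>(2) by simp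
  show ?thesis using f
  proof (induction rule: bounded_borel_induct)
    case (indicator A)
    have "A \<inter> space N = A" if "sets N = sets borel" for N :: "'a measure"
      using sets_eq_imp_space_eq[OF that] by simp
    then show ?case using measure_add_measure[OF \<mu>(1) \<nu>(1) ss, of A] sets \<mu>(2) \<nu>(2) by simp
  next
    case (cmult c u)
    then show ?case by (simp add: distrib_left)
  next
    case (add u v)
    then show ?case
      using bounded_borel_integrable[OF _ s sets] bounded_borel_integrable[OF _ \<mu>] bounded_borel_integrable[OF _ \<nu>]
      by simp
  next
    case (limit U B u)
    have "(\<lambda>i. \<integral>x. U i x \<partial>add_measure \<mu> \<nu>) \<longlonglongrightarrow> (\<integral>x. u x \<partial>\<mu>) + (\<integral>x. u x \<partial>\<nu>)"
      unfolding limit.IH using limit by (intro tendsto_add bounded_borel_integral_limit \<mu> \<nu>) auto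
    moreover have "(\<lambda>i. \<integral>x. U i x \<partial>add_measure \<mu> \<nu>) \<longlonglongrightarrow> (\<integral>x. u x \<partial>add_measure \<mu> \<nu>)"
      using limit by (intro bounded_borel_integral_limit s sets) auto
    ultimately show ?case by (rule LIMSEQ_unique[rotated])
  qed
qed

lemma integral_normalize_measure:
  fixes \<mu> :: "'a::topological_space measure" and f :: "'a \<Rightarrow> real"
  assumes \<mu>: "finite_measure \<mu>" "sets \<mu> = sets borel" "measure \<mu> UNIV > 0" and f: "bounded_borel f"
  shows "(\<integral>x. f x \<partial>normalize_measure \<mu>) = (\<integral>x. f x \<partial>\<mu>) / measure \<mu> UNIV"
proof -
  interpret finite_measure \<mu> by fact
  have sp: "space \<mu> = UNIV" using sets_eq_imp_space_eq[OF \<mu>(2)] by simp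
  have inv: "inverse (emeasure \<mu> (space \<mu>)) = ennreal (1 / measure \<mu> UNIV)"
    using \<mu>(3) by (simp add: emeasure_eq_measure sp inverse_ennreal inverse_eq_divide)
  have "normalize_measure \<mu> = density \<mu> (\<lambda>_. ennreal (1 / measure \<mu> UNIV))"
    unfolding normalize_measure_def inv
    by (rule measure_eqI) (simp_all add: emeasure_density nn_integral_cmult)
  then show ?thesis
    using bounded_borel_integrable[OF f \<mu>(1,2)] \<mu>(3) by (simp add: integral_density)
qed

lemma sets_normalize_measure: "sets (normalize_measure \<mu>) = sets \<mu>"
  by (simp add: normalize_measure_def)

text \<open>The bridge from compositions to \<open>urn_mean\<close>. Everything happens at a fixed
  \<omega>, so \<open>\<mu>\<close> is here a sequence of ordinary measures.\<close>

lemma urn_composition: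
  fixes \<mu> :: "nat \<Rightarrow> 'a::topological_space measure" and \<rho> :: "nat \<Rightarrow> 'w \<Rightarrow> 'a measure"
  assumes \<mu>\<^sub>0: "finite_measure (\<mu> 0)" "sets (\<mu> 0) = sets borel" "measure (\<mu> 0) UNIV > 0"
    and \<rho>: "\<And>n. prob_space (\<rho> n \<omega>)" "\<And>n. sets (\<rho> n \<omega>) = sets borel"
    and Suc: "\<And>n. \<mu> (Suc n) = add_measure (\<mu> n) (\<rho> n \<omega>)"
  shows "prob_space (normalize_measure (\<mu> n))" and "sets (normalize_measure (\<mu> n)) = sets borel"
    and "bounded_borel f \<Longrightarrow> (\<integral>x. f x \<partial>normalize_measure (\<mu> n)) = urn_mean (\<mu> 0) \<rho> n f \<omega>"
proof -
  have fin: "finite_measure (\<rho> n \<omega>)" and m1: "measure (\<rho> n \<omega>) UNIV = 1" for n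
    using \<rho>(1)[of n] prob_space.prob_space[OF \<rho>(1), of n] sets_eq_imp_space_eq[OF \<rho>(2), of n]
    by (auto simp: prob_space_def)
  have *: "finite_measure (\<mu> n) \<and> sets (\<mu> n) = sets borel \<and> measure (\<mu> n) UNIV = measure (\<mu> 0) UNIV + real n \<and>
      (\<forall>f. bounded_borel f \<longrightarrow> (\<integral>x. f x \<partial>\<mu> n) = (\<integral>x. f x \<partial>\<mu> 0) + (\<Sum>k<n. \<integral>x. f x \<partial>\<rho> k \<omega>))"
  proof (induction n)
    case 0
    then show ?case using \<mu>\<^sub>0 by simp
  next
    case (Suc n)
    then have IH: "finite_measure (\<mu> n)" "sets (\<mu> n) = sets borel" and ss: "sets (\<rho> n \<omega>) = sets (\<mu> n)"
      using \<rho>(2) by simp_all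
    show ?case unfolding assms(6)
      using Suc finite_measure_add_measure[OF IH(1) fin ss] measure_add_measure[OF IH(1) fin ss]
        integral_add_measure[OF IH fin \<rho>(2)] m1 by simp
  qed
  then have sp: "space (\<mu> n) = UNIV" using sets_eq_imp_space_eq[of "\<mu> n" borel] by simp
  interpret finite_measure "\<mu> n" using * by simp
  have pos: "measure (\<mu> n) UNIV > 0" using * \<mu>\<^sub>0(3) by simp
  then have "emeasure (\<mu> n) (space (\<mu> n)) \<noteq> 0" by (simp add: emeasure_eq_measure sp)
  then show "prob_space (normalize_measure (\<mu> n))" by (intro prob_space_normalize_measure finite_measure_axioms)
  show "sets (normalize_measure (\<mu> n)) = sets borel" using * by (simp add: sets_normalize_measure)
  show "(\<integral>x. f x \<partial>normalize_measure (\<mu> n)) = urn_mean (\<mu> 0) \<rho> n f \<omega>" if "bounded_borel f"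
    using * that integral_normalize_measure[of "\<mu> n" f] pos by (simp add: urn_mean_def)
qed

section \<open>Conditional laws and independence\<close>

lemma measurable_sigma_rv:
  assumes "Y \<in> Ys"
  shows "Y \<in> borel_measurable (sigma_rv M Ys)"
proof -
  have sub: "{Y -` B \<inter> space M | Y B. Y \<in> Ys \<and> B \<in> sets borel} \<subseteq> Pow (space M)" by auto
  show ?thesis
  proof (rule measurableI)
    fix B assume "B \<in> sets (borel :: 'b measure)"
    then show "Y -` B \<inter> space (sigma_rv M Ys) \<in> sets (sigma_rv M Ys)"
      unfolding sigma_rv_def using assms sub by (auto simp: space_measure_of sets_measure_of)
  qed simp
qed

lemma sets_sigma_rv_mono: "Ys \<subseteq> Zs \<Longrightarrow> sets (sigma_rv M Ys) \<subseteq> sets (sigma_rv M Zs)"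
proof -
  have sub: "{Y -` B \<inter> space M | Y B. Y \<in> Ys \<and> B \<in> sets borel} \<subseteq> Pow (space M)" for Ys by auto
  show "Ys \<subseteq> Zs \<Longrightarrow> ?thesis"
    unfolding sigma_rv_def sets_measure_of[OF sub] by (intro sigma_sets_mono') auto
qed

text \<open>The conditional law is given on indicators, each with its own null set. Under the
  expectation against Z these null sets do not matter, and the monotone class argument extends the
  identity to bounded f without a common null set.\<close>

lemma (in prob_space) has_cond_law_integral:
  fixes X :: "'a \<Rightarrow> 'b::topological_space"
  assumes law: "has_cond_law M F X \<kappa>" and sub: "subalgebra M F" and X: "X \<in> borel_measurable M"
    and \<kappa>: "\<And>\<omega>. \<omega> \<in> space M \<Longrightarrow> prob_space (\<kappa> \<omega>)" "\<And>\<omega>. \<omega> \<in> space M \<Longrightarrow> sets (\<kappa> \<omega>) = sets borel"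
    and meas: "\<And>f. bounded_borel f \<Longrightarrow> (\<lambda>\<omega>. \<integral>x. f x \<partial>\<kappa> \<omega>) \<in> borel_measurable M"
    and Z: "Z \<in> borel_measurable F" "\<And>\<omega>. \<bar>Z \<omega>\<bar> \<le> C" and f: "bounded_borel f"
  shows "expectation (\<lambda>\<omega>. Z \<omega> * f (X \<omega>)) = expectation (\<lambda>\<omega>. Z \<omega> * (\<integral>x. f x \<partial>\<kappa> \<omega>))"
proof -
  interpret finite_measure_subalgebra M F by unfold_locales (rule sub)
  have ZM: "Z \<in> borel_measurable M" by (rule measurable_from_subalg[OF sub Z(1)])
  have fX: "(\<lambda>\<omega>. f (X \<omega>)) \<in> borel_measurable M" if "bounded_borel f" for f :: "'b \<Rightarrow> real"
    using measurable_compose[OF X bounded_borel_measurable[OF that]] .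
  have fin: "finite_measure (\<kappa> \<omega>)" if "\<omega> \<in> space M" for \<omega>
    using \<kappa>(1)[OF that] by (rule prob_space.finite_measure)
  have le: "\<bar>\<integral>x. f x \<partial>\<kappa> \<omega>\<bar> \<le> B" if "\<omega> \<in> space M" "bounded_borel f" "\<And>x. \<bar>f x\<bar> \<le> B" for f B \<omega>
    by (rule bounded_borel_integral_abs_le[OF that(2,3) \<kappa>[OF that(1)]])
  have bd: "\<bar>Z \<omega> * y\<bar> \<le> C * B" if "\<bar>y\<bar> \<le> B" for \<omega> y B
    unfolding abs_mult using Z(2)[of \<omega>] that by (intro mult_mono) auto
  have int: "integrable M (\<lambda>\<omega>. Z \<omega> * f (X \<omega>))" "integrable M (\<lambda>\<omega>. Z \<omega> * (\<integral>x. f x \<partial>\<kappa> \<omega>))"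
    if f: "bounded_borel f" for f
  proof -
    obtain B where B: "\<And>x. \<bar>f x\<bar> \<le> B" using f by (auto simp: bounded_borel_def)
    show "integrable M (\<lambda>\<omega>. Z \<omega> * f (X \<omega>))"
      using bd[OF B] ZM fX[OF f] by (intro integrable_const_bound[where B = "C * B"]) auto
    show "integrable M (\<lambda>\<omega>. Z \<omega> * (\<integral>x. f x \<partial>\<kappa> \<omega>))"
      using bd[OF le[OF _ f B]] ZM meas[OF f] by (intro integrable_const_bound[where B = "C * B"]) auto
  qed
  show ?thesis using f
  proof (induction rule: bounded_borel_induct)
    case (indicator A)
    note i = int(1)[OF bounded_borel_indicator[OF indicator]]
    have "(\<lambda>\<omega>. indicator A (X \<omega>) :: real) \<in> borel_measurable M"
      by (rule fX[OF bounded_borel_indicator[OF indicator]])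
    from real_cond_exp_intg(2)[OF i Z(1) this]
    have "expectation (\<lambda>\<omega>. Z \<omega> * indicator A (X \<omega>)) =
        expectation (\<lambda>\<omega>. Z \<omega> * real_cond_exp M F (\<lambda>\<omega>. indicator A (X \<omega>)) \<omega>)" by simp
    also have "\<dots> = expectation (\<lambda>\<omega>. Z \<omega> * (\<integral>x. indicator A x \<partial>\<kappa> \<omega>))"
    proof (rule integral_cong_AE)
      show "(\<lambda>\<omega>. Z \<omega> * real_cond_exp M F (\<lambda>\<omega>. indicator A (X \<omega>)) \<omega>) \<in> borel_measurable M"
        using ZM by measurable
      show "(\<lambda>\<omega>. Z \<omega> * (\<integral>x. indicator A x \<partial>\<kappa> \<omega>)) \<in> borel_measurable M"
        using ZM meas[OF bounded_borel_indicator[OF indicator]] by measurable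
      have eq: "(\<integral>x. indicator A x \<partial>\<kappa> \<omega>) = measure (\<kappa> \<omega>) A" if "\<omega> \<in> space M" for \<omega>
        using sets_eq_imp_space_eq[OF \<kappa>(2)[OF that]] by simp
      have "AE \<omega> in M. real_cond_exp M F (\<lambda>\<omega>'. indicator A (X \<omega>')) \<omega> = measure (\<kappa> \<omega>) A"
        using law indicator unfolding has_cond_law_def by blast
      then show "AE \<omega> in M. Z \<omega> * real_cond_exp M F (\<lambda>\<omega>. indicator A (X \<omega>)) \<omega> = Z \<omega> * (\<integral>x. indicator A x \<partial>\<kappa> \<omega>)"
        using AE_space by eventually_elim (simp only: eq)
    qed
    finally show ?case .
  next
    case (cmult c u)
    then show ?case by (simp add: mult.left_commute)
  next
    case (add u v)
    have "expectation (\<lambda>\<omega>. Z \<omega> * (\<integral>x. u x + v x \<partial>\<kappa> \<omega>)) =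
        expectation (\<lambda>\<omega>. Z \<omega> * (\<integral>x. u x \<partial>\<kappa> \<omega>) + Z \<omega> * (\<integral>x. v x \<partial>\<kappa> \<omega>))"
      using bounded_borel_integrable[OF add(1) fin \<kappa>(2)] bounded_borel_integrable[OF add(2) fin \<kappa>(2)]
      by (intro Bochner_Integration.integral_cong) (auto simp: distrib_left)
    then show ?case using add int by (simp add: distrib_left)
  next
    case (limit U B u)
    have "(\<lambda>i. expectation (\<lambda>\<omega>. Z \<omega> * U i (X \<omega>))) \<longlonglongrightarrow> expectation (\<lambda>\<omega>. Z \<omega> * u (X \<omega>))"
    proof (rule integral_dominated_convergence[where w = "\<lambda>_. C * B"])
      show "(\<lambda>\<omega>. Z \<omega> * u (X \<omega>)) \<in> borel_measurable M" "(\<lambda>\<omega>. Z \<omega> * U i (X \<omega>)) \<in> borel_measurable M" for i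
        using ZM fX[OF limit.hyps(1)] fX[OF limit.hyps(3)] by auto
      show "AE \<omega> in M. (\<lambda>i. Z \<omega> * U i (X \<omega>)) \<longlonglongrightarrow> Z \<omega> * u (X \<omega>)"
        using limit.hyps(4) by (intro AE_I2 tendsto_mult_left)
      show "AE \<omega> in M. norm (Z \<omega> * U i (X \<omega>)) \<le> C * B" for i
        using bd[OF limit.hyps(2)] by auto
    qed simp
    moreover have "(\<lambda>i. expectation (\<lambda>\<omega>. Z \<omega> * (\<integral>x. U i x \<partial>\<kappa> \<omega>))) \<longlonglongrightarrow> expectation (\<lambda>\<omega>. Z \<omega> * (\<integral>x. u x \<partial>\<kappa> \<omega>))"
    proof (rule integral_dominated_convergence[where w = "\<lambda>_. C * B"])
      show "(\<lambda>\<omega>. Z \<omega> * (\<integral>x. u x \<partial>\<kappa> \<omega>)) \<in> borel_measurable M"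
        "(\<lambda>\<omega>. Z \<omega> * (\<integral>x. U i x \<partial>\<kappa> \<omega>)) \<in> borel_measurable M" for i
        using ZM meas[OF limit.hyps(1)] meas[OF limit.hyps(3)] by auto
      show "AE \<omega> in M. (\<lambda>i. Z \<omega> * (\<integral>x. U i x \<partial>\<kappa> \<omega>)) \<longlonglongrightarrow> Z \<omega> * (\<integral>x. u x \<partial>\<kappa> \<omega>)"
        using limit fin \<kappa>(2) by (intro AE_I2 tendsto_mult_left bounded_borel_integral_limit) auto
      show "AE \<omega> in M. norm (Z \<omega> * (\<integral>x. U i x \<partial>\<kappa> \<omega>)) \<le> C * B" for i
        using bd[OF le[OF _ limit.hyps(1) limit.hyps(2)]] by auto
    qed simp
    ultimately show ?case unfolding limit.IH by (rule LIMSEQ_unique)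
  qed
qed

lemma (in prob_space) cond_mean_draw:
  fixes X :: "'a \<Rightarrow> 'b::topological_space"
  assumes law: "has_cond_law M F X (\<lambda>\<omega>. normalize_measure (\<mu> n \<omega>))" and sub: "subalgebra M F" and X: "X \<in> borel_measurable M"
    and \<mu>\<^sub>0: "finite_measure \<mu>\<^sub>0" "sets \<mu>\<^sub>0 = sets borel" "measure \<mu>\<^sub>0 UNIV > 0"
    and \<rho>: "\<And>k \<omega>. prob_space (\<rho> k \<omega>)" "\<And>k \<omega>. sets (\<rho> k \<omega>) = sets borel"
    and zero: "\<And>\<omega>. \<omega> \<in> space M \<Longrightarrow> \<mu> 0 \<omega> = \<mu>\<^sub>0"
    and Suc: "\<And>k \<omega>. \<omega> \<in> space M \<Longrightarrow> \<mu> (Suc k) \<omega> = add_measure (\<mu> k \<omega>) (\<rho> k \<omega>)"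
    and meas: "\<And>k f. k < n \<Longrightarrow> bounded_borel f \<Longrightarrow> (\<lambda>\<omega>. \<integral>x. f x \<partial>\<rho> k \<omega>) \<in> borel_measurable M"
    and Z: "Z \<in> borel_measurable F" "\<And>\<omega>. \<bar>Z \<omega>\<bar> \<le> C" and f: "bounded_borel f"
  shows "expectation (\<lambda>\<omega>. Z \<omega> * f (X \<omega>)) = expectation (\<lambda>\<omega>. Z \<omega> * urn_mean \<mu>\<^sub>0 \<rho> n f \<omega>)"
proof -
  have c: "prob_space (normalize_measure (\<mu> n \<omega>))" "sets (normalize_measure (\<mu> n \<omega>)) = sets borel"
    "\<And>f. bounded_borel f \<Longrightarrow> (\<integral>x. f x \<partial>normalize_measure (\<mu> n \<omega>)) = urn_mean \<mu>\<^sub>0 \<rho> n f \<omega>"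
    if "\<omega> \<in> space M" for \<omega>
    using urn_composition[where \<mu> = "\<lambda>k. \<mu> k \<omega>" and \<rho> = \<rho> and \<omega> = \<omega>, OF _ _ _ \<rho> Suc[OF that]] \<mu>\<^sub>0
    unfolding zero[OF that] by blast+
  have "expectation (\<lambda>\<omega>. Z \<omega> * f (X \<omega>)) = expectation (\<lambda>\<omega>. Z \<omega> * (\<integral>x. f x \<partial>normalize_measure (\<mu> n \<omega>)))"
  proof (rule has_cond_law_integral[OF law sub X _ _ _ Z f])
    show "(\<lambda>\<omega>. \<integral>x. g x \<partial>normalize_measure (\<mu> n \<omega>)) \<in> borel_measurable M" if g: "bounded_borel g" for g
      using urn_mean_measurable[where n = n and \<mu>\<^sub>0 = \<mu>\<^sub>0 and \<rho> = \<rho>, OF meas[OF _ g]] c(3)[OF _ g] by (simp cong: measurable_cong)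
  qed (use c in auto)
  also have "\<dots> = expectation (\<lambda>\<omega>. Z \<omega> * urn_mean \<mu>\<^sub>0 \<rho> n f \<omega>)"
    using c(3)[OF _ f] by (intro Bochner_Integration.integral_cong) auto
  finally show ?thesis .
qed

text \<open>Fubini for the product of the law of e and the joint law of Z and X: integrating over e
  first produces \<open>shift_mean\<close>.\<close>

lemma (in prob_space) expectation_add_independent:
  fixes X e :: "'a \<Rightarrow> 'b::euclidean_space"
  assumes ind: "indep_set (sets (sigma_rv M {e})) (sets G)" and G: "subalgebra M G"
    and e: "e \<in> borel_measurable M" "distr M borel e = \<nu>"
    and X: "X \<in> borel_measurable G" and Z: "Z \<in> borel_measurable G" "\<And>\<omega>. \<bar>Z \<omega>\<bar> \<le> C" and f: "bounded_borel f"
  shows "expectation (\<lambda>\<omega>. Z \<omega> * f (X \<omega> + e \<omega>)) = expectation (\<lambda>\<omega>. Z \<omega> * shift_mean \<nu> f (X \<omega>))"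
proof -
  text \<open>\<open>indep_var\<close> needs both variables to have the same type, hence the dummy component of \<open>E\<close>.\<close>
  define E :: "'a \<Rightarrow> real \<times> 'b" where "E \<omega> = (0, e \<omega>)" for \<omega>
  define Y where "Y \<omega> = (Z \<omega>, X \<omega>)" for \<omega>
  let ?B = "borel \<Otimes>\<^sub>M borel :: (real \<times> 'b) measure"
  note [measurable] = e(1) bounded_borel_measurable[OF f]
  have [measurable]: "X \<in> borel_measurable M" "Z \<in> borel_measurable M"
    using measurable_from_subalg[OF G] X Z by auto
  have [measurable]: "E \<in> M \<rightarrow>\<^sub>M ?B" "Y \<in> M \<rightarrow>\<^sub>M ?B" unfolding E_def Y_def by measurable
  have YG: "Y \<in> G \<rightarrow>\<^sub>M ?B" unfolding Y_def using X Z(1) by measurable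
  have EE: "E \<in> sigma_rv M {e} \<rightarrow>\<^sub>M ?B"
    unfolding E_def using measurable_sigma_rv[of e "{e}" M] by measurable
  have spG: "space G = space M" and spE: "space (sigma_rv M {e}) = space M"
    using G subalgebra_sigma_rv[of "{e}" M] by (auto simp: subalgebra_def)
  have "indep_var ?B E ?B Y"
    unfolding indep_var_eq
  proof (intro conjI)
    have 1: "sigma_sets (space M) {E -` A \<inter> space M |A. A \<in> sets ?B} \<subseteq> sets (sigma_rv M {e})"
      unfolding spE[symmetric] using EE by (intro sets.sigma_sets_subset) (auto intro: measurable_sets)
    have 2: "sigma_sets (space M) {Y -` A \<inter> space M |A. A \<in> sets ?B} \<subseteq> sets G"
      unfolding spG[symmetric] using YG by (intro sets.sigma_sets_subset) (auto intro: measurable_sets)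
    show "indep_set (sigma_sets (space M) {E -` A \<inter> space M |A. A \<in> sets ?B})
        (sigma_sets (space M) {Y -` A \<inter> space M |A. A \<in> sets ?B})"
      using ind 1 2 unfolding indep_sets2_eq by blast
  qed measurable
  then have joint: "distr M ?B E \<Otimes>\<^sub>M distr M ?B Y = distr M (?B \<Otimes>\<^sub>M ?B) (\<lambda>\<omega>. (E \<omega>, Y \<omega>))"
    unfolding indep_var_distribution_eq by blast
  interpret E: prob_space "distr M ?B E" by (rule prob_space_distr) measurable
  interpret Y: prob_space "distr M ?B Y" by (rule prob_space_distr) measurable
  interpret pair_sigma_finite "distr M ?B E" "distr M ?B Y" ..
  define h :: "real \<times> 'b \<Rightarrow> real \<times> 'b \<Rightarrow> real" where "h y p = fst p * f (snd p + snd y)" for y p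
  have hm [measurable]: "case_prod h \<in> borel_measurable (?B \<Otimes>\<^sub>M ?B)"
    unfolding h_def by measurable
  have hEY: "case_prod h (E \<omega>, Y \<omega>) = Z \<omega> * f (X \<omega> + e \<omega>)" for \<omega> by (simp add: h_def E_def Y_def)
  obtain B where B: "\<And>x. \<bar>f x\<bar> \<le> B" using f by (auto simp: bounded_borel_def)
  have intM: "integrable M (\<lambda>\<omega>. Z \<omega> * f (X \<omega> + e \<omega>))"
  proof (rule integrable_const_bound[where B = "C * B"])
    show "AE \<omega> in M. norm (Z \<omega> * f (X \<omega> + e \<omega>)) \<le> C * B"
    proof (rule AE_I2)
      fix \<omega>
      have "\<bar>Z \<omega>\<bar> * \<bar>f (X \<omega> + e \<omega>)\<bar> \<le> C * B" using Z(2)[of \<omega>] B by (intro mult_mono) auto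
      then show "norm (Z \<omega> * f (X \<omega> + e \<omega>)) \<le> C * B" by (simp add: abs_mult)
    qed
  qed measurable
  have EY: "(\<lambda>\<omega>. (E \<omega>, Y \<omega>)) \<in> M \<rightarrow>\<^sub>M ?B \<Otimes>\<^sub>M ?B" by measurable
  have int: "integrable (distr M ?B E \<Otimes>\<^sub>M distr M ?B Y) (case_prod h)"
    unfolding joint integrable_distr_eq[OF EY hm] hEY by (rule intM)
  have "expectation (\<lambda>\<omega>. Z \<omega> * f (X \<omega> + e \<omega>)) = integral\<^sup>L (distr M ?B E \<Otimes>\<^sub>M distr M ?B Y) (case_prod h)"
    unfolding joint integral_distr[OF EY hm] hEY ..
  also have "\<dots> = (\<integral>p. (\<integral>y. h y p \<partial>distr M ?B E) \<partial>distr M ?B Y)"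
    by (rule integral_snd[OF int, symmetric])
  also have "(\<lambda>p. \<integral>y. h y p \<partial>distr M ?B E) = (\<lambda>p. fst p * shift_mean \<nu> f (snd p))"
  proof
    fix p :: "real \<times> 'b"
    have "(\<integral>y. h y p \<partial>distr M ?B E) = expectation (\<lambda>\<omega>. fst p * f (snd p + e \<omega>))"
      unfolding h_def by (subst integral_distr) (auto simp: E_def)
    also have "\<dots> = fst p * shift_mean \<nu> f (snd p)"
      unfolding shift_mean_def e(2)[symmetric] by (subst integral_distr) auto
    finally show "(\<integral>y. h y p \<partial>distr M ?B E) = fst p * shift_mean \<nu> f (snd p)" .
  qed
  also have "(\<integral>p. fst p * shift_mean \<nu> f (snd p) \<partial>distr M ?B Y) = expectation (\<lambda>\<omega>. Z \<omega> * shift_mean \<nu> f (X \<omega>))"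
  proof -
    have "prob_space \<nu>" "sets \<nu> = sets borel" using prob_space_distr[OF e(1)] e(2) by auto
    from bounded_borel_measurable[OF shift_mean_bounded_borel[OF this f]]
    have [measurable]: "shift_mean \<nu> f \<in> borel_measurable borel" .
    show ?thesis by (subst integral_distr) (auto simp: Y_def)
  qed
  finally show ?thesis .
qed

section \<open>The urns as urn processes\<close>

text \<open>Two successive conditionings: the offset is integrated out given the past and the draw,
  then the draw given the past alone.\<close>

lemma urn_process_sbarw:
  fixes X e :: "nat \<Rightarrow> 'w \<Rightarrow> 'a::euclidean_space"
  assumes M: "prob_space M" and \<mu>\<^sub>0: "finite_measure \<mu>\<^sub>0" "sets \<mu>\<^sub>0 = sets borel" "measure \<mu>\<^sub>0 UNIV > 0"
    and \<nu>: "prob_space \<nu>" "sets \<nu> = sets borel"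
    and Xe: "\<And>n. X n \<in> borel_measurable M" "\<And>n. e n \<in> borel_measurable M"
    and zero: "\<And>\<omega>. \<omega> \<in> space M \<Longrightarrow> \<mu> 0 \<omega> = \<mu>\<^sub>0"
    and law: "\<And>n. has_cond_law M (sigma_rv M (X ` {..<n} \<union> e ` {..<n})) (X n) (\<lambda>\<omega>. normalize_measure (\<mu> n \<omega>))"
    and offset: "\<And>n. distr M borel (e n) = \<nu>"
    and ind: "\<And>n. prob_space.indep_set M (sets (sigma_rv M {e n})) (sets (sigma_rv M (X ` {..n} \<union> e ` {..<n})))"
    and Suc: "\<And>n \<omega>. \<omega> \<in> space M \<Longrightarrow> \<mu> (Suc n) \<omega> = add_measure (\<mu> n \<omega>) (return borel (X n \<omega> + e n \<omega>))"
  shows "urn_process M (\<lambda>n. sigma_rv M (X ` {..<n} \<union> e ` {..<n})) \<mu>\<^sub>0 \<nu> (\<lambda>n \<omega>. return borel (X n \<omega> + e n \<omega>))"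
proof -
  interpret prob_space M by fact
  define F where "F n = sigma_rv M (X ` {..<n} \<union> e ` {..<n})" for n
  define \<rho> where "\<rho> n \<omega> = return borel (X n \<omega> + e n \<omega>)" for n \<omega>
  have sub: "subalgebra M (F n)" for n
    unfolding F_def by (rule subalgebra_sigma_rv) (use Xe in auto)
  have \<rho>: "prob_space (\<rho> n \<omega>)" "sets (\<rho> n \<omega>) = sets borel" for n \<omega>
    by (simp_all add: \<rho>_def prob_space_return)
  have \<rho>_int: "(\<integral>x. f x \<partial>\<rho> n \<omega>) = f (X n \<omega> + e n \<omega>)" if "bounded_borel f" for f n \<omega>
    unfolding \<rho>_def using bounded_borel_measurable[OF that] by (intro integral_return) auto
  have adapted: "(\<lambda>\<omega>. \<integral>x. f x \<partial>\<rho> n \<omega>) \<in> borel_measurable (F (Suc n))" if f: "bounded_borel f" for f n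
  proof -
    have [measurable]: "X n \<in> borel_measurable (F (Suc n))" "e n \<in> borel_measurable (F (Suc n))"
      unfolding F_def by (auto intro!: measurable_sigma_rv)
    note [measurable] = bounded_borel_measurable[OF f]
    show ?thesis unfolding \<rho>_int[OF f] by measurable
  qed
  have "urn_process M F \<mu>\<^sub>0 \<nu> \<rho>"
  proof (intro urn_process.intro urn_process_axioms.intro)
    show "subalgebra M (F n)" for n by (rule sub)
    show "sets (F n) \<subseteq> sets (F (Suc n))" for n
      unfolding F_def by (rule sets_sigma_rv_mono) auto
    show "(\<lambda>\<omega>. \<integral>x. f x \<partial>\<rho> n \<omega>) \<in> borel_measurable (F (Suc n))" if "bounded_borel f" for f n
      by (rule adapted[OF that])
    show "(\<integral>\<omega>. Z \<omega> * (\<integral>x. f x \<partial>\<rho> n \<omega>) \<partial>M) = (\<integral>\<omega>. Z \<omega> * urn_mean \<mu>\<^sub>0 \<rho> n (shift_mean \<nu> f) \<omega> \<partial>M)"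
      if f: "bounded_borel f" and Z: "Z \<in> borel_measurable (F n)" and ZB: "\<exists>B. \<forall>\<omega>. \<bar>Z \<omega>\<bar> \<le> B" for n f Z
    proof -
      obtain C where C: "\<And>\<omega>. \<bar>Z \<omega>\<bar> \<le> C" using ZB by blast
      \<comment> \<open>Unlike \<open>F n\<close>, this includes the draw at time n but not yet its
        offset.\<close>
      define G where "G = sigma_rv M (X ` {..n} \<union> e ` {..<n})"
      have G: "subalgebra M G" unfolding G_def by (rule subalgebra_sigma_rv) (use Xe in auto)
      have "sets (F n) \<subseteq> sets G" unfolding F_def G_def by (rule sets_sigma_rv_mono) auto
      then have "subalgebra G (F n)" using G sub by (simp add: subalgebra_def)
      then have ZG: "Z \<in> borel_measurable G" using Z by (rule measurable_from_subalg)
      have "(\<integral>\<omega>. Z \<omega> * (\<integral>x. f x \<partial>\<rho> n \<omega>) \<partial>M) = expectation (\<lambda>\<omega>. Z \<omega> * f (X n \<omega> + e n \<omega>))"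
        unfolding \<rho>_int[OF f] ..
      also have "\<dots> = expectation (\<lambda>\<omega>. Z \<omega> * shift_mean \<nu> f (X n \<omega>))"
        using ind[of n] unfolding G_def[symmetric]
        by (rule expectation_add_independent[OF _ G Xe(2) offset _ ZG C f])
          (auto simp: G_def intro!: measurable_sigma_rv)
      also have "\<dots> = expectation (\<lambda>\<omega>. Z \<omega> * urn_mean \<mu>\<^sub>0 \<rho> n (shift_mean \<nu> f) \<omega>)"
        by (rule cond_mean_draw[where \<mu> = \<mu> and F = "F n", OF _ sub Xe(1) \<mu>\<^sub>0 \<rho> zero _ _ Z C shift_mean_bounded_borel[OF \<nu> f]])
          (use law Suc measurable_from_subalg[OF sub adapted] in \<open>auto simp: F_def \<rho>_def[abs_def]\<close>)
      finally show ?thesis .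
    qed
  qed (fact M \<mu>\<^sub>0 \<nu> \<rho>)+
  then show ?thesis unfolding F_def \<rho>_def .
qed

text \<open>Integrating f against the increment already gives \<open>shift_mean\<close> at the draw,
  so a single conditioning on the past remains.\<close>

lemma urn_process_darw:
  fixes X :: "nat \<Rightarrow> 'w \<Rightarrow> 'a::euclidean_space"
  assumes M: "prob_space M" and \<mu>\<^sub>0: "finite_measure \<mu>\<^sub>0" "sets \<mu>\<^sub>0 = sets borel" "measure \<mu>\<^sub>0 UNIV > 0"
    and \<nu>: "prob_space \<nu>" "sets \<nu> = sets borel"
    and X: "\<And>n. X n \<in> borel_measurable M"
    and zero: "\<And>\<omega>. \<omega> \<in> space M \<Longrightarrow> \<mu> 0 \<omega> = \<mu>\<^sub>0"
    and law: "\<And>n. has_cond_law M (sigma_rv M (X ` {..<n})) (X n) (\<lambda>\<omega>. normalize_measure (\<mu> n \<omega>))"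
    and Suc: "\<And>n \<omega>. \<omega> \<in> space M \<Longrightarrow> \<mu> (Suc n) \<omega> = add_measure (\<mu> n \<omega>) (distr \<nu> borel (\<lambda>y. X n \<omega> + y))"
  shows "urn_process M (\<lambda>n. sigma_rv M (X ` {..<n})) \<mu>\<^sub>0 \<nu> (\<lambda>n \<omega>. distr \<nu> borel (\<lambda>y. X n \<omega> + y))"
proof -
  interpret prob_space M by fact
  define F where "F n = sigma_rv M (X ` {..<n})" for n
  define \<rho> where "\<rho> n \<omega> = distr \<nu> borel (\<lambda>y. X n \<omega> + y)" for n \<omega>
  have sub: "subalgebra M (F n)" for n
    unfolding F_def by (rule subalgebra_sigma_rv) (use X in auto)
  have tm: "(\<lambda>y. x + y) \<in> borel_measurable \<nu>" for x :: 'a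
    by (simp cong: measurable_cong_sets add: \<nu>(2))
  have \<rho>: "prob_space (\<rho> n \<omega>)" "sets (\<rho> n \<omega>) = sets borel" for n \<omega>
    using prob_space.prob_space_distr[OF \<nu>(1) tm] by (simp_all add: \<rho>_def)
  have \<rho>_int: "(\<integral>x. f x \<partial>\<rho> n \<omega>) = shift_mean \<nu> f (X n \<omega>)" if "bounded_borel f" for f n \<omega>
    unfolding \<rho>_def shift_mean_def using tm bounded_borel_measurable[OF that] by (rule integral_distr)
  have adapted: "(\<lambda>\<omega>. \<integral>x. f x \<partial>\<rho> n \<omega>) \<in> borel_measurable (F (Suc n))" if f: "bounded_borel f" for f n
  proof -
    have [measurable]: "X n \<in> borel_measurable (F (Suc n))"
      unfolding F_def by (auto intro!: measurable_sigma_rv)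
    note [measurable] = bounded_borel_measurable[OF shift_mean_bounded_borel[OF \<nu> f]]
    show ?thesis unfolding \<rho>_int[OF f] by measurable
  qed
  have "urn_process M F \<mu>\<^sub>0 \<nu> \<rho>"
  proof (intro urn_process.intro urn_process_axioms.intro)
    show "subalgebra M (F n)" for n by (rule sub)
    show "sets (F n) \<subseteq> sets (F (Suc n))" for n
      unfolding F_def by (rule sets_sigma_rv_mono) auto
    show "(\<lambda>\<omega>. \<integral>x. f x \<partial>\<rho> n \<omega>) \<in> borel_measurable (F (Suc n))" if "bounded_borel f" for f n
      by (rule adapted[OF that])
    show "(\<integral>\<omega>. Z \<omega> * (\<integral>x. f x \<partial>\<rho> n \<omega>) \<partial>M) = (\<integral>\<omega>. Z \<omega> * urn_mean \<mu>\<^sub>0 \<rho> n (shift_mean \<nu> f) \<omega> \<partial>M)"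
      if f: "bounded_borel f" and Z: "Z \<in> borel_measurable (F n)" and ZB: "\<exists>B. \<forall>\<omega>. \<bar>Z \<omega>\<bar> \<le> B" for n f Z
    proof -
      obtain C where C: "\<And>\<omega>. \<bar>Z \<omega>\<bar> \<le> C" using ZB by blast
      show ?thesis unfolding \<rho>_int[OF f]
        by (rule cond_mean_draw[where \<mu> = \<mu> and F = "F n", OF _ sub X \<mu>\<^sub>0 \<rho> zero _ _ Z C shift_mean_bounded_borel[OF \<nu> f]])
          (use law Suc measurable_from_subalg[OF sub adapted] in \<open>auto simp: F_def \<rho>_def[abs_def]\<close>)
    qed
  qed (fact M \<mu>\<^sub>0 \<nu> \<rho>)+
  then show ?thesis unfolding F_def \<rho>_def .
qed

section \<open>The Gaussian limit\<close>

lemma prob_space_linear_image_normal: "prob_space (linear_image_normal (A :: real^'d^'d))"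
proof -
  interpret N: prob_space std_normal_distribution by (rule prob_space_normal_density) simp
  interpret product_prob_space "\<lambda>_. std_normal_distribution" "UNIV :: 'd set" by unfold_locales
  have "(\<lambda>z. \<Sum>i\<in>UNIV. z i *\<^sub>R column i A) \<in> borel_measurable (Pi\<^sub>M (UNIV :: 'd set) (\<lambda>_. std_normal_distribution))"
    by measurable
  moreover have "A *v (\<chi> i. z i) = (\<Sum>i\<in>UNIV. z i *\<^sub>R column i A)" for z
    by (simp add: matrix_mult_sum scalar_mult_eq_scaleR)
  ultimately show ?thesis unfolding linear_image_normal_def by (intro prob_space_distr) simp
qed

lemma prob_space_centered_normal: "prob_space (centered_normal S)"
  unfolding centered_normal_def by (rule prob_space_linear_image_normal)

lemma sets_centered_normal: "sets (centered_normal S) = sets borel"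
  by (simp add: centered_normal_def linear_image_normal_def)

lemma Theta_map_rescale: "Theta_map (sqrt (ln (real n))) (ln (real n) *\<^sub>R m) N = distr N borel (rescale m n)"
  unfolding Theta_map_def rescale_def[abs_def] ..

text \<open>Countable, so that the limits hold almost surely for all these frequencies at once.\<close>

definition rational_frequencies :: "(real^'d) set" where
  "rational_frequencies = range (\<lambda>q :: 'd \<Rightarrow> rat. \<chi> i. pi * of_rat (q i))"

lemma countable_rational_frequencies: "countable (rational_frequencies :: (real^'d) set)"
  unfolding rational_frequencies_def by (rule countable_image) simp

lemma rational_frequencies_iff: "s \<in> rational_frequencies \<longleftrightarrow> (\<forall>i. \<exists>q. s $ i = pi * of_rat q)"
proof
  assume "\<forall>i. \<exists>q. s $ i = pi * of_rat q"
  then obtain q where "\<And>i. s $ i = pi * of_rat (q i)" by metis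
  then have "s = (\<chi> i. pi * of_rat (q i))" by (simp add: vec_eq_iff)
  then show "s \<in> rational_frequencies" unfolding rational_frequencies_def by blast
qed (auto simp: rational_frequencies_def)

lemma rational_frequencies_add:
  assumes "s \<in> rational_frequencies" "t \<in> rational_frequencies"
  shows "s + t \<in> rational_frequencies"
  unfolding rational_frequencies_iff
proof
  fix i
  obtain q r where "s $ i = pi * of_rat q" "t $ i = pi * of_rat r"
    using assms unfolding rational_frequencies_iff by blast
  then have "(s + t) $ i = pi * of_rat (q + r)" by (simp add: of_rat_add distrib_left)
  then show "\<exists>q. (s + t) $ i = pi * of_rat q" by blast
qed

lemma rational_frequencies_minus:
  assumes "s \<in> rational_frequencies"
  shows "- s \<in> rational_frequencies"
  unfolding rational_frequencies_iff
proof
  fix i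
  obtain q where "s $ i = pi * of_rat q" using assms unfolding rational_frequencies_iff by blast
  then have "(- s) $ i = pi * of_rat (- q)" by (simp add: of_rat_minus)
  then show "\<exists>q. (- s) $ i = pi * of_rat q" by blast
qed

text \<open>The factor pi in \<open>rational_frequencies\<close> is chosen for this: the cube
  cosines of integer half-width L have frequency pi / (2 L) along the coordinate axes.\<close>

lemma rational_frequencies_basis:
  assumes "b \<in> Basis"
  shows "(pi / (2 * real (Suc n))) *\<^sub>R b \<in> rational_frequencies"
  unfolding rational_frequencies_iff
proof
  fix i
  obtain k where b: "b = axis k 1" using assms by (auto simp: Basis_vec_def)
  have "((pi / (2 * real (Suc n))) *\<^sub>R b) $ i = pi * of_rat (if i = k then 1 / (2 * of_nat (Suc n)) else 0)"
    by (simp add: b axis_def of_rat_divide of_rat_mult of_rat_add)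
  then show "\<exists>q. ((pi / (2 * real (Suc n))) *\<^sub>R b) $ i = pi * of_rat q" by blast
qed

text \<open>The matrix enters through its quadratic form: the identity with a second moment shows
  positive semidefiniteness, hence the Gaussian characteristic function, and matches it with the
  limits of the waves.\<close>

lemma urn_weak_limit:
  fixes \<mu>\<^sub>0 \<nu> :: "(real^'d) measure" and S :: "real^'d^'d"
  assumes urn: "urn_process M F \<mu>\<^sub>0 \<nu> \<rho>" and sq: "integrable \<nu> (\<lambda>y. (norm y)\<^sup>2)"
    and S: "transpose S = S" "\<And>s. s \<bullet> (S *v s) = (\<integral>y. (s \<bullet> y)\<^sup>2 \<partial>\<nu>)"
    and zero: "\<And>\<omega>. \<omega> \<in> space M \<Longrightarrow> \<mu> 0 \<omega> = \<mu>\<^sub>0"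
    and Suc: "\<And>n \<omega>. \<omega> \<in> space M \<Longrightarrow> \<mu> (Suc n) \<omega> = add_measure (\<mu> n \<omega>) (\<rho> n \<omega>)"
    and m: "m = (\<integral>y. y \<partial>\<nu>)"
  shows "AE \<omega> in M. weakly_converges
    (\<lambda>n. Theta_map (sqrt (ln (real n))) (ln (real n) *\<^sub>R m) (normalize_measure (\<mu> n \<omega>))) (centered_normal S)"
proof -
  interpret urn_process M F \<mu>\<^sub>0 \<nu> \<rho> by (rule urn)
  interpret urn_process_square_integrable M F \<mu>\<^sub>0 \<nu> \<rho> by unfold_locales (rule sq)
  have drift: "drift = m" by (simp add: drift_def m)
  let ?v = "\<lambda>s. \<integral>y. (s \<bullet> y)\<^sup>2 \<partial>\<nu>"
  let ?D = "rational_frequencies :: (real^'d) set"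
  let ?G = "centered_normal S"
  interpret G: prob_space ?G by (rule prob_space_centered_normal)
  have char: "(CLINT x|?G. iexp (s \<bullet> x)) = complex_of_real (exp (- ?v s / 2))" for s
    unfolding S(2)[symmetric] by (rule char_centered_normal[OF S(1)]) (simp add: S(2))
  have intG: "integrable ?G (\<lambda>x. iexp (s \<bullet> x))" for s
    by (intro G.integrable_const_bound[where B = 1]) (auto simp: sets_centered_normal cong: measurable_cong_sets)
  have G_cos: "(\<integral>x. cos (s \<bullet> x) \<partial>?G) = exp (- ?v s / 2)" and G_sin: "(\<integral>x. sin (s \<bullet> x) \<partial>?G) = 0" for s
    using integral_Re[OF intG, of s] integral_Im[OF intG, of s] unfolding char by (simp_all add: Re_exp Im_exp)
  have w1: "wave 1 s x = cos (s \<bullet> x)" and w2: "wave (- \<i>) s x = sin (s \<bullet> x)" for s x :: "real^'d"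
    by (simp_all add: wave_def Re_exp Im_exp)
  have "AE \<omega> in M. \<forall>s\<in>?D. (\<lambda>n. mean n (\<lambda>x. wave 1 s (rescale drift n x)) \<omega>) \<longlonglongrightarrow> exp (- ?v s / 2)"
    unfolding AE_ball_countable[OF countable_rational_frequencies]
  proof
    show "AE \<omega> in M. (\<lambda>n. mean n (\<lambda>x. wave 1 s (rescale drift n x)) \<omega>) \<longlonglongrightarrow> exp (- ?v s / 2)" for s
      using mean_wave_tendsto[of 1 s] by simp
  qed
  moreover have "AE \<omega> in M. \<forall>s\<in>?D. (\<lambda>n. mean n (\<lambda>x. wave (- \<i>) s (rescale drift n x)) \<omega>) \<longlonglongrightarrow> 0"
    unfolding AE_ball_countable[OF countable_rational_frequencies]
  proof
    show "AE \<omega> in M. (\<lambda>n. mean n (\<lambda>x. wave (- \<i>) s (rescale drift n x)) \<omega>) \<longlonglongrightarrow> 0" for s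
      using mean_wave_tendsto[of "- \<i>" s] by simp
  qed
  ultimately show ?thesis using tight_sample_time AE_space
  proof eventually_elim
    case (elim \<omega>)
    have "prob_space (normalize_measure (\<mu> n \<omega>)) \<and> sets (normalize_measure (\<mu> n \<omega>)) = sets borel \<and>
        (\<forall>f. bounded_borel f \<longrightarrow> (\<integral>x. f x \<partial>normalize_measure (\<mu> n \<omega>)) = mean n f \<omega>)" for n
      using urn_composition[where \<mu> = "\<lambda>k. \<mu> k \<omega>" and \<rho> = \<rho> and \<omega> = \<omega>, OF _ _ _ increment Suc[OF elim(4)]] init
      unfolding zero[OF elim(4)] by blast
    then have comp: "prob_space (normalize_measure (\<mu> n \<omega>))" "sets (normalize_measure (\<mu> n \<omega>)) = sets borel"
        "bounded_borel f \<Longrightarrow> (\<integral>x. f x \<partial>normalize_measure (\<mu> n \<omega>)) = mean n f \<omega>" for n f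
      by blast+
    define N where "N n = Theta_map (sqrt (ln (real n))) (ln (real n) *\<^sub>R m) (normalize_measure (\<mu> n \<omega>))" for n
    have N: "N n = distr (normalize_measure (\<mu> n \<omega>)) borel (rescale drift n)" for n
      unfolding N_def Theta_map_rescale drift ..
    have rm: "rescale drift n \<in> borel_measurable (normalize_measure (\<mu> n \<omega>))" for n
      by (simp cong: measurable_cong_sets add: comp(2))
    have N_int: "(\<integral>x. f x \<partial>N n) = mean n (\<lambda>x. f (rescale drift n x)) \<omega>" if "bounded_borel f" for f n
      unfolding N integral_distr[OF rm bounded_borel_measurable[OF that]] by (rule comp(3)[OF bounded_borel_rescale[OF that]])
    have N_prob: "prob_space (N n)" for n
      unfolding N by (rule prob_space.prob_space_distr[OF comp(1) rm])
    have N_sets: "sets (N n) = sets borel" for n by (simp add: N)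
    have "weakly_converges N ?G"
    proof (rule weakly_converges_if_trig_tight[OF N_prob N_sets prob_space_centered_normal sets_centered_normal
          rational_frequencies_add rational_frequencies_minus rational_frequencies_basis])
      show "(\<lambda>n. \<integral>x. cos (s \<bullet> x) \<partial>N n) \<longlonglongrightarrow> (\<integral>x. cos (s \<bullet> x) \<partial>?G)" if "s \<in> ?D" for s
        using elim(1) that N_int[OF bounded_borel_wave, of _ 1 s] unfolding w1 G_cos by auto
      show "(\<lambda>n. \<integral>x. sin (s \<bullet> x) \<partial>N n) \<longlonglongrightarrow> (\<integral>x. sin (s \<bullet> x) \<partial>?G)" if "s \<in> ?D" for s
        using elim(2) that N_int[OF bounded_borel_wave, of _ "- \<i>" s] unfolding w2 G_sin by auto
      show "\<exists>R. \<forall>\<^sub>F n in sequentially. measure (N n) {x. norm x > R} < \<epsilon>" if "\<epsilon> > 0" for \<epsilon>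
      proof -
        obtain R where R: "R > 0" "\<forall>\<^sub>F n in sequentially. mean n (\<lambda>x. trunc_norm R (rescale drift n x)) \<omega> < \<epsilon>"
          using tight_all_times[OF elim(3)] \<open>\<epsilon> > 0\<close> unfolding tight_at_def by blast
        note bt = bounded_borel_trunc_norm[OF R(1)]
        have "measure (N n) {x. norm x > R} \<le> mean n (\<lambda>x. trunc_norm R (rescale drift n x)) \<omega>" for n
        proof -
          interpret N: prob_space "N n" by (rule N_prob)
          have sp: "space (N n) = UNIV" using sets_eq_imp_space_eq[OF N_sets] by simp
          have A: "{x. norm x > R} \<in> sets (N n)" unfolding N_sets by measurable
          \<comment> \<open>The tail indicator lies below the truncated norm, so
            \<open>tight_at\<close> yields tightness in the usual sense.\<close>
          have "measure (N n) {x. norm x > R} = (\<integral>x. indicator {x. norm x > R} x \<partial>N n)" by (simp add: sp)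
          also have "\<dots> \<le> (\<integral>x. trunc_norm R x \<partial>N n)"
          proof (rule integral_mono)
            show "integrable (N n) (indicator {x. norm x > R} :: _ \<Rightarrow> real)"
              using A by (simp add: integrable_real_indicator less_top[symmetric])
            show "integrable (N n) (trunc_norm R)"
              by (rule bounded_borel_integrable[OF bt N.finite_measure_axioms N_sets])
            show "indicator {x. norm x > R} x \<le> trunc_norm R x" for x :: "real^'d"
              using R(1) by (auto simp: indicator_def trunc_norm_def)
          qed
          also have "\<dots> = mean n (\<lambda>x. trunc_norm R (rescale drift n x)) \<omega>" by (rule N_int[OF bt])
          finally show ?thesis .
        qed
        with R(2) have "\<forall>\<^sub>F n in sequentially. measure (N n) {x. norm x > R} < \<epsilon>"
          by (auto elim!: eventually_mono intro: le_less_trans)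
        then show ?thesis ..
      qed
    qed
    then show ?case unfolding N_def .
  qed
qed

text \<open>Expanding the square of s \<bullet> y into coordinates; each mixed product of
  coordinates is integrable because it is dominated by the squared norm.\<close>

lemma second_moment_matrix_quadratic_form:
  fixes \<eta> :: "'p \<Rightarrow> real^'d"
  assumes \<eta>: "\<eta> \<in> borel_measurable P" and sq: "integrable P (\<lambda>\<omega>. (norm (\<eta> \<omega>))\<^sup>2)"
  shows "s \<bullet> (second_moment_matrix P \<eta> *v s) = (\<integral>y. (s \<bullet> y)\<^sup>2 \<partial>distr P borel \<eta>)"
proof -
  have int: "integrable P (\<lambda>\<omega>. \<eta> \<omega> $ i * \<eta> \<omega> $ j)" for i j
  proof (rule Bochner_Integration.integrable_bound[OF sq])
    show "AE \<omega> in P. norm (\<eta> \<omega> $ i * \<eta> \<omega> $ j) \<le> norm ((norm (\<eta> \<omega>))\<^sup>2)"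
    proof (rule AE_I2)
      fix \<omega>
      have "\<bar>\<eta> \<omega> $ i\<bar> * \<bar>\<eta> \<omega> $ j\<bar> \<le> norm (\<eta> \<omega>) * norm (\<eta> \<omega>)"
        by (intro mult_mono component_le_norm_cart) auto
      then show "norm (\<eta> \<omega> $ i * \<eta> \<omega> $ j) \<le> norm ((norm (\<eta> \<omega>))\<^sup>2)"
        by (simp add: abs_mult power2_eq_square)
    qed
    have "(\<lambda>\<omega>. (\<eta> \<omega> \<bullet> axis i 1) * (\<eta> \<omega> \<bullet> axis j 1)) \<in> borel_measurable P" using \<eta> by measurable
    then show "(\<lambda>\<omega>. \<eta> \<omega> $ i * \<eta> \<omega> $ j) \<in> borel_measurable P" by (simp add: inner_axis)
  qed
  have "(\<integral>y. (s \<bullet> y)\<^sup>2 \<partial>distr P borel \<eta>) = (\<integral>\<omega>. (s \<bullet> \<eta> \<omega>)\<^sup>2 \<partial>P)"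
    by (rule integral_distr[OF \<eta>]) measurable
  also have "\<dots> = (\<integral>\<omega>. (\<Sum>i\<in>UNIV. \<Sum>j\<in>UNIV. s $ i * s $ j * (\<eta> \<omega> $ i * \<eta> \<omega> $ j)) \<partial>P)"
    by (simp add: inner_vec_def power2_eq_square sum_product mult_ac)
  also have "\<dots> = (\<Sum>i\<in>UNIV. \<Sum>j\<in>UNIV. s $ i * s $ j * (\<integral>\<omega>. \<eta> \<omega> $ i * \<eta> \<omega> $ j \<partial>P))"
    using int by (simp add: Bochner_Integration.integral_sum)
  also have "\<dots> = s \<bullet> (second_moment_matrix P \<eta> *v s)"
    by (simp add: inner_vec_def matrix_vector_mult_def second_moment_matrix_def sum_distrib_left mult_ac)
  finally show ?thesis by simp
qed

lemma transpose_second_moment_matrix: "transpose (second_moment_matrix P \<eta>) = second_moment_matrix P \<eta>"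
  by (simp add: second_moment_matrix_def transpose_def vec_eq_iff mult.commute)

theorem theorem1p1:
  fixes P :: "'p measure" and \<eta> :: "'p \<Rightarrow> real^'d" and m :: "real^'d" and \<mu>\<^sub>0 :: "(real^'d) measure"
  assumes "prob_space P"
    and "\<eta> \<in> borel_measurable P"
    and "integrable P (\<lambda>\<omega>. (norm (\<eta> \<omega>))\<^sup>2)"
    and "m = (\<integral>\<omega>. \<eta> \<omega> \<partial>P)"
    and "sets \<mu>\<^sub>0 = sets borel"
    and "finite_measure \<mu>\<^sub>0"
    and "emeasure \<mu>\<^sub>0 (space \<mu>\<^sub>0) \<noteq> 0"
  shows "(\<forall>(M :: 'w measure) \<mu>. sbarw_urn M \<mu>\<^sub>0 (distr P borel \<eta>) \<mu> \<longrightarrow>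
           (AE \<omega> in M. weakly_converges
              (\<lambda>n. Theta_map (sqrt (ln (real n))) (ln (real n) *\<^sub>R m) (normalize_measure (\<mu> n \<omega>)))
              (centered_normal (second_moment_matrix P \<eta>)))) \<and>
         (\<forall>(M :: 'w measure) \<mu>. darw_urn M \<mu>\<^sub>0 (distr P borel \<eta>) \<mu> \<longrightarrow>
           (AE \<omega> in M. weakly_converges
              (\<lambda>n. Theta_map (sqrt (ln (real n))) (ln (real n) *\<^sub>R m) (normalize_measure (\<mu> n \<omega>)))
              (centered_normal (second_moment_matrix P \<eta>))))"
proof -
  \<comment> \<open>Both urns see \<eta> only through its law, so the moments and the quadratic form
    are transferred to \<nu>.\<close>
  define \<nu> where "\<nu> = distr P borel \<eta>"
  have \<nu>: "prob_space \<nu>" "sets \<nu> = sets borel"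
    unfolding \<nu>_def by (rule prob_space.prob_space_distr[OF assms(1,2)]) simp
  have sq: "integrable \<nu> (\<lambda>y. (norm y)\<^sup>2)"
    unfolding \<nu>_def using assms(2,3) by (subst integrable_distr_eq) auto
  have m: "m = (\<integral>y. y \<partial>\<nu>)"
    unfolding \<nu>_def assms(4) using assms(2) by (subst integral_distr) auto
  note S = transpose_second_moment_matrix[of P \<eta>]
    second_moment_matrix_quadratic_form[OF assms(2,3), folded \<nu>_def]
  interpret \<mu>\<^sub>0: finite_measure \<mu>\<^sub>0 by (rule assms(6))
  have \<mu>\<^sub>0: "finite_measure \<mu>\<^sub>0" "sets \<mu>\<^sub>0 = sets borel" "measure \<mu>\<^sub>0 UNIV > 0"
    using assms(5-7) sets_eq_imp_space_eq[OF assms(5)]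
    by (auto simp: \<mu>\<^sub>0.emeasure_eq_measure zero_less_measure_iff)
  let ?concl = "\<lambda>M \<mu>. AE \<omega> in M. weakly_converges
    (\<lambda>n. Theta_map (sqrt (ln (real n))) (ln (real n) *\<^sub>R m) (normalize_measure (\<mu> n \<omega>)))
    (centered_normal (second_moment_matrix P \<eta>))"
  show ?thesis unfolding \<nu>_def[symmetric]
  proof (intro conjI allI impI)
    fix M :: "'w measure" and \<mu> assume "sbarw_urn M \<mu>\<^sub>0 \<nu> \<mu>"
    then show "?concl M \<mu>"
      unfolding sbarw_urn_def
    proof (elim conjE exE)
      fix X e :: "nat \<Rightarrow> 'w \<Rightarrow> real^'d"
      assume M: "prob_space M"
        and Xe: "\<forall>n. X n \<in> borel_measurable M \<and> e n \<in> borel_measurable M"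
        and zero: "\<forall>\<omega>\<in>space M. \<mu> 0 \<omega> = \<mu>\<^sub>0"
        and law: "\<forall>n. has_cond_law M (sigma_rv M (X ` {..<n} \<union> e ` {..<n})) (X n) (\<lambda>\<omega>. normalize_measure (\<mu> n \<omega>))"
        and offset: "\<forall>n. distr M borel (e n) = \<nu>"
        and ind: "\<forall>n. prob_space.indep_set M (sets (sigma_rv M {e n})) (sets (sigma_rv M (X ` {..n} \<union> e ` {..<n})))"
        and Suc: "\<forall>n. \<forall>\<omega>\<in>space M. \<mu> (Suc n) \<omega> = add_measure (\<mu> n \<omega>) (return borel (X n \<omega> + e n \<omega>))"
      have X: "X n \<in> borel_measurable M" and e: "e n \<in> borel_measurable M" for n using Xe by simp_all
      have "urn_process M (\<lambda>n. sigma_rv M (X ` {..<n} \<union> e ` {..<n})) \<mu>\<^sub>0 \<nu> (\<lambda>n \<omega>. return borel (X n \<omega> + e n \<omega>))"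
        by (rule urn_process_sbarw[OF M \<mu>\<^sub>0 \<nu> X e bspec[OF zero] spec[OF law] spec[OF offset] spec[OF ind] bspec[OF spec[OF Suc]]])
      then show ?thesis
        by (rule urn_weak_limit[OF _ sq S bspec[OF zero] bspec[OF spec[OF Suc]] m])
    qed
  next
    fix M :: "'w measure" and \<mu> assume "darw_urn M \<mu>\<^sub>0 \<nu> \<mu>"
    then show "?concl M \<mu>"
      unfolding darw_urn_def
    proof (elim conjE exE)
      fix X :: "nat \<Rightarrow> 'w \<Rightarrow> real^'d"
      assume M: "prob_space M" and X: "\<forall>n. X n \<in> borel_measurable M"
        and zero: "\<forall>\<omega>\<in>space M. \<mu> 0 \<omega> = \<mu>\<^sub>0"
        and law: "\<forall>n. has_cond_law M (sigma_rv M (X ` {..<n})) (X n) (\<lambda>\<omega>. normalize_measure (\<mu> n \<omega>))"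
        and Suc: "\<forall>n. \<forall>\<omega>\<in>space M. \<mu> (Suc n) \<omega> = add_measure (\<mu> n \<omega>) (distr \<nu> borel (\<lambda>y. X n \<omega> + y))"
      have "urn_process M (\<lambda>n. sigma_rv M (X ` {..<n})) \<mu>\<^sub>0 \<nu> (\<lambda>n \<omega>. distr \<nu> borel (\<lambda>y. X n \<omega> + y))"
        by (rule urn_process_darw[OF M \<mu>\<^sub>0 \<nu> spec[OF X] bspec[OF zero] spec[OF law] bspec[OF spec[OF Suc]]])
      then show ?thesis
        by (rule urn_weak_limit[OF _ sq S bspec[OF zero] bspec[OF spec[OF Suc]] m])
    qed
  qed
qed

end
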